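(* Let $\Bbbk$ be a commutative ring, let $t\in\Bbbk$, and let $k,l$ be nonnegative integers. The $\Bbbk$-module $\mathrm{Hom}_{\mathcal{R}(t)}(k,l)$ in the rook category $\mathcal{R}(t)$ has a linear basis given by all rook diagrams of type $\binom{l}{k}$. (That is: each rook diagram $D$ of type $\binom{l}{k}$ is represented by a morphism of $\mathcal{R}(t)$, this morphism is independent of the choice of representative, and the family of these morphisms, indexed by the rook diagrams of type $\binom{l}{k}$, is a $\Bbbk$-basis of $\mathrm{Hom}_{\mathcal{R}(t)}(k,l)$.)
   Context: Partition diagrams. A partition of type $\binom{l}{k}$, written $D\colon k\to l$, is a set partition of $\{1,\dots,k,1',\dots,l'\}$; its elements are called blocks. It is drawn as a partition diagram with $k$ vertices $1,\dots,k$ (left to right) in the bottom row and $l$ vertices $1',\dots,l'$ (left to right) in the top row, with edges chosen so that the connected components are the blocks; diagrams giving the same set partition are identified. $D$ is a rook diagram if all blocks have size at most 2 and any two distinct vertices in the same block lie in distinct rows. Partition category. $\mathcal{P}ar(t)$ is the strict $\Bbbk$-linear monoidal category with objects the nonnegative integers, $\mathrm{Hom}(k,l)$ the free $\Bbbk$-module on partitions of type $\binom{l}{k}$, composition $D\circ D'=t^{\alpha(D,D')}D\star D'$ extended bilinearly, where, stacking $D\colon k\to l$ on top of $D'\colon m\to k$, $\alpha(D,D')$ is the number of connected components all of whose vertices are in the middle row, and $D\star D'\colon m\to l$ is the partition in which vertices lie in the same block iff the corresponding top/bottom vertices are connected in the stacked diagram; tensor product is $k\otimes l=k+l$ on objects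 (unit object $0$) and horizontal juxtaposition ($D$ on the left, $D'$ on the right) for $D\otimes D'$. Rook category. $\mathcal{R}(t)$ is the strict $\Bbbk$-linear monoidal category generated by one object $1$ and morphisms $s\colon2\to2$, $\eta\colon0\to1$, $\varepsilon\colon1\to0$ (where $0$ is the unit object, $k$ is the $k$-fold tensor power of $1$, and $\mathrm{id}=\mathrm{id}_1$), subject to the relations $s\circ s=\mathrm{id}_2$; $(s\otimes\mathrm{id})\circ(\mathrm{id}\otimes s)\circ(s\otimes\mathrm{id})=(\mathrm{id}\otimes s)\circ(s\otimes\mathrm{id})\circ(\mathrm{id}\otimes s)$; $s\circ(\eta\otimes\mathrm{id})=\mathrm{id}\otimes\eta$; $s\circ(\mathrm{id}\otimes\eta)=\eta\otimes\mathrm{id}$; $(\varepsilon\otimes\mathrm{id})\circ s=\mathrm{id}\otimes\varepsilon$; $(\mathrm{id}\otimes\varepsilon)\circ s=\varepsilon\otimes\mathrm{id}$; $\varepsilon\circ\eta=t\,\mathrm{id}_0$. Diagrams as morphisms. There is a canonical strict $\Bbbk$-linear monoidal functor $G\colon\mathcal{R}(t)\to\mathcal{P}ar(t)$ with $1\mapsto1$, $s\mapsto\{\{1,2'\},\{2,1'\}\}$, and $\eta,\varepsilon$ sent to the unique partitions of type $\binom10$, $\binom01$. A morphism of $\mathcal{R}(t)$ represents a rook diagram $D$ if it is obtained from the generators and identity morphisms by finitely many compositions and tensor products and its image under $G$ is $D$. A rook diagram is regarded as a morphism of $\mathcal{R}(t)$ via such a representing morphism. *)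

theory Defs
  imports "HOL-Algebra.Module" "HOL-Library.Disjoint_Sets"
begin

section \<open>Partition diagrams\<close>

datatype vertex = Bot nat | Top nat

definition diagram_vertices :: "nat \<Rightarrow> nat \<Rightarrow> vertex set" where
  "diagram_vertices k l = Bot ` {1..k} \<union> Top ` {1..l}"

text \<open>Partitions \<open>D: k \<rightarrow> l\<close>: \<open>k\<close> vertices in the bottom row, \<open>l\<close> in the top row.\<close>

definition partition_diagrams :: "nat \<Rightarrow> nat \<Rightarrow> vertex set set set" where
  "partition_diagrams k l = {D. partition_on (diagram_vertices k l) D}"

fun same_row :: "vertex \<Rightarrow> vertex \<Rightarrow> bool" where
  "same_row (Bot i) (Bot j) = True"
| "same_row (Top i) (Top j) = True"
| "same_row _ _ = False"

definition rook_diagrams :: "nat \<Rightarrow> nat \<Rightarrow> vertex set set set" where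
  "rook_diagrams k l = {D \<in> partition_diagrams k l.
     \<forall>B\<in>D. card B \<le> 2 \<and> (\<forall>u\<in>B. \<forall>v\<in>B. u \<noteq> v \<longrightarrow> \<not> same_row u v)}"

text \<open>Stacking \<open>D: k \<rightarrow> l\<close> on top of \<open>D': m \<rightarrow> k\<close>: the bottom row of \<open>D\<close> is identified with
  the top row of \<open>D'\<close>, forming the middle row.\<close>

datatype stacked_vertex = Lower nat | Middle nat | Upper nat

primrec place_above :: "vertex \<Rightarrow> stacked_vertex" where
  "place_above (Bot i) = Middle i"
| "place_above (Top i) = Upper i"

primrec place_below :: "vertex \<Rightarrow> stacked_vertex" where
  "place_below (Bot i) = Lower i"
| "place_below (Top i) = Middle i"

primrec place_outer :: "vertex \<Rightarrow> stacked_vertex" where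
  "place_outer (Bot i) = Lower i"
| "place_outer (Top i) = Upper i"

definition stack_edges :: "vertex set set \<Rightarrow> vertex set set \<Rightarrow> stacked_vertex rel" where
  "stack_edges D D' =
     (\<Union>B\<in>D. (place_above ` B) \<times> (place_above ` B)) \<union>
     (\<Union>B\<in>D'. (place_below ` B) \<times> (place_below ` B))"

definition stack_components :: "vertex set set \<Rightarrow> vertex set set \<Rightarrow> stacked_vertex set set" where
  "stack_components D D' =
     (place_above ` \<Union>D \<union> place_below ` \<Union>D') // (stack_edges D D')\<^sup>*"

definition middle_count :: "vertex set set \<Rightarrow> vertex set set \<Rightarrow> nat" where
  "middle_count D D' = card {C \<in> stack_components D D'. C \<subseteq> range Middle}"

definition diagram_star :: "vertex set set \<Rightarrow> vertex set set \<Rightarrow> vertex set set" where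
  "diagram_star D D' = {place_outer -` C | C. C \<in> stack_components D D'} - {{}}"

primrec shift_vertex :: "nat \<Rightarrow> nat \<Rightarrow> vertex \<Rightarrow> vertex" where
  "shift_vertex k l (Bot i) = Bot (k + i)"
| "shift_vertex k l (Top i) = Top (l + i)"

text \<open>Juxtaposition of \<open>D: k \<rightarrow> l\<close> (left) and \<open>D'\<close> (right).\<close>

definition diagram_tensor ::
    "nat \<Rightarrow> nat \<Rightarrow> vertex set set \<Rightarrow> vertex set set \<Rightarrow> vertex set set" where
  "diagram_tensor k l D D' = D \<union> (\<lambda>B. shift_vertex k l ` B) ` D'"

definition identity_diagram :: "nat \<Rightarrow> vertex set set" where
  "identity_diagram k = {{Bot i, Top i} | i. i \<in> {1..k}}"


section \<open>The partition category\<close>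

text \<open>An element of the free module on the partitions \<open>k \<rightarrow> l\<close> is encoded as its coefficient
  function, which is zero off \<^term>\<open>partition_diagrams k l\<close>; \<open>par_diagram R D\<close> is the basis
  vector of \<open>D\<close>.\<close>

definition par_diagram ::
    "('a, 'm) ring_scheme \<Rightarrow> vertex set set \<Rightarrow> vertex set set \<Rightarrow> 'a" where
  "par_diagram R D = (\<lambda>E. if E = D then \<one>\<^bsub>R\<^esub> else \<zero>\<^bsub>R\<^esub>)"

text \<open>Composition of \<open>f: k \<rightarrow> l\<close> and \<open>g: m \<rightarrow> k\<close>.\<close>

definition par_comp :: "('a, 'm) ring_scheme \<Rightarrow> 'a \<Rightarrow> nat \<Rightarrow> nat \<Rightarrow> nat \<Rightarrow>
    (vertex set set \<Rightarrow> 'a) \<Rightarrow> (vertex set set \<Rightarrow> 'a) \<Rightarrow> vertex set set \<Rightarrow> 'a" where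
  "par_comp R t m k l f g = (\<lambda>E.
     finsum R (\<lambda>(D, D'). f D \<otimes>\<^bsub>R\<^esub> g D' \<otimes>\<^bsub>R\<^esub> (t [^]\<^bsub>R\<^esub> middle_count D D'))
       {(D, D'). D \<in> partition_diagrams k l \<and> D' \<in> partition_diagrams m k \<and>
          diagram_star D D' = E})"

text \<open>Tensor product of \<open>f: k \<rightarrow> l\<close> and \<open>g: k' \<rightarrow> l'\<close>.\<close>

definition par_tensor :: "('a, 'm) ring_scheme \<Rightarrow> nat \<Rightarrow> nat \<Rightarrow> nat \<Rightarrow> nat \<Rightarrow>
    (vertex set set \<Rightarrow> 'a) \<Rightarrow> (vertex set set \<Rightarrow> 'a) \<Rightarrow> vertex set set \<Rightarrow> 'a" where
  "par_tensor R k l k' l' f g = (\<lambda>E.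
     finsum R (\<lambda>(D, D'). f D \<otimes>\<^bsub>R\<^esub> g D')
       {(D, D'). D \<in> partition_diagrams k l \<and> D' \<in> partition_diagrams k' l' \<and>
          diagram_tensor k l D D' = E})"


section \<open>The rook category\<close>

text \<open>The category is constructed from its presentation: its morphisms are the well-formed formal
  expressions in the generators modulo the smallest congruence that contains the axioms of a strict
  linear monoidal category and the defining relations. The objects are the natural numbers, with
  \<open>k \<otimes> l = k + l\<close>, so the tensor product of objects is strictly associative and unital.
  \<open>Comp f g\<close> stands for \<open>f \<circ> g\<close> (first \<open>g\<close>, then \<open>f\<close>).\<close>

datatype 'a rook_term =
    Ident nat
  | Swap
  | Eta
  | Eps
  | Comp "'a rook_term" "'a rook_term"
  | Tensor "'a rook_term" "'a rook_term"
  | Zero nat nat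
  | Add "'a rook_term" "'a rook_term"
  | Scale 'a "'a rook_term"

primrec source :: "'a rook_term \<Rightarrow> nat" where
  "source (Ident k) = k"
| "source Swap = 2"
| "source Eta = 0"
| "source Eps = 1"
| "source (Comp f g) = source g"
| "source (Tensor f g) = source f + source g"
| "source (Zero k l) = k"
| "source (Add f g) = source f"
| "source (Scale a f) = source f"

primrec target :: "'a rook_term \<Rightarrow> nat" where
  "target (Ident k) = k"
| "target Swap = 2"
| "target Eta = 1"
| "target Eps = 0"
| "target (Comp f g) = target f"
| "target (Tensor f g) = target f + target g"
| "target (Zero k l) = l"
| "target (Add f g) = target f"
| "target (Scale a f) = target f"

primrec wf_term :: "('a, 'm) ring_scheme \<Rightarrow> 'a rook_term \<Rightarrow> bool" where
  "wf_term R (Ident k) = True"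
| "wf_term R Swap = True"
| "wf_term R Eta = True"
| "wf_term R Eps = True"
| "wf_term R (Comp f g) = (wf_term R f \<and> wf_term R g \<and> source f = target g)"
| "wf_term R (Tensor f g) = (wf_term R f \<and> wf_term R g)"
| "wf_term R (Zero k l) = True"
| "wf_term R (Add f g) =
     (wf_term R f \<and> wf_term R g \<and> source f = source g \<and> target f = target g)"
| "wf_term R (Scale a f) = (a \<in> carrier R \<and> wf_term R f)"

definition rook_relations :: "'a \<Rightarrow> ('a rook_term \<times> 'a rook_term) set" where
  "rook_relations t =
     {(Comp Swap Swap, Ident 2),
      (Comp (Tensor Swap (Ident 1)) (Comp (Tensor (Ident 1) Swap) (Tensor Swap (Ident 1))),
       Comp (Tensor (Ident 1) Swap) (Comp (Tensor Swap (Ident 1)) (Tensor (Ident 1) Swap))),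
      (Comp Swap (Tensor Eta (Ident 1)), Tensor (Ident 1) Eta),
      (Comp Swap (Tensor (Ident 1) Eta), Tensor Eta (Ident 1)),
      (Comp (Tensor Eps (Ident 1)) Swap, Tensor (Ident 1) Eps),
      (Comp (Tensor (Ident 1) Eps) Swap, Tensor Eps (Ident 1)),
      (Comp Eps Eta, Scale t (Ident 0))}"

inductive rook_eq :: "('a, 'm) ring_scheme \<Rightarrow> 'a \<Rightarrow> 'a rook_term \<Rightarrow> 'a rook_term \<Rightarrow> bool"
  for R (structure) and t where
  \<comment> \<open>defining relations\<close>
  relation: "(f, g) \<in> rook_relations t \<Longrightarrow> rook_eq R t f g"
  \<comment> \<open>congruence\<close>
| refl: "wf_term R f \<Longrightarrow> rook_eq R t f f"
| sym: "rook_eq R t f g \<Longrightarrow> rook_eq R t g f"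
| trans: "rook_eq R t f g \<Longrightarrow> rook_eq R t g h \<Longrightarrow> rook_eq R t f h"
| cong_comp: "rook_eq R t f f' \<Longrightarrow> rook_eq R t g g' \<Longrightarrow> source f = target g \<Longrightarrow>
    rook_eq R t (Comp f g) (Comp f' g')"
| cong_tensor: "rook_eq R t f f' \<Longrightarrow> rook_eq R t g g' \<Longrightarrow>
    rook_eq R t (Tensor f g) (Tensor f' g')"
| cong_add: "rook_eq R t f f' \<Longrightarrow> rook_eq R t g g' \<Longrightarrow>
    source f = source g \<Longrightarrow> target f = target g \<Longrightarrow>
    rook_eq R t (Add f g) (Add f' g')"
| cong_scale: "a \<in> carrier R \<Longrightarrow> rook_eq R t f f' \<Longrightarrow> rook_eq R t (Scale a f) (Scale a f')"
  \<comment> \<open>category\<close>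
| comp_assoc: "wf_term R (Comp (Comp f g) h) \<Longrightarrow>
    rook_eq R t (Comp (Comp f g) h) (Comp f (Comp g h))"
| comp_id_left: "wf_term R f \<Longrightarrow> rook_eq R t (Comp (Ident (target f)) f) f"
| comp_id_right: "wf_term R f \<Longrightarrow> rook_eq R t (Comp f (Ident (source f))) f"
  \<comment> \<open>strict monoidal category\<close>
| tensor_assoc: "wf_term R f \<Longrightarrow> wf_term R g \<Longrightarrow> wf_term R h \<Longrightarrow>
    rook_eq R t (Tensor (Tensor f g) h) (Tensor f (Tensor g h))"
| tensor_unit_left: "wf_term R f \<Longrightarrow> rook_eq R t (Tensor (Ident 0) f) f"
| tensor_unit_right: "wf_term R f \<Longrightarrow> rook_eq R t (Tensor f (Ident 0)) f"
| tensor_id: "rook_eq R t (Tensor (Ident k) (Ident l)) (Ident (k + l))"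
| interchange: "wf_term R (Comp f g) \<Longrightarrow> wf_term R (Comp f' g') \<Longrightarrow>
    rook_eq R t (Tensor (Comp f g) (Comp f' g')) (Comp (Tensor f f') (Tensor g g'))"
  \<comment> \<open>the sets of morphisms are modules\<close>
| add_assoc: "wf_term R (Add (Add f g) h) \<Longrightarrow>
    rook_eq R t (Add (Add f g) h) (Add f (Add g h))"
| add_comm: "wf_term R (Add f g) \<Longrightarrow> rook_eq R t (Add f g) (Add g f)"
| add_zero: "wf_term R f \<Longrightarrow> rook_eq R t (Add f (Zero (source f) (target f))) f"
| add_inverse: "wf_term R f \<Longrightarrow>
    rook_eq R t (Add f (Scale (\<ominus> \<one>) f)) (Zero (source f) (target f))"
| scale_add_left: "a \<in> carrier R \<Longrightarrow> b \<in> carrier R \<Longrightarrow> wf_term R f \<Longrightarrow>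
    rook_eq R t (Scale (a \<oplus> b) f) (Add (Scale a f) (Scale b f))"
| scale_add_right: "a \<in> carrier R \<Longrightarrow> wf_term R (Add f g) \<Longrightarrow>
    rook_eq R t (Scale a (Add f g)) (Add (Scale a f) (Scale a g))"
| scale_scale: "a \<in> carrier R \<Longrightarrow> b \<in> carrier R \<Longrightarrow> wf_term R f \<Longrightarrow>
    rook_eq R t (Scale (a \<otimes> b) f) (Scale a (Scale b f))"
| scale_one: "wf_term R f \<Longrightarrow> rook_eq R t (Scale \<one> f) f"
  \<comment> \<open>composition and tensor product are bilinear\<close>
| comp_add_left: "wf_term R (Comp (Add f f') g) \<Longrightarrow>
    rook_eq R t (Comp (Add f f') g) (Add (Comp f g) (Comp f' g))"
| comp_add_right: "wf_term R (Comp f (Add g g')) \<Longrightarrow>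
    rook_eq R t (Comp f (Add g g')) (Add (Comp f g) (Comp f g'))"
| comp_scale_left: "a \<in> carrier R \<Longrightarrow> wf_term R (Comp f g) \<Longrightarrow>
    rook_eq R t (Comp (Scale a f) g) (Scale a (Comp f g))"
| comp_scale_right: "a \<in> carrier R \<Longrightarrow> wf_term R (Comp f g) \<Longrightarrow>
    rook_eq R t (Comp f (Scale a g)) (Scale a (Comp f g))"
| tensor_add_left: "wf_term R (Add f f') \<Longrightarrow> wf_term R g \<Longrightarrow>
    rook_eq R t (Tensor (Add f f') g) (Add (Tensor f g) (Tensor f' g))"
| tensor_add_right: "wf_term R f \<Longrightarrow> wf_term R (Add g g') \<Longrightarrow>
    rook_eq R t (Tensor f (Add g g')) (Add (Tensor f g) (Tensor f g'))"
| tensor_scale_left: "a \<in> carrier R \<Longrightarrow> wf_term R f \<Longrightarrow> wf_term R g \<Longrightarrow>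
    rook_eq R t (Tensor (Scale a f) g) (Scale a (Tensor f g))"
| tensor_scale_right: "a \<in> carrier R \<Longrightarrow> wf_term R f \<Longrightarrow> wf_term R g \<Longrightarrow>
    rook_eq R t (Tensor f (Scale a g)) (Scale a (Tensor f g))"

definition rook_class :: "('a, 'm) ring_scheme \<Rightarrow> 'a \<Rightarrow> 'a rook_term \<Rightarrow> 'a rook_term set" where
  "rook_class R t f = {g. rook_eq R t f g}"

text \<open>The Hom-module \<open>k \<rightarrow> l\<close>. The HOL-Algebra record type for modules extends that of rings; the
  two multiplicative fields play no role in \<^const>\<open>module\<close>.\<close>

definition rook_hom ::
    "('a, 'm) ring_scheme \<Rightarrow> 'a \<Rightarrow> nat \<Rightarrow> nat \<Rightarrow> ('a, 'a rook_term set) module" where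
  "rook_hom R t k l =
     \<lparr>carrier = {rook_class R t f | f. wf_term R f \<and> source f = k \<and> target f = l},
      mult = undefined,
      one = undefined,
      zero = rook_class R t (Zero k l),
      add = (\<lambda>X Y. \<Union>f\<in>X. \<Union>g\<in>Y. rook_class R t (Add f g)),
      smult = (\<lambda>a X. \<Union>f\<in>X. rook_class R t (Scale a f))\<rparr>"


section \<open>The functor to the partition category\<close>

primrec par_term ::
    "('a, 'm) ring_scheme \<Rightarrow> 'a \<Rightarrow> 'a rook_term \<Rightarrow> vertex set set \<Rightarrow> 'a" where
  "par_term R t (Ident k) = par_diagram R (identity_diagram k)"
| "par_term R t Swap = par_diagram R {{Bot 1, Top 2}, {Bot 2, Top 1}}"
| "par_term R t Eta = par_diagram R {{Top 1}}"
| "par_term R t Eps = par_diagram R {{Bot 1}}"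
| "par_term R t (Comp f g) =
     par_comp R t (source g) (source f) (target f) (par_term R t f) (par_term R t g)"
| "par_term R t (Tensor f g) =
     par_tensor R (source f) (target f) (source g) (target g) (par_term R t f) (par_term R t g)"
| "par_term R t (Zero k l) = (\<lambda>_. \<zero>\<^bsub>R\<^esub>)"
| "par_term R t (Add f g) = (\<lambda>D. par_term R t f D \<oplus>\<^bsub>R\<^esub> par_term R t g D)"
| "par_term R t (Scale a f) = (\<lambda>D. a \<otimes>\<^bsub>R\<^esub> par_term R t f D)"

text \<open>The value of the functor on a morphism is the common value of all expressions for it.\<close>

definition rook_to_par ::
    "('a, 'm) ring_scheme \<Rightarrow> 'a \<Rightarrow> 'a rook_term set \<Rightarrow> vertex set set \<Rightarrow> 'a" where
  "rook_to_par R t X = the_elem (par_term R t ` X)"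


section \<open>Diagrams as morphisms of the rook category\<close>

text \<open>Expressions built from generators and identities by composition and tensor product only.\<close>

primrec diagrammatic :: "'a rook_term \<Rightarrow> bool" where
  "diagrammatic (Ident k) = True"
| "diagrammatic Swap = True"
| "diagrammatic Eta = True"
| "diagrammatic Eps = True"
| "diagrammatic (Comp f g) = (diagrammatic f \<and> diagrammatic g)"
| "diagrammatic (Tensor f g) = (diagrammatic f \<and> diagrammatic g)"
| "diagrammatic (Zero k l) = False"
| "diagrammatic (Add f g) = False"
| "diagrammatic (Scale a f) = False"

definition represents :: "('a, 'm) ring_scheme \<Rightarrow> 'a \<Rightarrow> nat \<Rightarrow> nat \<Rightarrow>
    'a rook_term set \<Rightarrow> vertex set set \<Rightarrow> bool" where
  "represents R t k l X D \<longleftrightarrow>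
     X \<in> carrier (rook_hom R t k l) \<and> (\<exists>f\<in>X. diagrammatic f) \<and>
     rook_to_par R t X = par_diagram R D"

definition diagram_morphism :: "('a, 'm) ring_scheme \<Rightarrow> 'a \<Rightarrow> nat \<Rightarrow> nat \<Rightarrow>
    vertex set set \<Rightarrow> 'a rook_term set" where
  "diagram_morphism R t k l D = (THE X. represents R t k l X D)"


section \<open>Bases of modules\<close>

text \<open>A basis is a family rather than a subset: over the zero ring the family of a basis may
  fail to be injective.\<close>

definition module_basis ::
    "('a, 'm) ring_scheme \<Rightarrow> ('a, 'b, 'n) module_scheme \<Rightarrow> 'i set \<Rightarrow> ('i \<Rightarrow> 'b) \<Rightarrow> bool" where
  "module_basis R M I b \<longleftrightarrow>
     module R M \<and> b \<in> I \<rightarrow> carrier M \<and>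
     (\<forall>J c. finite J \<and> J \<subseteq> I \<and> c \<in> J \<rightarrow> carrier R \<and>
        (\<Oplus>\<^bsub>M\<^esub>i\<in>J. c i \<odot>\<^bsub>M\<^esub> b i) = \<zero>\<^bsub>M\<^esub> \<longrightarrow> (\<forall>i\<in>J. c i = \<zero>\<^bsub>R\<^esub>)) \<and>
     (\<forall>x\<in>carrier M. \<exists>J c. finite J \<and> J \<subseteq> I \<and> c \<in> J \<rightarrow> carrier R \<and>
        x = (\<Oplus>\<^bsub>M\<^esub>i\<in>J. c i \<odot>\<^bsub>M\<^esub> b i))"

end

theory Submission
  imports Defs
begin

text \<open>
  Every expression acts on the tensor powers of a free module with a distinguished basis vector
  that \<open>\<eta>\<close> picks out; this respects the defining relations. A rook diagram maps a word of distinct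
  ordinary letters to the word that records its edges, so different rook diagrams are linearly
  independent, and the coefficients of an expression in the partition category can be read off from
  its action. Hence they do not depend on the choice of the expression.

  For spanning, each rook diagram has a normal form that deals with the top vertices one after the
  other: an isolated vertex splits off \<open>\<eta>\<close>, and a joined vertex pulls its bottom partner to the
  front. Naturality of pulling a strand across others shows that the span of the normal forms is
  closed under composition with every generator.
\<close>

section \<open>A representation of the rook category\<close>

text \<open>The functor is given by sums over all partitions, and a direct check that it respects
  the monoidal axioms would need associativity of stacking, with its count of middle components, for
  arbitrary set partitions. Acting on functions of words avoids this: most axioms hold by unfolding,
  and stacking has to be understood only for rook diagrams, which are partial injections and hence
  words. There are infinitely many letters, so k distinct ordinary ones exist for every k.
  \<open>Eps\<close> is 1 on these so that an isolated bottom vertex leaves no trace in the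
  coefficient, and it is t on \<open>None\<close> because \<open>Comp Eps Eta\<close> has to act as
  t. Two diagrammatic expressions for one diagram are never transformed into each other. Once the
  normal forms span and their images are basis vectors of the partition category, a morphism is
  determined by its image, so uniqueness of representatives is a by-product. Coefficient functions
  are compared throughout, never elements counted, so the zero ring is no exception.\<close>

locale rook_presentation = cring R for R (structure) +
  fixes t :: 'a
  assumes t_closed [simp]: "t \<in> carrier R"

type_synonym word = "nat option list"

text \<open>Expressions act contravariantly on functions of words, that is, on the duals of the tensor powers
  of the free module on the letters. The letter \<open>None\<close> is the vector \<open>\<eta>\<close>, and \<open>\<epsilon>\<close> takes the
  value \<open>t\<close> on \<open>None\<close> and \<open>1\<close> on all other letters. Acting on functions turns composition into
  composition of maps, so no sum over intermediate words is needed.\<close>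

primrec sem :: "('a, 'm) ring_scheme \<Rightarrow> 'a \<Rightarrow> 'a rook_term \<Rightarrow> (word \<Rightarrow> 'a) \<Rightarrow> word \<Rightarrow> 'a" where
  "sem R t (Ident k) \<phi> w = \<phi> w"
| "sem R t Swap \<phi> w = \<phi> (rev w)"
| "sem R t Eta \<phi> w = \<phi> [None]"
| "sem R t Eps \<phi> w = (if hd w = None then t \<otimes>\<^bsub>R\<^esub> \<phi> [] else \<phi> [])"
| "sem R t (Comp f g) \<phi> w = sem R t g (sem R t f \<phi>) w"
| "sem R t (Tensor f g) \<phi> w =
     sem R t f (\<lambda>u. sem R t g (\<lambda>v. \<phi> (u @ v)) (drop (source f) w)) (take (source f) w)"
| "sem R t (Zero k l) \<phi> w = \<zero>\<^bsub>R\<^esub>"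
| "sem R t (Add f g) \<phi> w = sem R t f \<phi> w \<oplus>\<^bsub>R\<^esub> sem R t g \<phi> w"
| "sem R t (Scale a f) \<phi> w = a \<otimes>\<^bsub>R\<^esub> sem R t f \<phi> w"

text \<open>Functions are total on words, but only words of the right length are meaningful. This
  lets the argument function be replaced by one that agrees with it on those words, as a congruence
  rule for rewriting under an action.\<close>

lemma sem_local:
  assumes "wf_term R f" "length w = source f" "\<And>v. length v = target f \<Longrightarrow> \<phi> v = \<psi> v"
  shows "sem R t f \<phi> w = sem R t f \<psi> w"
  using assms
proof (induction f arbitrary: \<phi> \<psi> w)
  case (Tensor f g)
  have "sem R t g (\<lambda>v. \<phi> (u @ v)) (drop (source f) w) = sem R t g (\<lambda>v. \<psi> (u @ v)) (drop (source f) w)"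
    if "length u = target f" for u
    using Tensor.prems that by (intro Tensor.IH(2)) auto
  then show ?case using Tensor.prems by (simp, intro Tensor.IH(1)) auto
next
  case (Comp f g)
  have "sem R t f \<phi> v = sem R t f \<psi> v" if "length v = target g" for v
    using Comp.prems that by (intro Comp.IH(1)) auto
  then show ?case using Comp.prems by (simp, intro Comp.IH(2)) auto
next
  case (Add f g)
  have "sem R t f \<phi> w = sem R t f \<psi> w" "sem R t g \<phi> w = sem R t g \<psi> w"
    using Add.prems by (intro Add.IH; simp)+
  then show ?case by simp
next
  case (Scale a f)
  have "sem R t f \<phi> w = sem R t f \<psi> w"
    using Scale.prems by (intro Scale.IH; simp)
  then show ?case by simp
qed simp_all

context rook_presentation
begin

abbreviation sm where "sm \<equiv> sem R t"

section \<open>Linearity and commutation of the action\<close>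

lemma sem_closed [simp]:
  "wf_term R f \<Longrightarrow> (\<And>v. \<phi> v \<in> carrier R) \<Longrightarrow> sm f \<phi> w \<in> carrier R"
  by (induction f arbitrary: \<phi> w) auto

lemma sem_zero: "wf_term R f \<Longrightarrow> sm f (\<lambda>v. \<zero>) w = \<zero>"
proof (induction f arbitrary: w)
  case (Comp f g)
  then have "sm f (\<lambda>v. \<zero>) = (\<lambda>w. \<zero>)" by (intro ext) simp
  with Comp show ?case by simp
qed auto

lemma sem_add:
  assumes "wf_term R f" "\<And>v. \<phi> v \<in> carrier R" "\<And>v. \<psi> v \<in> carrier R"
  shows "sm f (\<lambda>v. \<phi> v \<oplus> \<psi> v) w = sm f \<phi> w \<oplus> sm f \<psi> w"
  using assms
proof (induction f arbitrary: \<phi> \<psi> w)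
  case (Comp f g)
  then have "sm f (\<lambda>v. \<phi> v \<oplus> \<psi> v) = (\<lambda>w. sm f \<phi> w \<oplus> sm f \<psi> w)" by (intro ext) simp
  with Comp show ?case by simp
next
  case (Tensor f g)
  then show ?case by simp
qed (auto simp: r_distr a_ac)

lemma sem_scale:
  assumes "wf_term R f" "\<And>v. \<phi> v \<in> carrier R" "a \<in> carrier R"
  shows "sm f (\<lambda>v. a \<otimes> \<phi> v) w = a \<otimes> sm f \<phi> w"
  using assms
proof (induction f arbitrary: \<phi> w)
  case (Comp f g)
  then have "sm f (\<lambda>v. a \<otimes> \<phi> v) = (\<lambda>w. a \<otimes> sm f \<phi> w)" by (intro ext) simp
  with Comp show ?case by simp
next
  case (Tensor f g)
  then show ?case by simp
qed (auto simp: r_distr m_lcomm)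

text \<open>Each action is a finite linear combination of evaluations, and the two act on separate
  variables, so this is an exchange of finite sums. In the induction over f the linear cases are the
  linearity of the action of g. It is the content of the interchange law.\<close>

lemma sem_commute:
  assumes "wf_term R f" "wf_term R g" "\<And>u v. \<chi> u v \<in> carrier R"
    "length w = source f" "length w' = source g"
  shows "sm f (\<lambda>u. sm g (\<chi> u) w') w = sm g (\<lambda>v. sm f (\<lambda>u. \<chi> u v) w) w'"
  using assms
proof (induction f arbitrary: \<chi> w)
  case (Comp f1 f2)
  have "sm (Comp f1 f2) (\<lambda>u. sm g (\<chi> u) w') w
      = sm f2 (sm f1 (\<lambda>u. sm g (\<chi> u) w')) w" by simp
  also have "\<dots> = sm f2 (\<lambda>x. sm g (\<lambda>v. sm f1 (\<lambda>u. \<chi> u v) x) w') w"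
    using Comp.prems by (intro sem_local Comp.IH) auto
  also have "\<dots> = sm g (\<lambda>v. sm f2 (\<lambda>x. sm f1 (\<lambda>u. \<chi> u v) x) w) w'"
    using Comp.prems by (intro Comp.IH(2)) auto
  finally show ?case by simp
next
  case (Tensor f1 f2)
  let ?w1 = "take (source f1) w" and ?w2 = "drop (source f1) w"
  have "sm (Tensor f1 f2) (\<lambda>u. sm g (\<chi> u) w') w
      = sm f1 (\<lambda>x. sm f2 (\<lambda>y. sm g (\<chi> (x @ y)) w') ?w2) ?w1" by simp
  also have "\<dots> = sm f1 (\<lambda>x. sm g (\<lambda>v. sm f2 (\<lambda>y. \<chi> (x @ y) v) ?w2) w') ?w1"
    using Tensor.prems by (intro sem_local Tensor.IH(2)) auto
  also have "\<dots> = sm g (\<lambda>v. sm f1 (\<lambda>x. sm f2 (\<lambda>y. \<chi> (x @ y) v) ?w2) ?w1) w'"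
    using Tensor.prems by (intro Tensor.IH(1)) auto
  finally show ?case by simp
qed (auto simp: sem_zero sem_add sem_scale)

lemma sem_ext:
  "sm (Add f g) \<phi> = (\<lambda>w. sm f \<phi> w \<oplus> sm g \<phi> w)"
  "sm (Scale a f) \<phi> = (\<lambda>w. a \<otimes> sm f \<phi> w)"
  "sm (Comp f g) \<phi> = sm g (sm f \<phi>)"
  "sm (Ident k) \<phi> = \<phi>"
  by (auto intro!: ext)

section \<open>Soundness of the representation\<close>

lemma rook_eq_typing:
  "rook_eq R t f g \<Longrightarrow> wf_term R f \<and> wf_term R g \<and> source f = source g \<and> target f = target g"
  by (induction rule: rook_eq.induct) (auto simp: rook_relations_def)

text \<open>Only interchange needs an exchange of two actions. The congruence rules rest on
  locality, and the remaining axioms follow by unfolding and linearity.\<close>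

theorem sem_sound:
  assumes "rook_eq R t f g" "\<And>v. \<phi> v \<in> carrier R" "length w = source f"
  shows "sm f \<phi> w = sm g \<phi> w"
  using assms
proof (induction arbitrary: \<phi> w rule: rook_eq.induct)
  \<comment> \<open>Words of length at most three are written out letter by letter; each relation
    then compares values of \<phi> at explicit words.\<close>
  case (relation f g)
  then show ?case
    by (auto simp: rook_relations_def length_Suc_conv numeral_2_eq_2)
next
  case (sym f g)
  then show ?case using rook_eq_typing[OF sym.hyps] by (metis)
next
  case (trans f g h)
  then show ?case using rook_eq_typing[OF trans.hyps(1)] by (metis)
next
  case (cong_comp f f' g g')
  note ty = rook_eq_typing[OF cong_comp.hyps(1)] rook_eq_typing[OF cong_comp.hyps(2)]
  \<comment> \<open>The induction hypothesis for \<open>f\<close> speaks of words of length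
    \<open>source f\<close> only, so \<open>f\<close> is exchanged for \<open>f'\<close> under
    \<open>g\<close> by locality.\<close>
  have "sm g (sm f \<phi>) w = sm g (sm f' \<phi>) w"
    using cong_comp ty by (intro sem_local) auto
  also have "\<dots> = sm g' (sm f' \<phi>) w"
    using cong_comp ty by auto
  finally show ?case by simp
next
  case (cong_tensor f f' g g')
  note ty = rook_eq_typing[OF cong_tensor.hyps(1)] rook_eq_typing[OF cong_tensor.hyps(2)]
  let ?w1 = "take (source f) w" and ?w2 = "drop (source f) w"
  have "sm f (\<lambda>u. sm g (\<lambda>v. \<phi> (u @ v)) ?w2) ?w1 = sm f (\<lambda>u. sm g' (\<lambda>v. \<phi> (u @ v)) ?w2) ?w1"
    using cong_tensor ty by (intro sem_local) auto
  also have "\<dots> = sm f' (\<lambda>u. sm g' (\<lambda>v. \<phi> (u @ v)) ?w2) ?w1"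
    using cong_tensor ty by auto
  finally show ?case using ty by simp
next
  case (interchange f g f' g')
  let ?w1 = "take (source g) w" and ?w2 = "drop (source g) w"
  have "sm (Tensor (Comp f g) (Comp f' g')) \<phi> w
      = sm g (sm f (\<lambda>u. sm g' (sm f' (\<lambda>v. \<phi> (u @ v))) ?w2)) ?w1" by simp
  \<comment> \<open>\<open>g'\<close> acts on the right letters and is pulled out of the action of
    \<open>f\<close> on the left ones.\<close>
  also have "\<dots> = sm g (\<lambda>x. sm g' (\<lambda>y. sm f (\<lambda>u. sm f' (\<lambda>v. \<phi> (u @ v)) y) x) ?w2) ?w1"
    using interchange by (intro sem_local sem_commute) auto
  also have "\<dots> = sm g (\<lambda>x. sm g' (\<lambda>y. sm (Tensor f f') \<phi> (x @ y)) ?w2) ?w1"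
    using interchange by (intro sem_local) auto
  also have "\<dots> = sm (Comp (Tensor f f') (Tensor g g')) \<phi> w"
    by simp
  finally show ?case .
next
  case (tensor_assoc f g h)
  then show ?case by (simp add: take_drop add.commute)
next
  case (add_inverse f)
  then show ?case by (simp add: l_minus r_neg)
qed (auto simp: a_ac r_distr l_distr m_assoc sem_add sem_scale sem_ext)

end

section \<open>The rook category as a quotient\<close>

text \<open>Operations on classes are unions over representatives; a union with constant value
  expresses that they are well defined.\<close>

lemma UN_eq_const: "x \<in> A \<Longrightarrow> (\<And>y. y \<in> A \<Longrightarrow> F y = F x) \<Longrightarrow> (\<Union>y\<in>A. F y) = F x"
  by blast

lemma UN2_eq_const:
  "x \<in> A \<Longrightarrow> y \<in> B \<Longrightarrow> (\<And>u v. u \<in> A \<Longrightarrow> v \<in> B \<Longrightarrow> F u v = F x y) \<Longrightarrow>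
    (\<Union>u\<in>A. \<Union>v\<in>B. F u v) = F x y"
  by blast

context rook_presentation
begin

abbreviation cls where "cls \<equiv> rook_class R t"

lemma cls_eqI: "rook_eq R t f g \<Longrightarrow> cls f = cls g"
  unfolding rook_class_def by (rule Collect_cong) (metis rook_eq.sym rook_eq.trans)

lemma mem_cls_iff: "g \<in> cls f \<longleftrightarrow> rook_eq R t f g"
  by (simp add: rook_class_def)

lemma mem_cls: "wf_term R f \<Longrightarrow> f \<in> cls f"
  by (simp add: rook_class_def rook_eq.refl)

lemma cls_eq_iff: "wf_term R f \<Longrightarrow> wf_term R g \<Longrightarrow> cls f = cls g \<longleftrightarrow> rook_eq R t f g"
  by (metis (no_types, lifting) cls_eqI mem_cls mem_Collect_eq rook_class_def)

section \<open>Morphisms as classes of expressions\<close>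

definition mor where "mor X \<longleftrightarrow> (\<exists>f. wf_term R f \<and> X = cls f)"
text \<open>The choice of the representative is harmless, since congruent expressions have the same
  type.\<close>

definition src where "src X = source (SOME f. f \<in> X)" for X :: "'a rook_term set"
definition tgt where "tgt X = target (SOME f. f \<in> X)" for X :: "'a rook_term set"

text \<open>\<^const>\<open>rook_class\<close> is empty on ill-typed expressions, so no typing condition is needed here.\<close>

definition comp_class (infixl "\<cdot>" 65) where "X \<cdot> Y = (\<Union>f\<in>X. \<Union>g\<in>Y. cls (Comp f g))"
definition tensor_class (infixl "\<star>" 70) where "X \<star> Y = (\<Union>f\<in>X. \<Union>g\<in>Y. cls (Tensor f g))"
definition add_class (infixl "\<boxplus>" 55) where "X \<boxplus> Y = (\<Union>f\<in>X. \<Union>g\<in>Y. cls (Add f g))"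
definition scale_class (infixr "\<bullet>" 60) where "a \<bullet> X = (\<Union>f\<in>X. cls (Scale a f))"

abbreviation I where "I n \<equiv> cls (Ident n)"
abbreviation nul where "nul k l \<equiv> cls (Zero k l)"
abbreviation J where "J \<equiv> cls (Ident (Suc 0))"
abbreviation s where "s \<equiv> cls Swap"
abbreviation eta where "eta \<equiv> cls Eta"
abbreviation eps where "eps \<equiv> cls Eps"

lemma morE:
  assumes "mor X"
  obtains f where "wf_term R f" "X = cls f"
  using assms by (auto simp: mor_def)

lemma mor_cls [simp]: "wf_term R f \<Longrightarrow> mor (cls f)"
  by (auto simp: mor_def)

lemma rook_eq_some: "wf_term R f \<Longrightarrow> rook_eq R t f (SOME g. g \<in> cls f)"
  using someI[of "\<lambda>g. g \<in> cls f", OF mem_cls] by (simp add: rook_class_def)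

lemma src_cls [simp]: "wf_term R f \<Longrightarrow> src (cls f) = source f"
  and tgt_cls [simp]: "wf_term R f \<Longrightarrow> tgt (cls f) = target f"
  using rook_eq_typing[OF rook_eq_some] by (simp_all add: src_def tgt_def)

lemma comp_cls:
  assumes "wf_term R f" "wf_term R g" "source f = target g"
  shows "cls f \<cdot> cls g = cls (Comp f g)"
proof -
  have "cls (Comp f' g') = cls (Comp f g)" if "f' \<in> cls f" "g' \<in> cls g" for f' g'
    using that assms by (intro cls_eqI[symmetric] rook_eq.cong_comp) (simp_all add: mem_cls_iff)
  then show ?thesis
    unfolding comp_class_def using mem_cls[OF assms(1)] mem_cls[OF assms(2)] by (intro UN2_eq_const)
qed

lemma tensor_cls:
  assumes "wf_term R f" "wf_term R g"
  shows "cls f \<star> cls g = cls (Tensor f g)"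
proof -
  have "cls (Tensor f' g') = cls (Tensor f g)" if "f' \<in> cls f" "g' \<in> cls g" for f' g'
    using that assms by (intro cls_eqI[symmetric] rook_eq.cong_tensor) (simp_all add: mem_cls_iff)
  then show ?thesis
    unfolding tensor_class_def using mem_cls[OF assms(1)] mem_cls[OF assms(2)] by (intro UN2_eq_const)
qed

lemma add_cls:
  assumes "wf_term R f" "wf_term R g" "source f = source g" "target f = target g"
  shows "cls f \<boxplus> cls g = cls (Add f g)"
proof -
  have "cls (Add f' g') = cls (Add f g)" if "f' \<in> cls f" "g' \<in> cls g" for f' g'
    using that assms by (intro cls_eqI[symmetric] rook_eq.cong_add) (simp_all add: mem_cls_iff)
  then show ?thesis
    unfolding add_class_def using mem_cls[OF assms(1)] mem_cls[OF assms(2)] by (intro UN2_eq_const)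
qed

lemma scale_cls:
  assumes "wf_term R f" "a \<in> carrier R"
  shows "a \<bullet> cls f = cls (Scale a f)"
proof -
  have "cls (Scale a f') = cls (Scale a f)" if "f' \<in> cls f" for f'
    using that assms by (intro cls_eqI[symmetric] rook_eq.cong_scale) (simp_all add: mem_cls_iff)
  then show ?thesis
    unfolding scale_class_def using mem_cls[OF assms(1)] by (intro UN_eq_const)
qed

lemmas op_cls = comp_cls tensor_cls add_cls scale_cls

lemma mor_ops [simp]:
  "mor X \<Longrightarrow> mor Y \<Longrightarrow> src X = tgt Y \<Longrightarrow> mor (X \<cdot> Y)"
  "mor X \<Longrightarrow> mor Y \<Longrightarrow> src X = tgt Y \<Longrightarrow> src (X \<cdot> Y) = src Y"
  "mor X \<Longrightarrow> mor Y \<Longrightarrow> src X = tgt Y \<Longrightarrow> tgt (X \<cdot> Y) = tgt X"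
  "mor X \<Longrightarrow> mor Y \<Longrightarrow> mor (X \<star> Y)"
  "mor X \<Longrightarrow> mor Y \<Longrightarrow> src (X \<star> Y) = src X + src Y"
  "mor X \<Longrightarrow> mor Y \<Longrightarrow> tgt (X \<star> Y) = tgt X + tgt Y"
  "mor X \<Longrightarrow> mor Y \<Longrightarrow> src X = src Y \<Longrightarrow> tgt X = tgt Y \<Longrightarrow> mor (X \<boxplus> Y)"
  "mor X \<Longrightarrow> mor Y \<Longrightarrow> src X = src Y \<Longrightarrow> tgt X = tgt Y \<Longrightarrow> src (X \<boxplus> Y) = src X"
  "mor X \<Longrightarrow> mor Y \<Longrightarrow> src X = src Y \<Longrightarrow> tgt X = tgt Y \<Longrightarrow> tgt (X \<boxplus> Y) = tgt X"
  "a \<in> carrier R \<Longrightarrow> mor X \<Longrightarrow> mor (a \<bullet> X)"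
  "a \<in> carrier R \<Longrightarrow> mor X \<Longrightarrow> src (a \<bullet> X) = src X"
  "a \<in> carrier R \<Longrightarrow> mor X \<Longrightarrow> tgt (a \<bullet> X) = tgt X"
  by ((elim morE, simp add: op_cls)+)

lemma comp_assoc:
  "mor X \<Longrightarrow> mor Y \<Longrightarrow> mor Z \<Longrightarrow> src X = tgt Y \<Longrightarrow> src Y = tgt Z \<Longrightarrow>
    X \<cdot> Y \<cdot> Z = X \<cdot> (Y \<cdot> Z)"
  by ((elim morE, force simp: op_cls cls_eq_iff intro: rook_eq.comp_assoc)+)

lemma comp_id [simp]:
  "mor X \<Longrightarrow> n = tgt X \<Longrightarrow> I n \<cdot> X = X"
  "mor X \<Longrightarrow> n = src X \<Longrightarrow> X \<cdot> I n = X"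
  by ((elim morE, force simp: op_cls cls_eq_iff intro: rook_eq.comp_id_left rook_eq.comp_id_right)+)

lemma tensor_assoc:
  "mor X \<Longrightarrow> mor Y \<Longrightarrow> mor Z \<Longrightarrow> X \<star> Y \<star> Z = X \<star> (Y \<star> Z)"
  by ((elim morE, force simp: op_cls cls_eq_iff intro: rook_eq.tensor_assoc)+)

lemma tensor_unit [simp]:
  "mor X \<Longrightarrow> I 0 \<star> X = X" "mor X \<Longrightarrow> X \<star> I 0 = X"
  by ((elim morE, force simp: op_cls cls_eq_iff intro: rook_eq.tensor_unit_left rook_eq.tensor_unit_right)+)

lemma tensor_id: "I a \<star> I b = I (a + b)"
  by (simp add: op_cls cls_eq_iff rook_eq.tensor_id)

lemma interchange:
  "mor X \<Longrightarrow> mor Y \<Longrightarrow> mor X' \<Longrightarrow> mor Y' \<Longrightarrow> src X = tgt Y \<Longrightarrow> src X' = tgt Y' \<Longrightarrow>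
    (X \<star> X') \<cdot> (Y \<star> Y') = (X \<cdot> Y) \<star> (X' \<cdot> Y')"
  by ((elim morE, force simp: op_cls cls_eq_iff intro: rook_eq.sym[OF rook_eq.interchange])+)

lemma relations:
  "s \<cdot> s = I (Suc (Suc 0))"
  "(s \<star> J) \<cdot> ((J \<star> s) \<cdot> (s \<star> J)) = (J \<star> s) \<cdot> ((s \<star> J) \<cdot> (J \<star> s))"
  "s \<cdot> (eta \<star> J) = J \<star> eta"
  "s \<cdot> (J \<star> eta) = eta \<star> J"
  "(eps \<star> J) \<cdot> s = J \<star> eps"
  "(J \<star> eps) \<cdot> s = eps \<star> J"
  "eps \<cdot> eta = t \<bullet> I 0"
  by (simp_all add: op_cls cls_eq_iff,
      (rule rook_eq.relation, simp add: rook_relations_def numeral_2_eq_2)+)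

lemma add_class_simps:
  "mor X \<Longrightarrow> mor Y \<Longrightarrow> mor Z \<Longrightarrow> src X = src Y \<Longrightarrow> tgt X = tgt Y \<Longrightarrow> src Y = src Z \<Longrightarrow>
    tgt Y = tgt Z \<Longrightarrow> X \<boxplus> Y \<boxplus> Z = X \<boxplus> (Y \<boxplus> Z)"
  "mor X \<Longrightarrow> mor Y \<Longrightarrow> src X = src Y \<Longrightarrow> tgt X = tgt Y \<Longrightarrow> X \<boxplus> Y = Y \<boxplus> X"
  "mor X \<Longrightarrow> X \<boxplus> nul (src X) (tgt X) = X"
  "mor X \<Longrightarrow> X \<boxplus> (\<ominus> \<one>) \<bullet> X = nul (src X) (tgt X)"
  "a \<in> carrier R \<Longrightarrow> b \<in> carrier R \<Longrightarrow> mor X \<Longrightarrow> (a \<oplus> b) \<bullet> X = a \<bullet> X \<boxplus> b \<bullet> X"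
  "a \<in> carrier R \<Longrightarrow> mor X \<Longrightarrow> mor Y \<Longrightarrow> src X = src Y \<Longrightarrow> tgt X = tgt Y \<Longrightarrow>
    a \<bullet> (X \<boxplus> Y) = a \<bullet> X \<boxplus> a \<bullet> Y"
  "a \<in> carrier R \<Longrightarrow> b \<in> carrier R \<Longrightarrow> mor X \<Longrightarrow> (a \<otimes> b) \<bullet> X = a \<bullet> b \<bullet> X"
  "mor X \<Longrightarrow> \<one> \<bullet> X = X"
  by ((elim morE, force simp: op_cls cls_eq_iff
      intro: rook_eq.add_assoc rook_eq.add_comm rook_eq.add_zero rook_eq.add_inverse
        rook_eq.scale_add_left rook_eq.scale_add_right rook_eq.scale_scale rook_eq.scale_one)+)

lemma comp_linear:
  "mor X \<Longrightarrow> mor Y \<Longrightarrow> mor Z \<Longrightarrow> src X = src Y \<Longrightarrow> tgt X = tgt Y \<Longrightarrow> src X = tgt Z \<Longrightarrow>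
    (X \<boxplus> Y) \<cdot> Z = X \<cdot> Z \<boxplus> Y \<cdot> Z"
  "mor X \<Longrightarrow> mor Y \<Longrightarrow> mor Z \<Longrightarrow> src X = src Y \<Longrightarrow> tgt X = tgt Y \<Longrightarrow> src Z = tgt X \<Longrightarrow>
    Z \<cdot> (X \<boxplus> Y) = Z \<cdot> X \<boxplus> Z \<cdot> Y"
  "a \<in> carrier R \<Longrightarrow> mor X \<Longrightarrow> mor Z \<Longrightarrow> src X = tgt Z \<Longrightarrow> (a \<bullet> X) \<cdot> Z = a \<bullet> (X \<cdot> Z)"
  "a \<in> carrier R \<Longrightarrow> mor X \<Longrightarrow> mor Z \<Longrightarrow> src Z = tgt X \<Longrightarrow> Z \<cdot> (a \<bullet> X) = a \<bullet> (Z \<cdot> X)"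
  by ((elim morE, force simp: op_cls cls_eq_iff
      intro: rook_eq.comp_add_left rook_eq.comp_add_right rook_eq.comp_scale_left rook_eq.comp_scale_right)+)

lemma tensor_linear:
  "mor X \<Longrightarrow> mor Y \<Longrightarrow> mor Z \<Longrightarrow> src X = src Y \<Longrightarrow> tgt X = tgt Y \<Longrightarrow>
    (X \<boxplus> Y) \<star> Z = X \<star> Z \<boxplus> Y \<star> Z"
  "mor X \<Longrightarrow> mor Y \<Longrightarrow> mor Z \<Longrightarrow> src X = src Y \<Longrightarrow> tgt X = tgt Y \<Longrightarrow>
    Z \<star> (X \<boxplus> Y) = Z \<star> X \<boxplus> Z \<star> Y"
  "a \<in> carrier R \<Longrightarrow> mor X \<Longrightarrow> mor Z \<Longrightarrow> (a \<bullet> X) \<star> Z = a \<bullet> (X \<star> Z)"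
  "a \<in> carrier R \<Longrightarrow> mor X \<Longrightarrow> mor Z \<Longrightarrow> Z \<star> (a \<bullet> X) = a \<bullet> (Z \<star> X)"
  by ((elim morE, force simp: op_cls cls_eq_iff
      intro: rook_eq.tensor_add_left rook_eq.tensor_add_right rook_eq.tensor_scale_left rook_eq.tensor_scale_right)+)

end

section \<open>Moving one strand across the others\<close>

text \<open>The last of \<open>n + 1\<close> strands moves to the front.\<close>

primrec sigma_term :: "nat \<Rightarrow> 'a rook_term" where
  "sigma_term 0 = Ident (Suc 0)"
| "sigma_term (Suc n) = Comp (Tensor Swap (Ident n)) (Tensor (Ident (Suc 0)) (sigma_term n))"

lemma source_sigma_term [simp]: "source (sigma_term n) = Suc n"
  by (induction n) auto

lemma target_sigma_term [simp]: "target (sigma_term n) = Suc n"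
  by (cases n) auto

lemma wf_sigma_term [simp]: "wf_term R (sigma_term n)"
  and diagrammatic_sigma_term [simp]: "diagrammatic (sigma_term n)"
  by (induction n) auto

declare sigma_term.simps(2) [simp del]

text \<open>Strand \<open>i\<close> of \<open>m\<close>, counted from \<open>0\<close>, moves to the front; meaningful for \<open>i < m\<close>.\<close>

definition cyc_term :: "nat \<Rightarrow> nat \<Rightarrow> 'a rook_term" where
  "cyc_term i m = Tensor (sigma_term i) (Ident (m - Suc i))"

context rook_presentation
begin

abbreviation sigma where "sigma n \<equiv> cls (sigma_term n)"

lemma sigma_Suc: "sigma (Suc n) = (s \<star> I n) \<cdot> (J \<star> sigma n)"
  by (simp add: op_cls sigma_term.simps)

section \<open>Whiskering and exchange\<close>

lemma whisker_left:
  "mor X \<Longrightarrow> mor Y \<Longrightarrow> src X = tgt Y \<Longrightarrow> (I a \<star> X) \<cdot> (I a \<star> Y) = I a \<star> (X \<cdot> Y)"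
  by (simp add: interchange)

lemma whisker_right:
  "mor X \<Longrightarrow> mor Y \<Longrightarrow> src X = tgt Y \<Longrightarrow> (X \<star> I a) \<cdot> (Y \<star> I a) = (X \<cdot> Y) \<star> I a"
  by (simp add: interchange)

lemma exchange:
  "mor X \<Longrightarrow> mor Y \<Longrightarrow> b = tgt Y \<Longrightarrow> a = src X \<Longrightarrow> (X \<star> I b) \<cdot> (I a \<star> Y) = X \<star> Y"
  "mor X \<Longrightarrow> mor Y \<Longrightarrow> b = src Y \<Longrightarrow> a = tgt X \<Longrightarrow> (I a \<star> Y) \<cdot> (X \<star> I b) = X \<star> Y"
  by (simp_all add: interchange)

lemma id_tensor: "mor X \<Longrightarrow> I a \<star> (I b \<star> X) = I (a + b) \<star> X"
  by (simp flip: tensor_assoc add: tensor_id)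

lemma tensor_id_id: "mor X \<Longrightarrow> X \<star> I a \<star> I b = X \<star> I (a + b)"
  by (simp add: tensor_assoc tensor_id)

text \<open>The moving strand crosses the b nearest strands and then the other a. This is the
  hexagon identity for the braiding of one strand, and it reduces naturality of a tensor product to
  that of its factors.\<close>

lemma sigma_add: "sigma (a + b) = (sigma a \<star> I b) \<cdot> (I a \<star> sigma b)"
proof (induction a)
  case 0
  then show ?case by (simp add: tensor_id)
next
  case (Suc a)
  have 1: "J \<star> sigma (a + b) = (J \<star> sigma a \<star> I b) \<cdot> (I (Suc a) \<star> sigma b)"
    by (simp add: Suc tensor_assoc id_tensor flip: whisker_left)
  have "sigma (Suc a + b) = (s \<star> I a \<star> I b) \<cdot> ((J \<star> sigma a \<star> I b) \<cdot> (I (Suc a) \<star> sigma b))"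
    unfolding add_Suc sigma_Suc 1 by (simp add: tensor_id_id)
  also have "\<dots> = (sigma (Suc a) \<star> I b) \<cdot> (I (Suc a) \<star> sigma b)"
    unfolding sigma_Suc by (simp flip: whisker_right add: comp_assoc)
  finally show ?case .
qed

section \<open>Naturality of the crossing of one strand\<close>

text \<open>Naturality in f of the braiding with a single strand: that strand may pass to the left
  before or after f is applied to the others.\<close>

definition natural where "natural f \<longleftrightarrow> mor f \<and> (J \<star> f) \<cdot> sigma (src f) = sigma (tgt f) \<cdot> (f \<star> J)"

lemma natural_id: "natural (I n)"
  by (simp add: natural_def tensor_id)

lemma natural_comp:
  assumes "natural f" "natural g" "src f = tgt g"
  shows "natural (f \<cdot> g)"
proof -
  have m [simp]: "mor f" "mor g" using assms by (auto simp: natural_def)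
  have "(J \<star> (f \<cdot> g)) \<cdot> sigma (src g) = (J \<star> f) \<cdot> ((J \<star> g) \<cdot> sigma (src g))"
    using assms(3) by (simp flip: whisker_left add: comp_assoc)
  also have "(J \<star> g) \<cdot> sigma (src g) = sigma (src f) \<cdot> (g \<star> J)"
    using assms(2,3) by (simp add: natural_def)
  also have "(J \<star> f) \<cdot> (sigma (src f) \<cdot> (g \<star> J)) = (J \<star> f) \<cdot> sigma (src f) \<cdot> (g \<star> J)"
    using assms(3) by (simp add: comp_assoc)
  also have "(J \<star> f) \<cdot> sigma (src f) = sigma (tgt f) \<cdot> (f \<star> J)"
    using assms(1) by (simp add: natural_def)
  also have "sigma (tgt f) \<cdot> (f \<star> J) \<cdot> (g \<star> J) = sigma (tgt f) \<cdot> ((f \<cdot> g) \<star> J)"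
    using assms(3) by (simp add: comp_assoc whisker_right)
  finally show ?thesis using assms(3) by (simp add: natural_def)
qed

text \<open>By \<open>sigma_add\<close> the strand crosses g and f separately, so the two naturality
  squares are pasted side by side.\<close>

lemma natural_tensor:
  assumes "natural f" "natural g"
  shows "natural (f \<star> g)"
proof -
  have m [simp]: "mor f" "mor g" using assms by (auto simp: natural_def)
  define a b a' b' where d: "a = src f" "b = src g" "a' = tgt f" "b' = tgt g"
  have 1: "(J \<star> f \<star> g) \<cdot> (sigma a \<star> I b) = (sigma a' \<star> I b') \<cdot> (f \<star> J \<star> g)"
    using assms by (simp add: interchange d natural_def)
  have 2: "(f \<star> J \<star> g) \<cdot> (I a \<star> sigma b) = (I a' \<star> sigma b') \<cdot> (f \<star> g \<star> J)"
    using assms by (simp add: interchange d natural_def tensor_assoc)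
  have "(J \<star> (f \<star> g)) \<cdot> sigma (a + b) = (J \<star> f \<star> g) \<cdot> (sigma a \<star> I b) \<cdot> (I a \<star> sigma b)"
    unfolding sigma_add by (simp add: tensor_assoc comp_assoc d)
  also have "\<dots> = (sigma a' \<star> I b') \<cdot> ((f \<star> J \<star> g) \<cdot> (I a \<star> sigma b))"
    unfolding 1 by (simp add: comp_assoc d)
  also have "\<dots> = sigma (a' + b') \<cdot> (f \<star> g \<star> J)"
    unfolding 2 sigma_add by (simp add: comp_assoc d)
  finally show ?thesis by (simp add: natural_def d)
qed

lemma sigma_1: "sigma (Suc 0) = s"
  unfolding sigma_Suc by (simp add: tensor_id)

text \<open>With \<open>sigma 2\<close> written out as two crossings, this is exactly the braid
  relation.\<close>

lemma natural_swap: "natural s"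
proof -
  have "sigma 2 = (s \<star> J) \<cdot> (J \<star> s)"
    unfolding numeral_2_eq_2 sigma_Suc[of "Suc 0"] sigma_1 ..
  then show ?thesis
    using relations(2) by (simp add: natural_def comp_assoc)
qed

lemma natural_eps: "natural eps"
  using relations(6) by (simp add: natural_def sigma_1)

lemma natural_sigma: "natural (sigma n)"
proof (induction n)
  case (Suc n)
  then show ?case unfolding sigma_Suc
    by (intro natural_comp natural_tensor natural_swap natural_id) auto
qed (simp add: natural_id)

text \<open>A strand that ends once it has reached the front may end where it started: the relation
  between \<epsilon> and s removes its crossings one by one.\<close>

lemma eps_sigma: "(eps \<star> I n) \<cdot> sigma n = I n \<star> eps"
proof (induction n)
  case (Suc n)
  have "(eps \<star> I (Suc n)) \<cdot> sigma (Suc n) = (eps \<star> J \<star> I n) \<cdot> ((s \<star> I n) \<cdot> (J \<star> sigma n))"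
    unfolding sigma_Suc by (simp add: tensor_id_id)
  also have "\<dots> = (J \<star> eps \<star> I n) \<cdot> (J \<star> sigma n)"
    by (simp flip: comp_assoc add: whisker_right relations)
  also have "\<dots> = J \<star> (I n \<star> eps)"
    by (simp add: tensor_assoc whisker_left Suc)
  also have "\<dots> = I (Suc n) \<star> eps"
    by (simp add: id_tensor)
  finally show ?case .
qed simp

section \<open>Pulling and ending strands of a bundle\<close>

abbreviation cyc where "cyc i m \<equiv> cls (cyc_term i m)"

lemma cyc_eq: "cyc i m = sigma i \<star> I (m - Suc i)"
  by (simp add: cyc_term_def op_cls)


text \<open>Two strands are pulled to the two front places and swapped; pulling them in the opposite
  order gives the same permutation. Taking strand i away lowers the number of every later strand by
  one, so strand j of the rest is strand \<open>Suc j\<close> of all. The swap completes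
  \<open>sigma j\<close> to \<open>sigma (Suc j)\<close>, which naturality carries across
  \<open>sigma i\<close>.\<close>

lemma cyc_exchange:
  assumes "i \<le> j" "Suc j < m"
  shows "(s \<star> I (m - 2)) \<cdot> (J \<star> cyc j (m - 1)) \<cdot> cyc i m = (J \<star> cyc i (m - 1)) \<cdot> cyc (Suc j) m"
proof -
  define r where "r = m - Suc (Suc j)"
  define p where "p = j - i"
  have m: "m = Suc (Suc j) + r" and j: "j = i + p" using assms by (simp_all add: r_def p_def)
  \<comment> \<open>Padding with p identity strands turns \<open>sigma i\<close> into an
    endomorphism of j + 1 strands, the number that \<open>sigma (Suc j)\<close> crosses.\<close>
  let ?f = "sigma i \<star> I p"
  have nat: "(J \<star> ?f) \<cdot> sigma (Suc j) = sigma (Suc j) \<cdot> (?f \<star> J)"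
    using natural_tensor[OF natural_sigma natural_id, of i p] by (simp add: natural_def j)
  have "(s \<star> I (m - 2)) \<cdot> (J \<star> cyc j (m - 1)) = (s \<star> I j \<star> I r) \<cdot> (J \<star> sigma j \<star> I r)"
    by (simp add: m cyc_eq tensor_id tensor_assoc)
  also have "\<dots> = sigma (Suc j) \<star> I r"
    unfolding sigma_Suc by (simp add: whisker_right)
  finally have "(s \<star> I (m - 2)) \<cdot> (J \<star> cyc j (m - 1)) \<cdot> cyc i m
      = (sigma (Suc j) \<star> I r) \<cdot> (?f \<star> J \<star> I r)"
    by (simp add: m j cyc_eq tensor_id_id)
  also have "\<dots> = (J \<star> ?f \<star> I r) \<cdot> (sigma (Suc j) \<star> I r)"
    by (simp add: whisker_right j nat[unfolded j])
  also have "\<dots> = (J \<star> cyc i (m - 1)) \<cdot> cyc (Suc j) m"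
    by (simp add: m j cyc_eq tensor_assoc tensor_id)
  finally show ?thesis .
qed

text \<open>The mirror case follows from \<open>cyc_exchange\<close> with the two strands
  interchanged, since the swap is an involution.\<close>

lemma cyc_exchange':
  assumes "j < i" "i < m"
  shows "(s \<star> I (m - 2)) \<cdot> (J \<star> cyc j (m - 1)) \<cdot> cyc i m = (J \<star> cyc (i - 1) (m - 1)) \<cdot> cyc j m"
proof -
  have m: "m = Suc (Suc (m - 2))" using assms by simp
  have "(s \<star> I (m - 2)) \<cdot> ((s \<star> I (m - 2)) \<cdot> (J \<star> cyc (i - 1) (m - 1)) \<cdot> cyc j m)
      = (s \<star> I (m - 2)) \<cdot> ((J \<star> cyc j (m - 1)) \<cdot> cyc i m)"
    using assms by (subst cyc_exchange) simp_all
  moreover have "(s \<star> I (m - 2)) \<cdot> ((s \<star> I (m - 2)) \<cdot> X) = X" if "mor X" "tgt X = m" for X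
  proof -
    have "(s \<star> I (m - 2)) \<cdot> ((s \<star> I (m - 2)) \<cdot> X) = ((s \<star> I (m - 2)) \<cdot> (s \<star> I (m - 2))) \<cdot> X"
      using that m by (simp add: comp_assoc)
    also have "\<dots> = X" using that m by (simp add: whisker_right relations tensor_id)
    finally show ?thesis .
  qed
  ultimately show ?thesis
    using assms by (simp add: comp_assoc cyc_eq)
qed

text \<open>Strand i, counted from 0, ends. The parameter m counts the surviving strands, so the
  source has m + 1.\<close>

abbreviation eps_at where "eps_at i m \<equiv> I i \<star> eps \<star> I (m - i)"

lemma eps_cyc:
  assumes "i < m"
  shows "(eps \<star> I (m - 1)) \<cdot> cyc i m = eps_at i (m - 1)"
proof -
  have "(eps \<star> I (m - 1)) \<cdot> cyc i m = (eps \<star> I i \<star> I (m - Suc i)) \<cdot> (sigma i \<star> I (m - Suc i))"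
    using assms by (simp add: cyc_eq tensor_id_id)
  also have "\<dots> = eps_at i (m - 1)"
    by (simp add: whisker_right eps_sigma)
  finally show ?thesis .
qed

text \<open>The strand pulled to the front starts to the right of the ending one and has to cross
  it, which is naturality of \<epsilon>. Before strand i ends, strand j of the survivors has the
  number \<open>Suc j\<close>.\<close>

lemma cyc_eps_le:
  assumes "i \<le> j" "j < m"
  shows "cyc j m \<cdot> eps_at i m = (J \<star> eps_at i (m - 1)) \<cdot> cyc (Suc j) (Suc m)"
proof -
  define r p where "r = m - Suc j" and "p = j - i"
  have m: "m = Suc j + r" and j: "j = i + p" using assms by (simp_all add: r_def p_def)
  let ?f = "I i \<star> eps \<star> I p"
  have nat: "(J \<star> ?f) \<cdot> sigma (Suc j) = sigma j \<cdot> (?f \<star> J)"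
    using natural_tensor[OF natural_tensor[OF natural_id natural_eps] natural_id, of i p]
    by (simp add: natural_def j)
  have "cyc j m \<cdot> eps_at i m = (sigma j \<star> I r) \<cdot> (?f \<star> J \<star> I r)"
    by (simp add: m j cyc_eq tensor_id_id)
  also have "\<dots> = (J \<star> ?f \<star> I r) \<cdot> (sigma (Suc j) \<star> I r)"
    by (simp add: whisker_right j nat[unfolded j])
  also have "\<dots> = (J \<star> eps_at i (m - 1)) \<cdot> cyc (Suc j) (Suc m)"
    by (simp add: m j cyc_eq tensor_assoc tensor_id)
  finally show ?thesis .
qed

text \<open>Here the ending strand lies to the right of the pulled one, so they never meet and the
  interchange law suffices; removal of the pulled strand lowers the number i by one.\<close>

lemma cyc_eps_gt:
  assumes "j < i" "i \<le> m"
  shows "cyc j m \<cdot> eps_at i m = (J \<star> eps_at (i - 1) (m - 1)) \<cdot> cyc j (Suc m)"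
proof -
  define r p where "r = m - i" and "p = i - Suc j"
  have m: "m = Suc j + p + r" and i: "i = Suc j + p" using assms by (simp_all add: r_def p_def)
  let ?f = "I p \<star> eps \<star> I r"
  have "cyc j m \<cdot> eps_at i m = (sigma j \<star> I (p + r)) \<cdot> (I (Suc j) \<star> ?f)"
    by (simp add: m i cyc_eq id_tensor tensor_assoc)
  also have "\<dots> = (I (Suc j) \<star> ?f) \<cdot> (sigma j \<star> I (Suc (p + r)))"
    by (simp add: interchange)
  also have "\<dots> = (J \<star> eps_at (i - 1) (m - 1)) \<cdot> cyc j (Suc m)"
    by (simp add: m i cyc_eq tensor_assoc id_tensor)
  finally show ?thesis .
qed

end

section \<open>Normal forms span\<close>

primrec eps_pow :: "nat \<Rightarrow> 'a rook_term" where
  "eps_pow 0 = Ident 0"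
| "eps_pow (Suc m) = Tensor Eps (eps_pow m)"

text \<open>The code lists for each top vertex, from left to right, either \<open>None\<close> if it is isolated or \<open>Some i\<close>
  if it is joined to the bottom vertex that is number \<open>i\<close>, counted from \<open>0\<close>, among those not yet used.\<close>

fun nf_term :: "nat \<Rightarrow> nat option list \<Rightarrow> 'a rook_term" where
  "nf_term m [] = eps_pow m"
| "nf_term m (None # c) = Tensor Eta (nf_term m c)"
| "nf_term m (Some i # c) = Comp (Tensor (Ident (Suc 0)) (nf_term (m - 1) c)) (cyc_term i m)"

fun valid_code :: "nat \<Rightarrow> nat option list \<Rightarrow> bool" where
  "valid_code m [] \<longleftrightarrow> True"
| "valid_code m (None # c) \<longleftrightarrow> valid_code m c"
| "valid_code m (Some i # c) \<longleftrightarrow> i < m \<and> valid_code (m - 1) c"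

lemma eps_pow_simps [simp]:
  "source (eps_pow m) = m" "target (eps_pow m) = 0" "wf_term R (eps_pow m)"
  "diagrammatic (eps_pow m)"
  by (induction m) auto

lemma cyc_term_simps [simp]:
  "i < m \<Longrightarrow> source (cyc_term i m) = m" "i < m \<Longrightarrow> target (cyc_term i m) = m"
  "wf_term R (cyc_term i m)" "diagrammatic (cyc_term i m)"
  by (auto simp: cyc_term_def)

lemma source_nf_term [simp]: "valid_code m c \<Longrightarrow> source (nf_term m c) = m"
  by (induction m c rule: nf_term.induct) auto

lemma target_nf_term [simp]: "target (nf_term m c) = length c"
  by (induction m c rule: nf_term.induct) auto

lemma wf_nf_term [simp]: "valid_code m c \<Longrightarrow> wf_term R (nf_term m c)"
  by (induction m c rule: nf_term.induct) auto

lemma diagrammatic_nf_term [simp]: "diagrammatic (nf_term m c)"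
  by (induction m c rule: nf_term.induct) auto

declare nf_term.simps(2,3) [simp del]

context rook_presentation
begin

section \<open>Zero morphisms\<close>

text \<open>The axioms express additive inverses through the scalar -1, so zero is split as 1 +
  (-1).\<close>

lemma scale_zero: "mor X \<Longrightarrow> \<zero> \<bullet> X = nul (src X) (tgt X)"
  using add_class_simps(5)[of \<one> "\<ominus> \<one>" X] by (simp add: r_neg add_class_simps)

text \<open>\<open>nul k l\<close> is zero times itself, and bilinearity moves that scalar out of
  the composite.\<close>

lemma comp_nul:
  assumes "mor X"
  shows "src X = l \<Longrightarrow> X \<cdot> nul k l = nul k (tgt X)"
    and "tgt X = k \<Longrightarrow> nul k l \<cdot> X = nul (src X) l"
  using assms comp_linear(4)[of \<zero> "nul k l" X] comp_linear(3)[of \<zero> "nul k l" X]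
  by (simp_all add: scale_zero)

lemma tensor_nul:
  assumes "mor X"
  shows "X \<star> nul k l = nul (src X + k) (tgt X + l)"
    and "nul k l \<star> X = nul (k + src X) (l + tgt X)"
  using assms tensor_linear(4)[of \<zero> "nul k l" X] tensor_linear(3)[of \<zero> "nul k l" X]
  by (simp_all add: scale_zero)

abbreviation NF where "NF m c \<equiv> cls (nf_term m c)"

lemma NF_None: "valid_code m c \<Longrightarrow> NF m (None # c) = eta \<star> NF m c"
  by (simp add: op_cls nf_term.simps)

lemma NF_Some: "i < m \<Longrightarrow> valid_code (m - 1) c \<Longrightarrow> NF m (Some i # c) = (J \<star> NF (m - 1) c) \<cdot> cyc i m"
  by (simp add: op_cls nf_term.simps)

section \<open>The span of the normal forms\<close>

text \<open>An inductive closure in place of finite sums: a linear operation then needs to be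
  checked on normal forms only, by rule induction and before any module structure is
  available.\<close>

inductive span :: "nat \<Rightarrow> nat \<Rightarrow> 'a rook_term set \<Rightarrow> bool" where
  span_NF: "valid_code m c \<Longrightarrow> l = length c \<Longrightarrow> span m l (NF m c)"
| span_nul: "span m l (nul m l)"
| span_add: "span m l X \<Longrightarrow> span m l Y \<Longrightarrow> span m l (X \<boxplus> Y)"
| span_scale: "a \<in> carrier R \<Longrightarrow> span m l X \<Longrightarrow> span m l (a \<bullet> X)"

lemma span_typing: "span m l X \<Longrightarrow> mor X \<and> src X = m \<and> tgt X = l"
  by (induction rule: span.induct) auto

lemma span_map:
  assumes "span m l X"
    and "\<And>c. valid_code m c \<Longrightarrow> length c = l \<Longrightarrow> span m' l' (F (NF m c))"
    and "F (nul m l) = nul m' l'"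
    and "\<And>X Y. mor X \<Longrightarrow> mor Y \<Longrightarrow> src X = m \<Longrightarrow> src Y = m \<Longrightarrow> tgt X = l \<Longrightarrow> tgt Y = l \<Longrightarrow>
      F (X \<boxplus> Y) = F X \<boxplus> F Y"
    and "\<And>a X. a \<in> carrier R \<Longrightarrow> mor X \<Longrightarrow> src X = m \<Longrightarrow> tgt X = l \<Longrightarrow> F (a \<bullet> X) = a \<bullet> F X"
  shows "span m' l' (F X)"
proof -
  \<comment> \<open>The indices of \<open>span\<close> are decoupled from m and l, so that the
    hypotheses on F stay fixed during the induction.\<close>
  have "m = m0 \<Longrightarrow> l = l0 \<Longrightarrow> span m' l' (F X)" if "span m0 l0 X" for m0 l0
    using that
  proof (induction rule: span.induct)
    case (span_NF m c l)
    then show ?case using assms(2) by simp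
  next
    case (span_nul m l)
    then show ?case using assms(3) span.span_nul by simp
  next
    case (span_add m l X Y)
    then show ?case using assms(4) span_typing span.span_add by simp
  next
    case (span_scale a m l X)
    then show ?case using assms(5) span_typing span.span_scale by simp
  qed
  with assms(1) show ?thesis by blast
qed

lemma span_None: "span m l X \<Longrightarrow> span m (Suc l) (eta \<star> X)"
proof (erule span_map)
  fix c assume "valid_code m c" "length c = l"
  then show "span m (Suc l) (eta \<star> NF m c)"
    using span_NF[of m "None # c"] by (simp add: NF_None)
qed (simp_all add: tensor_nul tensor_linear)

lemma span_Some:
  assumes "i \<le> m" "span m l X"
  shows "span (Suc m) (Suc l) ((J \<star> X) \<cdot> cyc i (Suc m))"
  using assms(2)
proof (rule span_map)
  fix c assume "valid_code m c" "length c = l"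
  then show "span (Suc m) (Suc l) ((J \<star> NF m c) \<cdot> cyc i (Suc m))"
    using span_NF[of "Suc m" "Some i # c"] assms(1) by (simp add: NF_Some)
qed (use assms(1) in \<open>simp_all add: tensor_nul tensor_linear comp_nul comp_linear\<close>)

lemma eps_pow_add: "cls (eps_pow (a + b)) = cls (eps_pow a) \<star> cls (eps_pow b)"
proof (induction a)
  case (Suc a)
  have "cls (eps_pow (Suc n)) = eps \<star> cls (eps_pow n)" for n
    by (simp add: op_cls)
  with Suc show ?case by (simp add: tensor_assoc del: eps_pow.simps)
qed simp

text \<open>When \<epsilon> meets a joined top vertex, its bottom partner becomes isolated and an
  \<epsilon> appears below the remaining normal form. It is absorbed by sliding it through the code
  until only ending strands are left.\<close>

lemma span_NF_eps:
  "valid_code m c \<Longrightarrow> i \<le> m \<Longrightarrow> span (Suc m) (length c) (NF m c \<cdot> eps_at i m)"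
proof (induction m c arbitrary: i rule: nf_term.induct)
  case (1 m)
  then obtain b where m: "m = i + b" using le_Suc_ex by blast
  have "NF m [] \<cdot> eps_at i m = (cls (eps_pow i) \<star> (I 0 \<star> cls (eps_pow b))) \<cdot> (I i \<star> (eps \<star> I b))"
    by (simp add: m eps_pow_add tensor_assoc)
  also have "\<dots> = cls (eps_pow i) \<star> (eps \<star> cls (eps_pow b))"
    by (simp add: interchange del: tensor_unit)
  also have "eps \<star> cls (eps_pow b) = cls (eps_pow (Suc b))"
    by (simp add: op_cls)
  also have "cls (eps_pow i) \<star> cls (eps_pow (Suc b)) = NF (Suc m) []"
    by (simp add: m del: eps_pow.simps flip: eps_pow_add)
  finally show ?case using span_NF[of "Suc m" "[]"] by simp
next
  case (2 m c)
  have "NF m (None # c) \<cdot> eps_at i m = (eta \<star> NF m c) \<cdot> (I 0 \<star> eps_at i m)"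
    using 2 by (simp add: NF_None)
  also have "\<dots> = eta \<star> (NF m c \<cdot> eps_at i m)"
    using 2 by (simp add: interchange del: tensor_unit)
  finally show ?case using 2 span_None by simp
next
  case (3 m j c)
  then have j: "j < m" "valid_code (m - 1) c" by auto
  \<comment> \<open>The new numbers after the ending strand has passed the pull of strand j; they
    depend on which of the two lies further left.\<close>
  define i' where "i' = (if i \<le> j then i else i - 1)"
  define j' where "j' = (if i \<le> j then Suc j else j)"
  have i': "i' \<le> m - 1" and j': "j' \<le> m" using 3 by (auto simp: i'_def j'_def)
  have "cyc j m \<cdot> eps_at i m = (J \<star> eps_at i' (m - 1)) \<cdot> cyc j' (Suc m)"
    using cyc_eps_le cyc_eps_gt 3 by (auto simp: i'_def j'_def)
  then have "NF m (Some j # c) \<cdot> eps_at i m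
      = (J \<star> NF (m - 1) c) \<cdot> ((J \<star> eps_at i' (m - 1)) \<cdot> cyc j' (Suc m))"
    using 3 j by (simp only: NF_Some) (simp add: comp_assoc)
  also have "\<dots> = (J \<star> (NF (m - 1) c \<cdot> eps_at i' (m - 1))) \<cdot> cyc j' (Suc m)"
    using i' j j' by (simp add: comp_assoc flip: whisker_left)
  finally show ?case
    using span_Some[OF j', of "length c"] 3(1)[OF j(2) i'] j by simp
qed

section \<open>Closure under composition with every expression\<close>

text \<open>All sources m are covered at once, because the treatment of a joined top vertex lowers
  the number of bottom vertices.\<close>

definition preserves where
  "preserves h \<longleftrightarrow> mor h \<and> (\<forall>m X. span m (src h) X \<longrightarrow> span m (tgt h) (h \<cdot> X))"

lemma preservesI:
  assumes "mor h"
    and "\<And>m c. valid_code m c \<Longrightarrow> length c = src h \<Longrightarrow> span m (tgt h) (h \<cdot> NF m c)"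
  shows "preserves h"
proof -
  have "span m (tgt h) (h \<cdot> X)" if "span m (src h) X" for m X
    using that by (rule span_map) (use assms in \<open>simp_all add: comp_linear comp_nul\<close>)
  with assms(1) show ?thesis by (simp add: preserves_def)
qed

lemma preserves_comp: "preserves f \<Longrightarrow> preserves g \<Longrightarrow> src f = tgt g \<Longrightarrow> preserves (f \<cdot> g)"
  unfolding preserves_def using span_typing by (simp add: comp_assoc)

lemma preserves_id: "preserves (I n)"
  unfolding preserves_def using span_typing by simp

text \<open>An identity strand on the left leaves the first entry of a code alone, and h acts on the
  normal form of the rest. Thus identities to the left can be stripped off, and a generator has to
  be treated only on the leftmost strands.\<close>

lemma preserves_id_tensor_1:
  assumes "preserves h"
  shows "preserves (J \<star> h)"
proof (rule preservesI)
  show "mor (J \<star> h)" using assms by (simp add: preserves_def)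
next
  fix m c assume c: "valid_code m c" "length c = src (J \<star> h)"
  have h: "mor h" using assms by (simp add: preserves_def)
  then obtain x d where d: "c = x # d" "length d = src h" using c by (auto simp: length_Suc_conv)
  show "span m (tgt (J \<star> h)) ((J \<star> h) \<cdot> NF m c)"
  proof (cases x)
    case None
    then have "(J \<star> h) \<cdot> NF m c = eta \<star> (h \<cdot> NF m d)"
      using h c d by (simp add: NF_None interchange)
    moreover have "span m (tgt h) (h \<cdot> NF m d)"
      using assms c d None span_NF[of m d "src h"] by (simp add: preserves_def)
    ultimately show ?thesis using span_None h by simp
  next
    case (Some i)
    then have i: "i \<le> m - 1" "Suc (m - 1) = m" "valid_code (m - 1) d" using c d by auto
    have "(J \<star> h) \<cdot> NF m c = (J \<star> (h \<cdot> NF (m - 1) d)) \<cdot> cyc i m"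
      using h c d Some by (simp add: NF_Some interchange flip: comp_assoc)
    moreover have "span (m - 1) (tgt h) (h \<cdot> NF (m - 1) d)"
      using assms i d span_NF[of "m - 1" d "src h"] by (simp add: preserves_def)
    ultimately show ?thesis using span_Some[OF i(1)] h i(2) by simp
  qed
qed

lemma preserves_id_tensor: "preserves h \<Longrightarrow> preserves (I a \<star> h)"
proof (induction a)
  case (Suc a)
  then have "preserves (J \<star> (I a \<star> h))" by (simp add: preserves_id_tensor_1)
  with Suc.prems show ?case by (simp add: id_tensor preserves_def)
qed (simp add: preserves_def)

lemma preserves_eta: "preserves (eta \<star> I b)"
proof -
  have "(eta \<star> I b) \<cdot> X = eta \<star> X" if "mor X" "tgt X = b" for X
    using that exchange(1)[of eta X b 0] by simp
  then show ?thesis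
    unfolding preserves_def using span_None span_typing by simp
qed

text \<open>An isolated first top vertex yields \<epsilon> after \<eta>, the scalar t. A joined one
  passes the \<epsilon> down to its bottom partner.\<close>

lemma preserves_eps: "preserves (eps \<star> I b)"
proof (rule preservesI)
  fix m c assume c: "valid_code m c" "length c = src (eps \<star> I b)"
  then obtain x d where d: "c = x # d" "length d = b" by (auto simp: length_Suc_conv)
  show "span m (tgt (eps \<star> I b)) ((eps \<star> I b) \<cdot> NF m c)"
  proof (cases x)
    case None
    then have "(eps \<star> I b) \<cdot> NF m c = t \<bullet> NF m d"
      using c d by (simp add: NF_None interchange relations tensor_linear)
    then show ?thesis using c d None by (simp add: span_scale span_NF)
  next
    case (Some i)
    then have i: "i < m" "Suc (m - 1) = m" "valid_code (m - 1) d" using c d by auto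
    have "(eps \<star> I b) \<cdot> NF m c = (eps \<star> NF (m - 1) d) \<cdot> cyc i m"
      using d i Some by (simp add: NF_Some exchange flip: comp_assoc)
    \<comment> \<open>By the interchange law \<epsilon> moves below the rest of the normal form,
      where it meets the pulled strand.\<close>
    also have "eps \<star> NF (m - 1) d = NF (m - 1) d \<cdot> (eps \<star> I (m - 1))"
      using i exchange(2)[of eps "NF (m - 1) d" "m - 1" 0] by simp
    also have "\<dots> \<cdot> cyc i m = NF (m - 1) d \<cdot> eps_at i (m - 1)"
      using i eps_cyc[of i m] by (simp add: comp_assoc)
    finally show ?thesis
      using span_NF_eps[of "m - 1" d i] i d by simp
  qed
qed simp

text \<open>Only the first two entries of the code are touched. An isolated vertex slides through s
  by the relations for \<eta>; for two joined vertices the order in which their bottom partners are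
  pulled to the front is reversed.\<close>

lemma preserves_swap: "preserves (s \<star> I b)"
proof (rule preservesI)
  fix m c assume c: "valid_code m c" "length c = src (s \<star> I b)"
  then obtain x y d where d: "c = x # y # d" "length d = b"
    by (auto simp: length_Suc_conv numeral_2_eq_2)
  have eta_eta: "s \<cdot> (eta \<star> eta) = eta \<star> eta"
  proof -
    have "s \<cdot> (eta \<star> eta) = s \<cdot> ((eta \<star> J) \<cdot> eta)"
      using exchange(1)[of eta eta "Suc 0" 0] by simp
    also have "\<dots> = (s \<cdot> (eta \<star> J)) \<cdot> eta" by (simp add: comp_assoc)
    also have "\<dots> = eta \<star> eta"
      using exchange(2)[of eta eta 0 "Suc 0"] by (simp add: relations)
    finally show ?thesis .
  qed
  have "span m (Suc (Suc b)) ((s \<star> I b) \<cdot> NF m c)"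
  proof (cases x)
    case x: None
    then have c': "valid_code m (y # d)" using c d by simp
    show ?thesis
    proof (cases y)
      case None
      then have "valid_code m d" using c' by simp
      then have "(s \<star> I b) \<cdot> NF m c = eta \<star> (eta \<star> NF m d)"
        using c' d x None eta_eta by (simp add: NF_None interchange flip: tensor_assoc)
      with \<open>valid_code m d\<close> show ?thesis
        using span_None[OF span_None[OF span_NF[of m d b]]] d by simp
    next
      case (Some i)
      then have i: "i < m" "Suc (m - 1) = m" "valid_code (m - 1) d" using c' by auto
      have "NF m c = (eta \<star> J \<star> NF (m - 1) d) \<cdot> cyc i m"
        using i x d Some interchange[of eta "I 0" "J \<star> NF (m - 1) d" "cyc i m"]
        by (simp add: NF_None NF_Some tensor_assoc)
      then have "(s \<star> I b) \<cdot> NF m c = ((s \<star> I b) \<cdot> (eta \<star> J \<star> NF (m - 1) d)) \<cdot> cyc i m"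
        using i d by (simp add: comp_assoc)
      also have "(s \<star> I b) \<cdot> (eta \<star> J \<star> NF (m - 1) d) = J \<star> (eta \<star> NF (m - 1) d)"
        using i d by (simp add: interchange relations) (simp add: tensor_assoc)
      finally show ?thesis
        using span_Some[OF _ span_None[OF span_NF[of "m - 1" d b]], of i] i d by simp
    qed
  next
    case x: (Some i)
    then have i: "i < m" "Suc (m - 1) = m" "valid_code (m - 1) (y # d)" using c d by auto
    show ?thesis
    proof (cases y)
      case None
      then have v: "valid_code (m - 1) d" using i by simp
      have "NF m c = (J \<star> eta \<star> NF (m - 1) d) \<cdot> cyc i m"
        using i x d None v by (simp add: NF_None NF_Some tensor_assoc)
      then have "(s \<star> I b) \<cdot> NF m c = ((s \<star> I b) \<cdot> (J \<star> eta \<star> NF (m - 1) d)) \<cdot> cyc i m"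
        using i d v by (simp add: comp_assoc)
      also have "(s \<star> I b) \<cdot> (J \<star> eta \<star> NF (m - 1) d) = eta \<star> (J \<star> NF (m - 1) d)"
        using v d by (simp add: interchange relations) (simp add: tensor_assoc)
      also have "\<dots> \<cdot> cyc i m = eta \<star> ((J \<star> NF (m - 1) d) \<cdot> cyc i m)"
        using i v interchange[of eta "I 0" "J \<star> NF (m - 1) d" "cyc i m"] by simp
      finally show ?thesis
        using span_None[OF span_Some[OF _ span_NF[of "m - 1" d b], of i]] i d v by simp
    next
      case (Some j)
      then have j: "j < m - 1" "Suc (m - 2) = m - 1" "Suc (Suc (m - 2)) = m"
        and v: "valid_code (m - 2) d"
        using i by (auto simp: numeral_2_eq_2)
      let ?N = "NF (m - 2) d"
      have J2: "J \<star> (J \<star> ?N) = I (Suc (Suc 0)) \<star> ?N" using v by (simp add: id_tensor)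
      \<comment> \<open>Both pulls are gathered below the rest \<open>?N\<close> of the normal form,
        so that the swap can move past \<open>?N\<close> and meet them.\<close>
      have split: "(J \<star> ((J \<star> ?N) \<cdot> cyc p (m - 1))) \<cdot> cyc q m
          = (I (Suc (Suc 0)) \<star> ?N) \<cdot> ((J \<star> cyc p (m - 1)) \<cdot> cyc q m)"
        if "p < m - 1" "q < m" for p q
      proof -
        have "J \<star> ((J \<star> ?N) \<cdot> cyc p (m - 1)) = (I (Suc (Suc 0)) \<star> ?N) \<cdot> (J \<star> cyc p (m - 1))"
          using v j that by (simp flip: whisker_left J2)
        then show ?thesis using v i(2) j that by (simp add: comp_assoc)
      qed
      \<comment> \<open>\<open>q\<close> and \<open>p\<close> are the first two entries of the new
        code; the case distinction is about which of the two bottom vertices lies further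
        left.\<close>
      obtain p q where pq: "p < m - 1" "q < m"
        and eq: "(s \<star> I (m - 2)) \<cdot> ((J \<star> cyc j (m - 1)) \<cdot> cyc i m) = (J \<star> cyc p (m - 1)) \<cdot> cyc q m"
      proof (cases "i \<le> j")
        case True
        then show ?thesis
          using that[of i "Suc j"] cyc_exchange[of i j m] i j by (simp add: comp_assoc)
      next
        case False
        then show ?thesis
          using that[of "i - 1" j] cyc_exchange'[of j i m] i j by (simp add: comp_assoc)
      qed
      have "NF m c = (I (Suc (Suc 0)) \<star> ?N) \<cdot> ((J \<star> cyc j (m - 1)) \<cdot> cyc i m)"
        using i j v x d Some split[of j i] by (simp add: NF_Some numeral_2_eq_2)
      then have "(s \<star> I b) \<cdot> NF m c
          = ((s \<star> I b) \<cdot> (I (Suc (Suc 0)) \<star> ?N)) \<cdot> ((J \<star> cyc j (m - 1)) \<cdot> cyc i m)"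
        using i j v d by (simp add: comp_assoc)
      also have "(s \<star> I b) \<cdot> (I (Suc (Suc 0)) \<star> ?N) = (I (Suc (Suc 0)) \<star> ?N) \<cdot> (s \<star> I (m - 2))"
        using v d by (simp add: exchange)
      also have "\<dots> \<cdot> ((J \<star> cyc j (m - 1)) \<cdot> cyc i m)
          = (I (Suc (Suc 0)) \<star> ?N) \<cdot> ((s \<star> I (m - 2)) \<cdot> ((J \<star> cyc j (m - 1)) \<cdot> cyc i m))"
        using i j v by (simp add: comp_assoc)
      also have "\<dots> = (J \<star> ((J \<star> ?N) \<cdot> cyc p (m - 1))) \<cdot> cyc q m"
        unfolding eq split[OF pq] ..
      finally show ?thesis
        using span_Some[OF _ span_Some[OF _ span_NF[of "m - 2" d b], of p], of q] pq i j v d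
        by simp
    qed
  qed
  then show "span m (tgt (s \<star> I b)) ((s \<star> I b) \<cdot> NF m c)" by simp
qed simp

lemma preserves_linear:
  "preserves f \<Longrightarrow> preserves g \<Longrightarrow> src f = src g \<Longrightarrow> tgt f = tgt g \<Longrightarrow> preserves (f \<boxplus> g)"
  "a \<in> carrier R \<Longrightarrow> preserves f \<Longrightarrow> preserves (a \<bullet> f)"
  "preserves (nul k l)"
  unfolding preserves_def using span_typing
  by (simp_all add: comp_linear comp_nul span_add span_scale span_nul)

text \<open>The identities on the right have to be general for tensor products: f \<otimes> g is g
  next to identities on the left, followed by f next to identities on the right. Left identities are
  covered by \<open>preserves_id_tensor\<close>.\<close>

lemma preserves_term: "wf_term R f \<Longrightarrow> preserves (cls f \<star> I b)"
proof (induction f arbitrary: b)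
  case (Comp f g)
  then have "preserves ((cls f \<star> I b) \<cdot> (cls g \<star> I b))"
    by (intro preserves_comp) auto
  with Comp.prems show ?case by (simp add: whisker_right comp_cls)
next
  case (Tensor f g)
  then have "preserves ((cls f \<star> I (target g + b)) \<cdot> (I (source f) \<star> (cls g \<star> I b)))"
    by (intro preserves_comp preserves_id_tensor) auto
  with Tensor.prems show ?case by (simp add: exchange tensor_cls tensor_assoc flip: tensor_cls)
next
  case (Add f g)
  then have "preserves (cls f \<star> I b \<boxplus> cls g \<star> I b)" by (intro preserves_linear) auto
  with Add.prems show ?case by (simp add: tensor_linear flip: add_cls)
next
  case (Scale a f)
  then have "preserves (a \<bullet> (cls f \<star> I b))" by (intro preserves_linear) auto
  with Scale.prems show ?case by (simp add: tensor_linear flip: scale_cls)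
qed (simp_all add: preserves_swap preserves_eta preserves_eps preserves_id preserves_linear
    tensor_id tensor_nul)

lemma span_id: "span n n (I n)"
proof (induction n)
  case 0
  then show ?case using span_NF[of 0 "[]"] by simp
next
  case (Suc n)
  have "cyc 0 (Suc n) = I (Suc n)" by (simp add: cyc_eq tensor_id)
  then show ?case using span_Some[OF _ Suc, of 0] by (simp add: tensor_id)
qed

text \<open>A morphism is its own composite with an identity, and identities lie in the
  span.\<close>

theorem span_all: "mor X \<Longrightarrow> span (src X) (tgt X) X"
  using preserves_term[of _ 0] span_id by (force simp: preserves_def elim: morE)

end

section \<open>Rook diagrams as words\<close>

text \<open>With blocks given as level sets, equality of partitions becomes equality of the kernels
  of two maps.\<close>

definition fibres :: "('a \<Rightarrow> 'b) \<Rightarrow> 'a set \<Rightarrow> 'a set set" where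
  "fibres r V = (\<lambda>x. {y \<in> V. r y = r x}) ` V"

lemma partition_on_fibres: "partition_on V (fibres r V)"
  by (auto simp: partition_on_def fibres_def disjoint_def)

lemma Union_fibres: "\<Union>(fibres r V) = V"
  by (auto simp: fibres_def)

lemma same_block_fibres:
  "x \<in> V \<Longrightarrow> y \<in> V \<Longrightarrow> (\<exists>B\<in>fibres r V. x \<in> B \<and> y \<in> B) \<longleftrightarrow> r x = r y"
  by (auto simp: fibres_def)

lemma partition_on_eqI:
  assumes "partition_on V P" "partition_on V Q"
    and "\<And>x y. x \<in> V \<Longrightarrow> y \<in> V \<Longrightarrow> (\<exists>B\<in>P. x \<in> B \<and> y \<in> B) \<longleftrightarrow> (\<exists>B\<in>Q. x \<in> B \<and> y \<in> B)"
  shows "P = Q"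
proof -
  have "P' \<subseteq> Q'" if P': "partition_on V P'" and Q': "partition_on V Q'"
    and eq: "\<And>x y. x \<in> V \<Longrightarrow> y \<in> V \<Longrightarrow> (\<exists>B\<in>P'. x \<in> B \<and> y \<in> B) \<longleftrightarrow> (\<exists>B\<in>Q'. x \<in> B \<and> y \<in> B)"
    for P' Q'
  proof
    fix B assume B: "B \<in> P'"
    then obtain x where x: "x \<in> B" "x \<in> V"
      using P' by (metis all_not_in_conv partition_onD1 partition_onD3 UnionI)
    then obtain C where C: "C \<in> Q'" "x \<in> C" using Q' by (auto simp: partition_on_def)
    have "B = {y \<in> V. \<exists>B\<in>P'. x \<in> B \<and> y \<in> B}"
      using P' B x by (auto simp: partition_on_def dest: disjointD)
    moreover have "C = {y \<in> V. \<exists>B\<in>Q'. x \<in> B \<and> y \<in> B}"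
      using Q' C by (auto simp: partition_on_def dest: disjointD)
    ultimately have "B = C" using eq x by auto
    with C show "B \<in> Q'" by simp
  qed
  from this[of P Q] this[of Q P] show ?thesis using assms by auto
qed

lemma fibres_cong:
  "(\<And>x y. x \<in> V \<Longrightarrow> y \<in> V \<Longrightarrow> r x = r y \<longleftrightarrow> r' x = r' y) \<Longrightarrow> fibres r V = fibres r' V"
  by (intro partition_on_eqI[OF partition_on_fibres partition_on_fibres])
     (simp add: same_block_fibres)

text \<open>Made for \<open>diagram_star\<close>: blocks of the outer rows are preimages of
  components, and the discarded empty preimages come from components without an outer
  vertex.\<close>

lemma fibres_vimage:
  assumes "\<And>x. h x \<in> V \<longleftrightarrow> x \<in> W"
  shows "{h -` C | C. C \<in> fibres r V} - {{}} = fibres (r \<circ> h) W"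
proof (intro equalityI subsetI)
  fix S assume S: "S \<in> {h -` C | C. C \<in> fibres r V} - {{}}"
  then obtain x z where "S = h -` {y \<in> V. r y = r x}" "z \<in> S" by (auto simp: fibres_def)
  then have "S = {y \<in> W. (r \<circ> h) y = (r \<circ> h) z}" "z \<in> W" using assms by auto
  then show "S \<in> fibres (r \<circ> h) W" unfolding fibres_def by (rule image_eqI)
next
  fix S assume "S \<in> fibres (r \<circ> h) W"
  then obtain z where z: "z \<in> W" "S = {y \<in> W. r (h y) = r (h z)}" by (auto simp: fibres_def)
  then have "S = h -` {y \<in> V. r y = r (h z)}" "{y \<in> V. r y = r (h z)} \<in> fibres r V" "z \<in> S"
    using assms by (auto simp: fibres_def)
  then show "S \<in> {h -` C | C. C \<in> fibres r V} - {{}}" by blast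
qed

section \<open>Rook words and rook diagrams\<close>

text \<open>Entry \<open>a\<close> of the word is the partner of \<open>Top (Suc a)\<close>: positions and letters count from \<open>0\<close>,
  vertices from \<open>1\<close>.\<close>

definition rook_words :: "nat \<Rightarrow> nat \<Rightarrow> word set" where
  "rook_words k l = {u. length u = l \<and> (\<forall>i. Some i \<in> set u \<longrightarrow> i < k) \<and>
     (\<forall>a<l. \<forall>b<l. u ! a = u ! b \<and> u ! a \<noteq> None \<longrightarrow> a = b)}"

text \<open>A representative of the block of a vertex: its bottom vertex if there is one.\<close>

primrec root :: "word \<Rightarrow> vertex \<Rightarrow> vertex" where
  "root u (Bot i) = Bot i"
| "root u (Top j) = (case u ! (j - 1) of None \<Rightarrow> Top j | Some i \<Rightarrow> Bot (Suc i))"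

definition word_diagram :: "nat \<Rightarrow> word \<Rightarrow> vertex set set" where
  "word_diagram k u = fibres (root u) (diagram_vertices k (length u))"

lemma diagram_vertices_iff [simp]:
  "Bot i \<in> diagram_vertices k l \<longleftrightarrow> 1 \<le> i \<and> i \<le> k"
  "Top j \<in> diagram_vertices k l \<longleftrightarrow> 1 \<le> j \<and> j \<le> l"
  by (auto simp: diagram_vertices_def)

lemma rook_wordsD:
  assumes "u \<in> rook_words k l"
  shows "length u = l" "\<And>a i. a < l \<Longrightarrow> u ! a = Some i \<Longrightarrow> i < k"
    "\<And>a b i. a < l \<Longrightarrow> b < l \<Longrightarrow> u ! a = Some i \<Longrightarrow> u ! b = Some i \<Longrightarrow> a = b"
  using assms by (auto simp: rook_words_def, metis nth_mem)

lemma Some_lt_nth: "u \<in> rook_words k l \<Longrightarrow> 1 \<le> j \<Longrightarrow> j \<le> l \<Longrightarrow> u ! (j - 1) = Some i \<Longrightarrow> Suc i \<le> k"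
  using rook_wordsD(2)[of u k l "j - 1" i] by (cases j) auto

lemma root_inj_Top:
  assumes "u \<in> rook_words k l" "1 \<le> a" "a \<le> l" "1 \<le> b" "b \<le> l"
    "root u (Top a) = root u (Top b)"
  shows "a = b"
proof (cases "u ! (a - 1)")
  case None
  with assms(6) show ?thesis by (auto split: option.splits)
next
  case (Some i)
  with assms(6) have "u ! (b - 1) = Some i" by (auto split: option.splits)
  then show ?thesis
    using rook_wordsD(3)[OF assms(1), of "a - 1" "b - 1" i] Some assms(2-5)
    by (cases a; cases b) auto
qed

lemma word_diagram_rook:
  assumes "u \<in> rook_words k l"
  shows "word_diagram k u \<in> rook_diagrams k l"
proof -
  let ?V = "diagram_vertices k l"
  have l: "length u = l" using assms by (rule rook_wordsD)
  have sep: "\<not> same_row x y" if "x \<in> ?V" "y \<in> ?V" "root u x = root u y" "x \<noteq> y" for x y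
  proof
    assume "same_row x y"
    then consider i j where "x = Bot i" "y = Bot j" | i j where "x = Top i" "y = Top j"
      by (cases x; cases y) auto
    then show False
    proof cases
      case 1
      then show False using that by simp
    next
      case 2
      then show False using that root_inj_Top[OF assms, of i j] by (simp del: root.simps)
    qed
  qed
  \<comment> \<open>By the pigeonhole principle, two of any three vertices share a row.\<close>
  have "card B \<le> 2" if B: "B \<subseteq> ?V" "\<And>x y. x \<in> B \<Longrightarrow> y \<in> B \<Longrightarrow> root u x = root u y" for B
  proof (rule ccontr)
    assume "\<not> card B \<le> 2"
    then obtain T where T: "T \<subseteq> B" "card T = 3"
      using obtain_subset_with_card_n[of 3 B] by auto
    then obtain x y z where "T = {x, y, z}" "x \<noteq> y" "y \<noteq> z" "x \<noteq> z"
      by (auto simp: card_3_iff)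
    moreover have "\<not> same_row p q" if "p \<in> B" "q \<in> B" "p \<noteq> q" for p q
      using sep[of p q] B that by blast
    ultimately have "\<not> same_row x y" "\<not> same_row y z" "\<not> same_row x z" using T by simp_all
    then show False by (cases x; cases y; cases z) auto
  qed
  moreover have "B \<subseteq> ?V \<and> (\<forall>x\<in>B. \<forall>y\<in>B. root u x = root u y)" if "B \<in> word_diagram k u" for B
    using that by (auto simp: word_diagram_def fibres_def l)
  moreover have "partition_on ?V (word_diagram k u)"
    by (simp add: word_diagram_def l partition_on_fibres)
  moreover have "\<not> same_row x y" if "B \<subseteq> ?V \<and> (\<forall>x\<in>B. \<forall>y\<in>B. root u x = root u y)"
    "x \<in> B" "y \<in> B" "x \<noteq> y" for B x y
    using that sep[of x y] by blast
  ultimately show ?thesis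
    unfolding rook_diagrams_def partition_diagrams_def mem_Collect_eq by metis
qed

text \<open>The kernel of \<open>root\<close> recovers the word, because \<open>Some i\<close>
  stands at position a exactly if \<open>Top (Suc a)\<close> and \<open>Bot (Suc i)\<close> share a
  block.\<close>

lemma word_diagram_inj:
  assumes u: "u \<in> rook_words k l" and v: "v \<in> rook_words k l"
    and eq: "word_diagram k u = word_diagram k v"
  shows "u = v"
proof -
  have len: "length u = l" "length v = l" using u v rook_wordsD(1) by blast+
  have ker: "root u x = root u y \<longleftrightarrow> root v x = root v y"
    if "x \<in> diagram_vertices k l" "y \<in> diagram_vertices k l" for x y
    using same_block_fibres[OF that, of "root u"] same_block_fibres[OF that, of "root v"] eq len
    by (simp add: word_diagram_def)
  have "u ! a = Some i \<longleftrightarrow> v ! a = Some i" if "a < l" "i < k" for a i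
    using ker[of "Top (Suc a)" "Bot (Suc i)"] that by (auto split: option.splits)
  moreover have "i < k" if "a < l" "u ! a = Some i \<or> v ! a = Some i" for a i
    using that u v rook_wordsD(2) by blast
  ultimately show ?thesis
    using len by (intro nth_equalityI) (auto, metis option.exhaust)
qed

lemma word_diagram_surj:
  assumes D: "D \<in> rook_diagrams k l"
  shows "\<exists>u\<in>rook_words k l. D = word_diagram k u"
proof -
  let ?V = "diagram_vertices k l"
  define R where "R x y \<longleftrightarrow> (\<exists>B\<in>D. x \<in> B \<and> y \<in> B)" for x y
  have part: "partition_on ?V D" using D by (simp add: rook_diagrams_def partition_diagrams_def)
  have R_refl: "R x x" if "x \<in> ?V" for x using that part by (auto simp: R_def partition_on_def)
  have R_sym: "R x y \<Longrightarrow> R y x" for x y by (auto simp: R_def)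
  have R_trans: "R x y \<Longrightarrow> R y z \<Longrightarrow> R x z" for x y z
    using part by (auto simp: R_def partition_on_def dest: disjointD)
  have R_V: "R x y \<Longrightarrow> y \<in> ?V" for x y using part by (auto simp: R_def partition_on_def)
  have R_row: "R x y \<Longrightarrow> same_row x y \<Longrightarrow> x = y" for x y
    using D by (auto simp: R_def rook_diagrams_def)
  \<comment> \<open>The choice has a single candidate, as a block contains at most one bottom
    vertex.\<close>
  define u where
    "u = map (\<lambda>a. if \<exists>i. R (Top (Suc a)) (Bot (Suc i))
       then Some (SOME i. R (Top (Suc a)) (Bot (Suc i))) else None) [0..<l]"
  have len: "length u = l" by (simp add: u_def)
  have u_iff: "u ! a = Some i \<longleftrightarrow> R (Top (Suc a)) (Bot (Suc i))" if a: "a < l" for a i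
  proof
    assume "u ! a = Some i"
    then have "\<exists>i. R (Top (Suc a)) (Bot (Suc i))" "i = (SOME i. R (Top (Suc a)) (Bot (Suc i)))"
      using a by (auto simp: u_def split: if_splits)
    then show "R (Top (Suc a)) (Bot (Suc i))" using someI_ex by metis
  next
    assume R: "R (Top (Suc a)) (Bot (Suc i))"
    then have "R (Top (Suc a)) (Bot (Suc (SOME i. R (Top (Suc a)) (Bot (Suc i)))))"
      by (rule someI)
    with R have "R (Bot (Suc i)) (Bot (Suc (SOME i. R (Top (Suc a)) (Bot (Suc i)))))"
      using R_sym R_trans by blast
    then have "i = (SOME i. R (Top (Suc a)) (Bot (Suc i)))" using R_row by fastforce
    with R a show "u ! a = Some i" by (auto simp: u_def)
  qed
  have "i < k" if "a < l" "u ! a = Some i" for a i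
    using that u_iff R_V by fastforce
  moreover have "a = b" if "a < l" "b < l" "u ! a = Some i" "u ! b = Some i" for a b i
  proof -
    have "R (Top (Suc a)) (Top (Suc b))" using that u_iff R_sym R_trans by metis
    then show ?thesis using R_row by fastforce
  qed
  ultimately have u: "u \<in> rook_words k l"
    unfolding rook_words_def len in_set_conv_nth mem_Collect_eq by (metis option.exhaust)
  have Top_root: "R (Top a) (root u (Top a))" if "1 \<le> a" "a \<le> l" for a
    using u_iff[of "a - 1"] R_refl[of "Top a"] that by (auto split: option.splits)
  have root: "R x (root u x)" if "x \<in> ?V" for x
    using that Top_root R_refl by (cases x) auto
  have "root u x = root u y" if "R x y" "x \<in> ?V" "y \<in> ?V" for x y
  proof (cases x; cases y)
    fix a b assume "x = Bot a" "y = Bot b"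
    then show ?thesis using R_row[OF that(1)] by simp
  next
    fix a b assume "x = Top a" "y = Top b"
    then show ?thesis using R_row[OF that(1)] by simp
  next
    fix a b assume xy: "x = Top a" "y = Bot b"
    then show ?thesis using u_iff[of "a - 1" "b - 1"] that by auto
  next
    fix a b assume xy: "x = Bot a" "y = Top b"
    then show ?thesis using u_iff[of "b - 1" "a - 1"] R_sym[OF that(1)] that by auto
  qed
  moreover have "R x y" if "root u x = root u y" "x \<in> ?V" "y \<in> ?V" for x y
    using root that R_sym R_trans by metis
  ultimately have ker: "R x y \<longleftrightarrow> root u x = root u y" if "x \<in> ?V" "y \<in> ?V" for x y
    using that by blast
  have "D = word_diagram k u"
    unfolding word_diagram_def len
  proof (rule partition_on_eqI[OF part partition_on_fibres])
    fix x y assume "x \<in> ?V" "y \<in> ?V"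
    then show "(\<exists>B\<in>D. x \<in> B \<and> y \<in> B) \<longleftrightarrow> (\<exists>B\<in>fibres (root u) ?V. x \<in> B \<and> y \<in> B)"
      unfolding same_block_fibres[OF \<open>x \<in> ?V\<close> \<open>y \<in> ?V\<close>] using ker[of x y] by (simp only: R_def)
  qed
  with u show ?thesis by blast
qed

lemma finite_rook_words: "finite (rook_words k l)"
proof -
  have "rook_words k l \<subseteq> {u. set u \<subseteq> insert None (Some ` {..<k}) \<and> length u = l}"
    by (auto simp: rook_words_def) (metis option.exhaust image_eqI lessThan_iff)
  then show ?thesis by (rule finite_subset) (simp add: finite_lists_length_eq)
qed

section \<open>Stacking in terms of words\<close>

text \<open>For words read as partial maps, with \<open>None\<close> for undefined, this is the
  composite. For a word w of letters it is the word that the diagram of u makes out of w.\<close>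

definition substitute :: "word \<Rightarrow> word \<Rightarrow> word" where
  "substitute w u = map (\<lambda>x. Option.bind x (nth w)) u"

text \<open>For a word \<open>w\<close> of a diagram placed below \<open>u\<close>, these are the components in the middle row;
  for a word of letters fed into \<open>u\<close>, the positions where \<open>\<epsilon>\<close> meets \<open>\<eta>\<close>.\<close>

definition loose_ends :: "nat \<Rightarrow> word \<Rightarrow> word \<Rightarrow> nat set" where
  "loose_ends k u w = {j. j < k \<and> Some j \<notin> set u \<and> w ! j = None}"

lemma length_substitute [simp]: "length (substitute w u) = length u"
  by (simp add: substitute_def)

lemma nth_substitute [simp]: "a < length u \<Longrightarrow> substitute w u ! a = Option.bind (u ! a) (nth w)"
  by (simp add: substitute_def)

lemma substitute_rook_words:
  assumes u: "u \<in> rook_words k l" and v: "v \<in> rook_words m k"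
  shows "substitute v u \<in> rook_words m l"
proof -
  note [simp] = rook_wordsD(1)[OF u]
  have "i < m" if a: "a < l" "substitute v u ! a = Some i" for a i
  proof -
    obtain p where "u ! a = Some p" "v ! p = Some i"
      using a by (auto simp: bind_eq_Some_conv)
    then show ?thesis using rook_wordsD(2)[OF v, of p i] rook_wordsD(2)[OF u a(1)] by blast
  qed
  moreover have "a = b"
    if ab: "a < l" "b < l" "substitute v u ! a = Some i" "substitute v u ! b = Some i" for a b i
  proof -
    obtain p q where pq: "u ! a = Some p" "v ! p = Some i" "u ! b = Some q" "v ! q = Some i"
      using ab by (auto simp: bind_eq_Some_conv)
    then have "p = q"
      using rook_wordsD(3)[OF v, of p q i] rook_wordsD(2)[OF u] ab by blast
    with pq show ?thesis using rook_wordsD(3)[OF u ab(1,2), of p] by simp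
  qed
  ultimately show ?thesis
    unfolding rook_words_def in_set_conv_nth mem_Collect_eq length_substitute
      rook_wordsD(1)[OF u] by (metis option.exhaust)
qed

text \<open>A canonical element of the component of a vertex in the stacked diagram: follow the edges down
  as far as possible.\<close>

primrec stacked_root :: "word \<Rightarrow> word \<Rightarrow> stacked_vertex \<Rightarrow> stacked_vertex" where
  "stacked_root u v (Lower i) = Lower i"
| "stacked_root u v (Middle j) = place_below (root v (Top j))"
| "stacked_root u v (Upper a) =
     (case u ! (a - 1) of None \<Rightarrow> Upper a | Some j \<Rightarrow> place_below (root v (Top (Suc j))))"

lemma stacked_root_below: "stacked_root u v (place_below x) = place_below (root v x)"
  by (cases x) auto

lemma stacked_root_above: "stacked_root u v (place_above (root u x)) = stacked_root u v (place_above x)"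
  by (cases x) (auto split: option.splits)

lemma root_vertex:
  assumes "u \<in> rook_words k l" "x \<in> diagram_vertices k l"
  shows "root u x \<in> diagram_vertices k l"
  using assms(2) Some_lt_nth[OF assms(1)] by (cases x) (auto split: option.splits)

lemma root_root: "u \<in> rook_words k l \<Longrightarrow> x \<in> diagram_vertices k l \<Longrightarrow> root u (root u x) = root u x"
  by (cases x) (auto split: option.splits)

text \<open>The root is constant along edges, and every vertex reaches its root by at most two
  edges, so the components are the level sets of the root.\<close>

lemma stack_components_word_diagram:
  assumes u: "u \<in> rook_words k l" and v: "v \<in> rook_words m k"
  shows "stack_components (word_diagram k u) (word_diagram m v) =
    fibres (stacked_root u v)
      (place_above ` diagram_vertices k l \<union> place_below ` diagram_vertices m k)"
proof -
  let ?A = "diagram_vertices k l" and ?B = "diagram_vertices m k"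
  let ?V = "place_above ` ?A \<union> place_below ` ?B" and ?r = "stacked_root u v"
  let ?E = "stack_edges (word_diagram k u) (word_diagram m v)"
  note len = rook_wordsD(1)[OF u] rook_wordsD(1)[OF v]
  have E: "?E = {(place_above x, place_above y) | x y. x \<in> ?A \<and> y \<in> ?A \<and> root u x = root u y} \<union>
      {(place_below x, place_below y) | x y. x \<in> ?B \<and> y \<in> ?B \<and> root v x = root v y}"
    unfolding stack_edges_def word_diagram_def fibres_def len by (fastforce simp: image_iff)
  have edge: "?r x = ?r y \<and> x \<in> ?V \<and> y \<in> ?V" if "(x, y) \<in> ?E" for x y
    using that stacked_root_above[of u v] unfolding E
    by (auto simp: stacked_root_below) metis
  have path: "?r x = ?r y \<and> y \<in> ?V" if "(x, y) \<in> ?E\<^sup>*" "x \<in> ?V" for x y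
    using that by (induction rule: rtrancl_induct) (auto dest: edge)
  have below: "(place_below x, ?r (place_below x)) \<in> ?E" if "x \<in> ?B" for x
    unfolding E stacked_root_below using that root_vertex[OF v that] root_root[OF v that] by force
  have to_root: "(x, ?r x) \<in> ?E\<^sup>*" if "x \<in> ?V" for x
    using that
  proof
    assume "x \<in> place_below ` ?B"
    then show ?thesis using below by blast
  next
    assume "x \<in> place_above ` ?A"
    then obtain y where y: "y \<in> ?A" "x = place_above y" by blast
    have e: "(x, place_above (root u y)) \<in> ?E"
      unfolding E using y root_vertex[OF u y(1)] root_root[OF u y(1)] by force
    show ?thesis
    proof (cases "root u y")
      case (Bot j)
      then have "Top j \<in> ?B" using root_vertex[OF u y(1)] by simp
      then have "(place_above (root u y), ?r (place_above (root u y))) \<in> ?E"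
        using below[of "Top j"] Bot by simp
      with e show ?thesis using stacked_root_above[of u v y] y by auto
    next
      case (Top a)
      then have "?r (place_above (root u y)) = place_above (root u y)"
        by (cases y) (auto split: option.splits)
      with e show ?thesis using stacked_root_above[of u v y] y by auto
    qed
  qed
  have "sym ?E" unfolding stack_edges_def sym_def by blast
  then have sym: "sym (?E\<^sup>*)" by (rule sym_rtrancl)
  have "?E\<^sup>* `` {x} = {y \<in> ?V. ?r y = ?r x}" if x: "x \<in> ?V" for x
  proof (intro equalityI subsetI)
    fix y assume "y \<in> ?E\<^sup>* `` {x}"
    then show "y \<in> {y \<in> ?V. ?r y = ?r x}" using path[of x y] x by auto
  next
    fix y assume "y \<in> {y \<in> ?V. ?r y = ?r x}"
    then have "(x, ?r x) \<in> ?E\<^sup>*" "(?r x, y) \<in> ?E\<^sup>*"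
      using to_root[of x] to_root[of y] x symD[OF sym] by auto
    then show "y \<in> ?E\<^sup>* `` {x}" by (simp add: rtrancl_trans)
  qed
  moreover have "\<Union>(word_diagram k u) = ?A" "\<Union>(word_diagram m v) = ?B"
    using len by (simp_all add: word_diagram_def Union_fibres)
  ultimately show ?thesis
    unfolding stack_components_def quotient_def fibres_def by auto
qed

lemma stacked_vertices:
  "place_above ` diagram_vertices k l \<union> place_below ` diagram_vertices m k =
    Lower ` {1..m} \<union> Middle ` {1..k} \<union> Upper ` {1..l}"
  by (auto simp: diagram_vertices_def image_Un image_image)

text \<open>A middle vertex has at most one partner above and at most one below. A component that
  stays in the middle row is therefore a single vertex with neither.\<close>

lemma middle_count_word_diagram:
  assumes u: "u \<in> rook_words k l" and v: "v \<in> rook_words m k"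
  shows "middle_count (word_diagram k u) (word_diagram m v) = card (loose_ends k u v)"
proof -
  let ?V = "Lower ` {1..m} \<union> Middle ` {1..k} \<union> Upper ` {1..l}" and ?r = "stacked_root u v"
  let ?M = "\<lambda>j. {Middle (Suc j)}"
  note len = rook_wordsD(1)[OF u]
  have loose: "{y \<in> ?V. ?r y = ?r (Middle (Suc j))} = ?M j" if j: "j \<in> loose_ends k u v" for j
  proof (intro equalityI subsetI)
    fix y assume y: "y \<in> {y \<in> ?V. ?r y = ?r (Middle (Suc j))}"
    then have r: "?r y = Middle (Suc j)" using j by (simp add: loose_ends_def)
    show "y \<in> ?M j"
    proof (cases y)
      case (Lower i)
      with r show ?thesis by simp
    next
      case (Middle p)
      with r show ?thesis by (auto split: option.splits)
    next
      case (Upper a)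
      with r have "u ! (a - 1) = Some j" by (auto split: option.splits)
      moreover have "a - 1 < length u" using y Upper len by auto
      ultimately show ?thesis using j nth_mem by (fastforce simp: loose_ends_def)
    qed
  next
    fix y assume "y \<in> ?M j"
    then show "y \<in> {y \<in> ?V. ?r y = ?r (Middle (Suc j))}" using j by (auto simp: loose_ends_def)
  qed
  have "{C \<in> fibres ?r ?V. C \<subseteq> range Middle} = ?M ` loose_ends k u v"
  proof (intro equalityI subsetI)
    fix C assume "C \<in> {C \<in> fibres ?r ?V. C \<subseteq> range Middle}"
    then obtain x where x: "x \<in> ?V" "C = {y \<in> ?V. ?r y = ?r x}" and C: "C \<subseteq> range Middle"
      by (auto simp: fibres_def)
    then have "x \<in> range Middle" by blast
    then obtain j where j: "x = Middle (Suc j)" "j < k"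
      using x(1) by (auto simp: image_iff) (metis Suc_le_D Suc_le_lessD)
    have "v ! j = None"
    proof (rule ccontr)
      assume "v ! j \<noteq> None"
      then obtain i where i: "v ! j = Some i" by blast
      then have "Lower (Suc i) \<in> C"
        using x j rook_wordsD(2)[OF v j(2)] by auto
      with C show False by auto
    qed
    moreover have "Some j \<notin> set u"
    proof
      assume "Some j \<in> set u"
      then obtain a where "a < l" "u ! a = Some j" using len by (auto simp: in_set_conv_nth)
      then have "Upper (Suc a) \<in> C" using x j by auto
      with C show False by auto
    qed
    ultimately have "j \<in> loose_ends k u v" using j by (simp add: loose_ends_def)
    then show "C \<in> ?M ` loose_ends k u v" using loose[of j] x j by auto
  next
    fix C assume "C \<in> ?M ` loose_ends k u v"
    then obtain j where j: "j \<in> loose_ends k u v" "C = ?M j" by blast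
    then have "Middle (Suc j) \<in> ?V" by (auto simp: loose_ends_def)
    then have "C \<in> fibres ?r ?V" using loose[OF j(1)] j(2) unfolding fibres_def by blast
    then show "C \<in> {C \<in> fibres ?r ?V. C \<subseteq> range Middle}" using j by auto
  qed
  then have "middle_count (word_diagram k u) (word_diagram m v) = card (?M ` loose_ends k u v)"
    unfolding middle_count_def stack_components_word_diagram[OF u v] stacked_vertices by simp
  also have "\<dots> = card (loose_ends k u v)" by (rule card_image) (auto simp: inj_on_def)
  finally show ?thesis .
qed

lemma diagram_star_word_diagram:
  assumes u: "u \<in> rook_words k l" and v: "v \<in> rook_words m k"
  shows "diagram_star (word_diagram k u) (word_diagram m v) = word_diagram m (substitute v u)"
proof -
  let ?V = "place_above ` diagram_vertices k l \<union> place_below ` diagram_vertices m k"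
  let ?W = "diagram_vertices m l" and ?r = "stacked_root u v"
  note len = rook_wordsD(1)[OF u] rook_wordsD(1)[OF v]
  have outer: "place_outer x \<in> ?V \<longleftrightarrow> x \<in> ?W" for x
    unfolding stacked_vertices by (cases x) auto
  have "diagram_star (word_diagram k u) (word_diagram m v) = fibres (?r \<circ> place_outer) ?W"
    unfolding diagram_star_def stack_components_word_diagram[OF u v]
    by (rule fibres_vimage) (rule outer)
  also have "\<dots> = fibres (root (substitute v u)) ?W"
  proof (rule fibres_cong)
    fix x y assume "x \<in> ?W" "y \<in> ?W"
    let ?c = "substitute v u"
    \<comment> \<open>An upper vertex is isolated, or runs into a dead end in the middle row, or
      reaches the lower row. In the second case the two roots differ, but the kernels agree, because
      distinct upper vertices reach distinct middle ones.\<close>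
    have top: "(?r (Upper a) = Upper a \<and> root ?c (Top a) = Top a \<and> u ! (a - 1) = None) \<or>
        (\<exists>j. u ! (a - 1) = Some j \<and> ?r (Upper a) = Middle (Suc j) \<and> root ?c (Top a) = Top a) \<or>
        (\<exists>i. ?r (Upper a) = Lower (Suc i) \<and> root ?c (Top a) = Bot (Suc i))"
      if "1 \<le> a" "a \<le> l" for a
      using that len by (cases a) (auto split: option.splits)
    have inj: "a = b" if "1 \<le> a" "a \<le> l" "1 \<le> b" "b \<le> l" "u ! (a - 1) = Some j" "u ! (b - 1) = Some j"
      for a b j
      using root_inj_Top[OF u that(1-4)] that(5,6) by simp
    show "(?r \<circ> place_outer) x = (?r \<circ> place_outer) y \<longleftrightarrow> root ?c x = root ?c y"
    proof (cases x)
      case x: (Bot i)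
      show ?thesis
      proof (cases y)
        case (Top b)
        with \<open>y \<in> ?W\<close> top[of b] x show ?thesis by (auto simp del: root.simps(2) stacked_root.simps(3))
      qed (simp add: x)
    next
      case x: (Top a)
      then have a: "1 \<le> a" "a \<le> l" using \<open>x \<in> ?W\<close> by simp_all
      show ?thesis
      proof (cases y)
        case (Bot i)
        with top[OF a] x show ?thesis by (auto simp del: root.simps(2) stacked_root.simps(3))
      next
        case (Top b)
        then have b: "1 \<le> b" "b \<le> l" using \<open>y \<in> ?W\<close> by simp_all
        show ?thesis
        proof (cases "a = b")
          case False
          then have "u ! (a - 1) = Some j \<Longrightarrow> u ! (b - 1) \<noteq> Some j" for j
            using inj[OF a b] by blast
          with False show ?thesis
            using top[OF a] top[OF b] unfolding x Top o_apply place_outer.simps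
            by (elim disjE exE conjE) (simp_all del: root.simps(2) stacked_root.simps(3))
        qed (simp add: x Top)
      qed
    qed
  qed
  finally show ?thesis by (simp add: word_diagram_def len)
qed

section \<open>Juxtaposition and generators in terms of words\<close>

definition juxtapose :: "nat \<Rightarrow> word \<Rightarrow> word \<Rightarrow> word" where
  "juxtapose k u v = u @ map (map_option ((+) k)) v"

lemma juxtapose_rook_words:
  assumes u: "u \<in> rook_words k l" and v: "v \<in> rook_words k' l'"
  shows "juxtapose k u v \<in> rook_words (k + k') (l + l')"
proof -
  note len = rook_wordsD(1)[OF u] rook_wordsD(1)[OF v]
  have nth: "juxtapose k u v ! a = (if a < l then u ! a else map_option ((+) k) (v ! (a - l)))"
    if "a < l + l'" for a
    using that len by (auto simp: juxtapose_def nth_append)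
  have "i < k + k'" if "a < l + l'" "juxtapose k u v ! a = Some i" for a i
    using that rook_wordsD(2)[OF u, of a i] rook_wordsD(2)[OF v, of "a - l" "i - k"]
    by (auto simp: nth split: if_splits)
  moreover have "a = b" if a: "a < l + l'" "b < l + l'"
    "juxtapose k u v ! a = Some i" "juxtapose k u v ! b = Some i" for a b i
  proof (cases "i < k")
    case True
    then have "a < l" "b < l" using a by (auto simp: nth split: if_splits)
    then show ?thesis using a rook_wordsD(3)[OF u, of a b i] by (simp add: nth)
  next
    case False
    then have "\<not> a < l" "\<not> b < l"
      using a rook_wordsD(2)[OF u, of a i] rook_wordsD(2)[OF u, of b i] by (auto simp: nth)
    moreover from this have "a - l = b - l"
      using a by (intro rook_wordsD(3)[OF v, of _ _ "i - k"]) (auto simp: nth)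
    ultimately show ?thesis by simp
  qed
  moreover have "length (juxtapose k u v) = l + l'" using len by (simp add: juxtapose_def)
  ultimately show ?thesis
    unfolding rook_words_def in_set_conv_nth mem_Collect_eq by (metis option.exhaust)
qed

text \<open>On the left vertices the root is that of u, on the shifted ones it is the shifted root
  of v. The two kinds of values are disjoint, so the level sets separate.\<close>

lemma diagram_tensor_word_diagram:
  assumes u: "u \<in> rook_words k l" and v: "v \<in> rook_words k' l'"
  shows "diagram_tensor k l (word_diagram k u) (word_diagram k' v) =
    word_diagram (k + k') (juxtapose k u v)"
proof -
  let ?V1 = "diagram_vertices k l" and ?V2 = "diagram_vertices k' l'"
  let ?V = "diagram_vertices (k + k') (l + l')" and ?c = "juxtapose k u v"
  let ?sh = "shift_vertex k l"
  note len = rook_wordsD(1)[OF u] rook_wordsD(1)[OF v]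
  have V: "?V = ?V1 \<union> ?sh ` ?V2"
  proof (intro equalityI subsetI)
    fix x assume x: "x \<in> ?V"
    show "x \<in> ?V1 \<union> ?sh ` ?V2"
    proof (cases x)
      case (Bot i)
      show ?thesis
      proof (cases "i \<le> k")
        case False
        then have "Bot i = ?sh (Bot (i - k))" "Bot (i - k) \<in> ?V2" using x Bot by auto
        then show ?thesis unfolding Bot by blast
      qed (use x Bot in simp)
    next
      case (Top i)
      show ?thesis
      proof (cases "i \<le> l")
        case False
        then have "Top i = ?sh (Top (i - l))" "Top (i - l) \<in> ?V2" using x Top by auto
        then show ?thesis unfolding Top by blast
      qed (use x Top in simp)
    qed
  next
    fix x assume "x \<in> ?V1 \<union> ?sh ` ?V2"
    then show "x \<in> ?V"
    proof
      assume "x \<in> ?V1"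
      then show ?thesis by (cases x) auto
    next
      assume "x \<in> ?sh ` ?V2"
      then obtain y where "y \<in> ?V2" "x = ?sh y" by blast
      then show ?thesis by (cases y) auto
    qed
  qed
  have root1: "root ?c x = root u x" if "x \<in> ?V1" for x
    using that len by (cases x) (auto simp: juxtapose_def nth_append)
  have root2: "root ?c (?sh x) = ?sh (root v x)" if "x \<in> ?V2" for x
    using that len by (cases x) (auto simp: juxtapose_def nth_append split: option.splits)
  have disj: "?sh x \<notin> ?V1" if "x \<in> ?V2" for x
    using that by (cases x) auto
  have inj: "?sh x = ?sh y \<Longrightarrow> x = y" for x y
    by (cases x; cases y) auto
  have sep: "root ?c x \<noteq> root ?c (?sh y)" if "x \<in> ?V1" "y \<in> ?V2" for x y
    unfolding root1[OF that(1)] root2[OF that(2)]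
    using root_vertex[OF u that(1)] disj[OF root_vertex[OF v that(2)]] by auto
  have F1: "{y \<in> ?V. root ?c y = root ?c x} = {y \<in> ?V1. root u y = root u x}" if x: "x \<in> ?V1" for x
  proof (intro equalityI subsetI)
    fix y assume y: "y \<in> {y \<in> ?V. root ?c y = root ?c x}"
    then have "y \<in> ?V1" unfolding V using sep[OF x] by fastforce
    with y x show "y \<in> {y \<in> ?V1. root u y = root u x}" by (simp add: root1)
  next
    fix y assume "y \<in> {y \<in> ?V1. root u y = root u x}"
    with x show "y \<in> {y \<in> ?V. root ?c y = root ?c x}" by (simp add: root1 V)
  qed
  have F2: "{y \<in> ?V. root ?c y = root ?c (?sh x)} = ?sh ` {y \<in> ?V2. root v y = root v x}"
    if x: "x \<in> ?V2" for x
  proof (intro equalityI subsetI)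
    fix y assume y: "y \<in> {y \<in> ?V. root ?c y = root ?c (?sh x)}"
    then obtain z where z: "z \<in> ?V2" "y = ?sh z" unfolding V using sep[OF _ x] by fastforce
    with y x have "root v z = root v x" by (auto simp: root2 dest: inj)
    with z show "y \<in> ?sh ` {y \<in> ?V2. root v y = root v x}" by auto
  next
    fix y assume "y \<in> ?sh ` {y \<in> ?V2. root v y = root v x}"
    with x show "y \<in> {y \<in> ?V. root ?c y = root ?c (?sh x)}" by (auto simp: root2 V)
  qed
  have "fibres (root ?c) ?V = (\<lambda>x. {y \<in> ?V. root ?c y = root ?c x}) ` ?V1 \<union>
      (\<lambda>x. {y \<in> ?V. root ?c y = root ?c (?sh x)}) ` ?V2"
    unfolding fibres_def by (subst (2) V) (simp add: image_Un image_image)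
  also have "\<dots> = fibres (root u) ?V1 \<union> (\<lambda>B. ?sh ` B) ` fibres (root v) ?V2"
    unfolding fibres_def image_image using F1 F2 by simp
  finally show ?thesis
    using len by (simp add: word_diagram_def diagram_tensor_def juxtapose_def)
qed

definition id_word :: "nat \<Rightarrow> word" where "id_word k = map Some [0..<k]"

lemma id_word_simps [simp]: "length (id_word k) = k" "i < k \<Longrightarrow> id_word k ! i = Some i"
  by (simp_all add: id_word_def)

lemma generator_rook_words:
  "id_word k \<in> rook_words k k" "[Some 1, Some 0] \<in> rook_words 2 2"
  "[None] \<in> rook_words 0 1" "[] \<in> rook_words k 0"
  by (auto simp: rook_words_def id_word_def less_Suc_eq numeral_2_eq_2)

lemma identity_diagram_eq: "identity_diagram k = word_diagram k (id_word k)"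
proof -
  have root: "root (id_word k) (Top i) = Bot i" if "1 \<le> i" "i \<le> k" for i
    using that by (cases i) auto
  let ?V = "diagram_vertices k k"
  have fib: "{y \<in> ?V. root (id_word k) y = Bot i} = {Bot i, Top i}" if i: "1 \<le> i" "i \<le> k" for i
  proof (intro equalityI subsetI)
    fix y assume "y \<in> {y \<in> ?V. root (id_word k) y = Bot i}"
    then show "y \<in> {Bot i, Top i}" using root by (cases y) (auto simp del: root.simps(2))
  next
    fix y assume "y \<in> {Bot i, Top i}"
    then show "y \<in> {y \<in> ?V. root (id_word k) y = Bot i}" using i root by (auto simp del: root.simps(2))
  qed
  have "word_diagram k (id_word k) = (\<lambda>x. {y \<in> ?V. root (id_word k) y = x}) ` root (id_word k) ` ?V"
    by (simp add: word_diagram_def fibres_def image_image)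
  also have "root (id_word k) ` ?V = Bot ` {1..k}"
    unfolding diagram_vertices_def image_Un image_image using root by (auto simp del: root.simps(2))
  also have "(\<lambda>x. {y \<in> ?V. root (id_word k) y = x}) ` Bot ` {1..k} = identity_diagram k"
    unfolding identity_diagram_def image_image Setcompr_eq_image using fib by (auto intro!: image_cong)
  finally show ?thesis ..
qed

lemma generator_diagrams:
  "{{Bot 1, Top 2}, {Bot 2, Top 1}} = word_diagram 2 [Some 1, Some 0]"
  "{{Top 1}} = word_diagram 0 [None]"
  "{{Bot 1}} = word_diagram 1 []"
proof -
  have "{Suc 0..2} = {1, 2}" by auto
  then have V: "diagram_vertices 2 2 = {Bot 1, Bot 2, Top 1, Top 2}"
    "diagram_vertices 0 1 = {Top 1}" "diagram_vertices 1 0 = {Bot 1}"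
    by (auto simp: diagram_vertices_def)
  have len: "length [Some 1, Some (0::nat)] = 2" "length [None :: nat option] = 1"
    "length ([] :: word) = 0" by auto
  show "{{Bot 1, Top 2}, {Bot 2, Top 1}} = word_diagram 2 [Some 1, Some 0]"
    unfolding word_diagram_def len V fibres_def by (auto simp: numeral_2_eq_2)
  show "{{Top 1}} = word_diagram 0 [None]" "{{Bot 1}} = word_diagram 1 []"
    unfolding word_diagram_def len V fibres_def by auto
qed

section \<open>Associativity and the bookkeeping of powers of t\<close>

lemma substitute_assoc:
  assumes "u \<in> rook_words k l" "v \<in> rook_words m k"
  shows "substitute (substitute w v) u = substitute w (substitute v u)"
proof (rule nth_equalityI)
  fix a assume "a < length (substitute (substitute w v) u)"
  then show "substitute (substitute w v) u ! a = substitute w (substitute v u) ! a"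
    using rook_wordsD(1)[OF assms(1)] rook_wordsD(1)[OF assms(2)] rook_wordsD(2)[OF assms(1), of a]
    by (cases "u ! a") auto
qed simp

lemma finite_loose_ends [simp]: "finite (loose_ends k u w)"
  by (simp add: loose_ends_def)

lemma mem_set_substitute:
  "Some i \<in> set (substitute v u) \<longleftrightarrow> (\<exists>j. Some j \<in> set u \<and> v ! j = Some i)"
  unfolding substitute_def set_map image_iff eq_commute[of "Some i"] bind_eq_Some_conv by auto

text \<open>Both sides count components that disappear when three diagrams are stacked.\<close>

lemma card_loose_ends:
  assumes u: "u \<in> rook_words k l" and v: "v \<in> rook_words m k"
  shows "card (loose_ends m v w) + card (loose_ends k u (substitute w v)) =
    card (loose_ends k u v) + card (loose_ends m (substitute v u) w)"
proof -
  \<comment> \<open>Some vanishing components run through both gluing rows: \<open>A\<close> records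
    them by the upper vertex, \<open>B\<close> by the lower one, and \<open>v\<close> matches the
    two.\<close>
  define A where "A = {j. j < k \<and> Some j \<notin> set u \<and> (\<exists>i. v ! j = Some i \<and> w ! i = None)}"
  define B where "B = {i. i < m \<and> Some i \<in> set v \<and> Some i \<notin> set (substitute v u) \<and> w ! i = None}"
  note len = rook_wordsD(1)[OF v]
  have 1: "loose_ends k u (substitute w v) = loose_ends k u v \<union> A"
    using len by (auto simp: loose_ends_def A_def split: bind_splits)
  have 2: "loose_ends m (substitute v u) w = loose_ends m v w \<union> B"
  proof -
    have "Some i \<in> set v" if "Some i \<in> set (substitute v u)" for i
    proof -
      obtain j where j: "Some j \<in> set u" "v ! j = Some i" using \<open>Some i \<in> _\<close> mem_set_substitute by blast
      then obtain a where "a < l" "u ! a = Some j"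
        using rook_wordsD(1)[OF u] by (auto simp: in_set_conv_nth)
      then have "j < k" using rook_wordsD(2)[OF u] by blast
      then show ?thesis using j(2) len nth_mem[of j v] by simp
    qed
    then show ?thesis by (auto simp: loose_ends_def B_def)
  qed
  have "bij_betw (\<lambda>j. the (v ! j)) A B"
  proof (rule bij_betw_imageI)
    show "inj_on (\<lambda>j. the (v ! j)) A"
      using rook_wordsD(3)[OF v] by (intro inj_onI) (auto simp: A_def)
    show "(\<lambda>j. the (v ! j)) ` A = B"
    proof (intro equalityI subsetI)
      fix i assume "i \<in> (\<lambda>j. the (v ! j)) ` A"
      then obtain j where j: "j < k" "Some j \<notin> set u" "v ! j = Some i" "w ! i = None"
        by (auto simp: A_def)
      have "j' = j" if j': "Some j' \<in> set u" "v ! j' = Some i" for j'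
      proof -
        obtain a where "a < l" "u ! a = Some j'"
          using j' rook_wordsD(1)[OF u] by (auto simp: in_set_conv_nth)
        then have "j' < k" using rook_wordsD(2)[OF u] by blast
        then show ?thesis using rook_wordsD(3)[OF v, of j' j i] j' j by simp
      qed
      then have "Some i \<notin> set (substitute v u)" using j(2) mem_set_substitute by blast
      moreover have "i < m" using rook_wordsD(2)[OF v j(1)] j by blast
      moreover have "Some i \<in> set v" using j len nth_mem[of j v] by simp
      ultimately show "i \<in> B" using j by (simp add: B_def)
    next
      fix i assume i: "i \<in> B"
      then obtain j where j: "j < k" "v ! j = Some i" using len by (auto simp: B_def in_set_conv_nth)
      then have "Some j \<notin> set u" using i by (auto simp: B_def mem_set_substitute)
      then have "j \<in> A" using i j by (auto simp: A_def B_def)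
      then show "i \<in> (\<lambda>j. the (v ! j)) ` A" using j by (auto intro!: image_eqI[of _ _ j])
    qed
  qed
  then have "card A = card B" by (rule bij_betw_same_card)
  moreover have "finite A" "finite B" by (auto simp: A_def B_def)
  moreover have "loose_ends k u v \<inter> A = {}" "loose_ends m v w \<inter> B = {}"
    by (auto simp: loose_ends_def A_def B_def)
  ultimately show ?thesis unfolding 1 2 by (simp add: card_Un_disjoint)
qed

lemma substitute_juxtapose:
  assumes "u \<in> rook_words k l" "v \<in> rook_words k' l'" "length w = k" "length w' = k'"
  shows "substitute (w @ w') (juxtapose k u v) = substitute w u @ substitute w' v"
proof (rule nth_equalityI)
  show "length (substitute (w @ w') (juxtapose k u v)) = length (substitute w u @ substitute w' v)"
    by (simp add: juxtapose_def)
next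
  note len = rook_wordsD(1)[OF assms(1)] rook_wordsD(1)[OF assms(2)]
  fix a assume "a < length (substitute (w @ w') (juxtapose k u v))"
  then have a: "a < l + l'" using len by (simp add: juxtapose_def)
  show "substitute (w @ w') (juxtapose k u v) ! a = (substitute w u @ substitute w' v) ! a"
  proof (cases "a < l")
    case True
    then show ?thesis using len assms(3) rook_wordsD(2)[OF assms(1), of a]
      by (cases "u ! a") (auto simp: juxtapose_def nth_append)
  next
    case False
    then show ?thesis using len assms(3) a
      by (cases "v ! (a - l)") (auto simp: juxtapose_def nth_append)
  qed
qed

lemma card_loose_ends_juxtapose:
  assumes u: "u \<in> rook_words k l" and "length w = k"
  shows "card (loose_ends (k + k') (juxtapose k u v) (w @ w')) =
    card (loose_ends k u w) + card (loose_ends k' v w')"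
proof -
  have lt: "i < k" if "Some i \<in> set u" for i
    using that rook_wordsD[OF u] by (auto simp: in_set_conv_nth)
  have mem: "Some i \<in> set (juxtapose k u v) \<longleftrightarrow> Some i \<in> set u \<or> k \<le> i \<and> Some (i - k) \<in> set v" for i
  proof -
    have "Some i = map_option ((+) k) x \<longleftrightarrow> k \<le> i \<and> x = Some (i - k)" for x
      by (cases x) auto
    then show ?thesis by (auto simp: juxtapose_def image_iff)
  qed
  have "loose_ends (k + k') (juxtapose k u v) (w @ w') = loose_ends k u w \<union> (+) k ` loose_ends k' v w'"
  proof (intro equalityI subsetI)
    fix j assume j: "j \<in> loose_ends (k + k') (juxtapose k u v) (w @ w')"
    show "j \<in> loose_ends k u w \<union> (+) k ` loose_ends k' v w'"
    proof (cases "j < k")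
      case True
      with j assms(2) show ?thesis by (simp add: loose_ends_def mem nth_append)
    next
      case False
      with j assms(2) have "j - k \<in> loose_ends k' v w'"
        by (auto simp: loose_ends_def mem nth_append)
      with False show ?thesis by (auto intro!: image_eqI[of _ _ "j - k"])
    qed
  next
    fix j assume "j \<in> loose_ends k u w \<union> (+) k ` loose_ends k' v w'"
    then show "j \<in> loose_ends (k + k') (juxtapose k u v) (w @ w')"
      using assms(2) lt[of j] by (auto simp: loose_ends_def mem nth_append)
  qed
  moreover have "loose_ends k u w \<inter> (+) k ` loose_ends k' v w' = {}"
    by (auto simp: loose_ends_def)
  ultimately show ?thesis by (simp add: card_Un_disjoint card_image)
qed

section \<open>Sums over pairs and sums over fibres\<close>

lemma (in abelian_monoid) finsum_pairs:
  assumes "finite A" "finite B" "\<And>x y. x \<in> A \<Longrightarrow> y \<in> B \<Longrightarrow> F x y \<in> carrier G"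
  shows "finsum G (\<lambda>y. finsum G (\<lambda>x. F x y) A) B = finsum G (\<lambda>(x, y). F x y) (A \<times> B)"
  using assms(2,3)
proof (induction B rule: finite_induct)
  case (insert y B)
  have eq: "A \<times> insert y B = (\<lambda>x. (x, y)) ` A \<union> A \<times> B" by auto
  have "finsum G (\<lambda>(x, y). F x y) (A \<times> insert y B)
      = finsum G (\<lambda>(x, y). F x y) ((\<lambda>x. (x, y)) ` A) \<oplus> finsum G (\<lambda>(x, y). F x y) (A \<times> B)"
    unfolding eq using insert assms(1) by (intro finsum_Un_disjoint) auto
  also have "finsum G (\<lambda>(x, y). F x y) ((\<lambda>x. (x, y)) ` A) = finsum G (\<lambda>x. F x y) A"
    using insert by (subst finsum_reindex) (auto simp: inj_on_def)
  finally show ?case using insert by (simp add: Pi_def)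
qed simp

text \<open>Coefficients of a composite are collected according to the resulting diagram; this
  undoes the collection and returns to a sum over pairs.\<close>

lemma (in cring) finsum_fibres:
  assumes "finite S" "finite T" "p \<in> S \<rightarrow> T" "h \<in> S \<rightarrow> carrier R" "a \<in> T \<rightarrow> carrier R"
  shows "finsum R (\<lambda>e. finsum R h {x \<in> S. p x = e} \<otimes> a e) T = finsum R (\<lambda>x. h x \<otimes> a (p x)) S"
  using assms(1,3,4)
proof (induction S rule: finite_induct)
  case empty
  have "finsum R (\<lambda>e. \<zero> \<otimes> a e) T = finsum R (\<lambda>e. \<zero>) T"
    using assms(5) by (intro finsum_cong') (auto simp: Pi_def)
  then show ?case by simp
next
  case (insert s S)
  have cl: "finsum R h {x \<in> S. p x = e} \<in> carrier R" for e
    using insert by (intro finsum_closed) auto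
  have "finsum R h {x \<in> insert s S. p x = e} \<otimes> a e
      = (if p s = e then h s \<otimes> a e else \<zero>) \<oplus> finsum R h {x \<in> S. p x = e} \<otimes> a e"
    if "e \<in> T" for e
  proof (cases "p s = e")
    case True
    then have "{x \<in> insert s S. p x = e} = insert s {x \<in> S. p x = e}" by auto
    then show ?thesis using insert assms(5) that True cl[of e] by (auto simp: Pi_def l_distr)
  next
    case False
    then have "{x \<in> insert s S. p x = e} = {x \<in> S. p x = e}" by auto
    then show ?thesis using cl[of e] False assms(5) that by (auto simp: Pi_def)
  qed
  then have "finsum R (\<lambda>e. finsum R h {x \<in> insert s S. p x = e} \<otimes> a e) T
      = finsum R (\<lambda>e. (if p s = e then h s \<otimes> a e else \<zero>) \<oplus> finsum R h {x \<in> S. p x = e} \<otimes> a e) T"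
    using insert assms(5) cl by (intro finsum_cong') (auto simp: Pi_def)
  also have "\<dots> = finsum R (\<lambda>e. if p s = e then h s \<otimes> a e else \<zero>) T
      \<oplus> finsum R (\<lambda>e. finsum R h {x \<in> S. p x = e} \<otimes> a e) T"
    using insert assms(5) cl by (intro finsum_addf) (auto simp: Pi_def)
  also have "finsum R (\<lambda>e. if p s = e then h s \<otimes> a e else \<zero>) T = h s \<otimes> a (p s)"
    using insert assms by (intro finsum_singleton) (auto simp: Pi_def)
  finally show ?case using insert assms(5) by (simp add: Pi_def)
qed

section \<open>The functor in terms of the representation\<close>

lemma finite_partition_diagrams: "finite (partition_diagrams k l)"
proof -
  have "finite (diagram_vertices k l)" by (simp add: diagram_vertices_def)
  then have "finite (Pow (Pow (diagram_vertices k l)))" by simp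
  then show ?thesis
    by (rule rev_finite_subset) (auto simp: partition_diagrams_def partition_on_def)
qed

lemma rook_partition: "D \<in> rook_diagrams k l \<Longrightarrow> D \<in> partition_diagrams k l"
  by (simp add: rook_diagrams_def)

context rook_presentation
begin

abbreviation par where "par \<equiv> par_term R t"

text \<open>Images of the functor live on rook diagrams inside the larger partition category. Sums
  over partitions thereby become sums over rook words.\<close>

definition supported :: "nat \<Rightarrow> nat \<Rightarrow> (vertex set set \<Rightarrow> 'a) \<Rightarrow> bool" where
  "supported k l f \<longleftrightarrow> (\<forall>D. f D \<in> carrier R) \<and> (\<forall>D. D \<notin> rook_diagrams k l \<longrightarrow> f D = \<zero>)"

text \<open>Pairs with a partition that is not a rook diagram contribute zero, and the others are
  indexed by pairs of words, since distinct words give distinct diagrams.\<close>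

lemma finsum_rook_pairs:
  assumes cl: "\<And>D D'. h (D, D') \<in> carrier R"
    and zero: "\<And>D D'. D \<notin> rook_diagrams k l \<or> D' \<notin> rook_diagrams m n \<Longrightarrow> h (D, D') = \<zero>"
  shows "finsum R h {(D, D'). D \<in> partition_diagrams k l \<and> D' \<in> partition_diagrams m n \<and> F D D' = E}
    = finsum R (\<lambda>(u, v). h (word_diagram k u, word_diagram m v))
        {x \<in> rook_words k l \<times> rook_words m n. (\<lambda>(u, v). F (word_diagram k u) (word_diagram m v)) x = E}"
    (is "finsum R h ?S = finsum R _ ?T")
proof -
  let ?W = "\<lambda>(u, v). (word_diagram k u, word_diagram m v)"
  have "?S \<subseteq> partition_diagrams k l \<times> partition_diagrams m n" by auto
  then have fin: "finite ?S" by (rule finite_subset) (simp add: finite_partition_diagrams)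
  have "finsum R h ?S = finsum R h (?W ` ?T)"
  proof (rule add.finprod_mono_neutral_cong_right[OF fin])
    show "?W ` ?T \<subseteq> ?S" using word_diagram_rook rook_partition by auto
    show "h x = \<zero>" if x: "x \<in> ?S - ?W ` ?T" for x
    proof (rule ccontr)
      assume "h x \<noteq> \<zero>"
      then have "fst x \<in> rook_diagrams k l" "snd x \<in> rook_diagrams m n"
        using zero[of "fst x" "snd x"] by auto
      then obtain u v where "u \<in> rook_words k l" "fst x = word_diagram k u"
        "v \<in> rook_words m n" "snd x = word_diagram m v"
        using word_diagram_surj by metis
      then have "x = ?W (u, v)" "(u, v) \<in> ?T" using x by (auto simp: prod_eq_iff)
      then show False using x by blast
    qed
  qed (use cl in auto)
  also have "\<dots> = finsum R (\<lambda>x. h (?W x)) ?T"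
  proof (rule finsum_reindex)
    show "inj_on ?W ?T"
    proof (rule inj_onI)
      fix x y assume xy: "x \<in> ?T" "y \<in> ?T" "?W x = ?W y"
      obtain u v u' v' where "x = (u, v)" "y = (u', v')" by (metis surj_pair)
      with xy show "x = y" using word_diagram_inj[of u k l u'] word_diagram_inj[of v m n v'] by simp
    qed
  qed (use cl in auto)
  also have "\<dots> = finsum R (\<lambda>(u, v). h (word_diagram k u, word_diagram m v)) ?T"
    by (rule finsum_cong') (use cl in auto)
  finally show ?thesis .
qed

section \<open>The action of a single diagram\<close>

text \<open>The closed form of \<open>sem\<close> on a single diagram: the pullback of \<phi> along
  the substitution of letters, with a factor t for every letter \<open>None\<close> fed into an
  isolated bottom vertex.\<close>

definition act :: "word \<Rightarrow> (word \<Rightarrow> 'a) \<Rightarrow> word \<Rightarrow> 'a" where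
  "act u \<phi> w = t [^] card (loose_ends (length w) u w) \<otimes> \<phi> (substitute w u)"

lemma act_closed [simp]: "(\<And>v. \<phi> v \<in> carrier R) \<Longrightarrow> act u \<phi> w \<in> carrier R"
  by (simp add: act_def)

text \<open>Pullback reverses the order, so this is the action of u after v, up to the factor in
  \<open>par_comp\<close>. The exponents of t on both sides agree by
  \<open>card_loose_ends\<close>.\<close>

lemma act_comp:
  assumes "u \<in> rook_words k l" "v \<in> rook_words m k" "length w = m" "\<And>v. \<phi> v \<in> carrier R"
  shows "act v (act u \<phi>) w = t [^] card (loose_ends k u v) \<otimes> act (substitute v u) \<phi> w"
  using assms card_loose_ends[OF assms(1,2), of w]
  by (simp add: act_def substitute_assoc nat_pow_mult rook_wordsD(1)[OF assms(2)] flip: m_assoc)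

lemma act_tensor:
  assumes "u \<in> rook_words k l" "v \<in> rook_words k' l'" "length w = k" "length w' = k'"
    "\<And>v. \<phi> v \<in> carrier R"
  shows "act (juxtapose k u v) \<phi> (w @ w') = act u (\<lambda>x. act v (\<lambda>y. \<phi> (x @ y)) w') w"
  using assms
  by (simp add: act_def substitute_juxtapose card_loose_ends_juxtapose nat_pow_mult flip: m_assoc)

lemma finsum_bilinear:
  assumes "finite A" "finite B" "a \<in> A \<rightarrow> carrier R" "b \<in> B \<rightarrow> carrier R"
    "\<And>u v. u \<in> A \<Longrightarrow> v \<in> B \<Longrightarrow> F u v \<in> carrier R"
  shows "finsum R (\<lambda>v. b v \<otimes> finsum R (\<lambda>u. a u \<otimes> F u v) A) B
    = finsum R (\<lambda>(u, v). a u \<otimes> b v \<otimes> F u v) (A \<times> B)"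
proof -
  have "b v \<otimes> finsum R (\<lambda>u. a u \<otimes> F u v) A = finsum R (\<lambda>u. a u \<otimes> b v \<otimes> F u v) A" if "v \<in> B" for v
  proof -
    have "b v \<otimes> finsum R (\<lambda>u. a u \<otimes> F u v) A = finsum R (\<lambda>u. b v \<otimes> (a u \<otimes> F u v)) A"
      using assms that by (intro finsum_rdistr) (auto simp: Pi_def)
    also have "\<dots> = finsum R (\<lambda>u. a u \<otimes> b v \<otimes> F u v) A"
      using assms that by (intro finsum_cong') (auto simp: Pi_def m_ac)
    finally show ?thesis .
  qed
  then have "finsum R (\<lambda>v. b v \<otimes> finsum R (\<lambda>u. a u \<otimes> F u v) A) B
      = finsum R (\<lambda>v. finsum R (\<lambda>u. a u \<otimes> b v \<otimes> F u v) A) B"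
    using assms by (intro finsum_cong') (auto simp: Pi_def intro!: finsum_closed)
  also have "\<dots> = finsum R (\<lambda>(u, v). a u \<otimes> b v \<otimes> F u v) (A \<times> B)"
    using assms by (intro finsum_pairs) (auto simp: Pi_def)
  finally show ?thesis .
qed

section \<open>Linear extension of the action\<close>

definition lin_act :: "nat \<Rightarrow> nat \<Rightarrow> (vertex set set \<Rightarrow> 'a) \<Rightarrow> (word \<Rightarrow> 'a) \<Rightarrow> word \<Rightarrow> 'a" where
  "lin_act k l f \<phi> w = finsum R (\<lambda>u. f (word_diagram k u) \<otimes> act u \<phi> w) (rook_words k l)"

lemma lin_act_closed [simp]:
  "supported k l f \<Longrightarrow> (\<And>v. \<phi> v \<in> carrier R) \<Longrightarrow> lin_act k l f \<phi> w \<in> carrier R"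
  unfolding lin_act_def by (rule finsum_closed) (auto simp: supported_def)

text \<open>Composition and tensor product in the partition category are treated together: both
  extend an operation F on diagrams bilinearly with a factor c, and p is the counterpart of F on
  words. The factor is a power of t for composition and \<one> for the tensor product.\<close>

lemma lin_act_pairs:
  assumes f: "supported k l f" and g: "supported m n g"
    and p: "\<And>u v. u \<in> rook_words k l \<Longrightarrow> v \<in> rook_words m n \<Longrightarrow> p u v \<in> rook_words k' l'"
    and F: "\<And>u v. u \<in> rook_words k l \<Longrightarrow> v \<in> rook_words m n \<Longrightarrow>
      F (word_diagram k u) (word_diagram m v) = word_diagram k' (p u v)"
    and c: "\<And>D D'. c D D' \<in> carrier R"
    and q: "q = (\<lambda>E. finsum R (\<lambda>(D, D'). f D \<otimes> g D' \<otimes> c D D')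
      {(D, D'). D \<in> partition_diagrams k l \<and> D' \<in> partition_diagrams m n \<and> F D D' = E})"
    and \<phi>: "\<And>v. \<phi> v \<in> carrier R"
  shows "supported k' l' q"
    and "lin_act k' l' q \<phi> w = finsum R (\<lambda>(u, v). f (word_diagram k u) \<otimes> g (word_diagram m v)
      \<otimes> (c (word_diagram k u) (word_diagram m v) \<otimes> act (p u v) \<phi> w)) (rook_words k l \<times> rook_words m n)"
proof -
  note [simp] = c \<phi>
  have cl [simp]: "f D \<in> carrier R" "g D \<in> carrier R" for D using f g by (auto simp: supported_def)
  let ?h = "\<lambda>(u, v). f (word_diagram k u) \<otimes> g (word_diagram m v) \<otimes> c (word_diagram k u) (word_diagram m v)"
  let ?S = "rook_words k l \<times> rook_words m n"
  have "q E = finsum R (\<lambda>(u, v). (\<lambda>(D, D'). f D \<otimes> g D' \<otimes> c D D') (word_diagram k u, word_diagram m v))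
      {x \<in> ?S. (\<lambda>(u, v). F (word_diagram k u) (word_diagram m v)) x = E}" for E
    unfolding q using f g by (intro finsum_rook_pairs) (auto simp: supported_def)
  then have q_eq: "q E = finsum R ?h {x \<in> ?S. (\<lambda>(u, v). F (word_diagram k u) (word_diagram m v)) x = E}" for E
    by simp
  show "supported k' l' q"
    unfolding supported_def
  proof (intro conjI allI impI)
    show "q E \<in> carrier R" for E unfolding q_eq by (rule finsum_closed) auto
    show "q E = \<zero>" if "E \<notin> rook_diagrams k' l'" for E
    proof -
      have "{x \<in> ?S. (\<lambda>(u, v). F (word_diagram k u) (word_diagram m v)) x = E} = {}"
        using that F word_diagram_rook[OF p] by auto
      then show ?thesis unfolding q_eq by (simp only: finsum_empty)
    qed
  qed
  have "q (word_diagram k' e) = finsum R ?h {x \<in> ?S. (\<lambda>(u, v). p u v) x = e}"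
    if "e \<in> rook_words k' l'" for e
  proof -
    have "{x \<in> ?S. (\<lambda>(u, v). F (word_diagram k u) (word_diagram m v)) x = word_diagram k' e}
        = {x \<in> ?S. (\<lambda>(u, v). p u v) x = e}"
    proof (rule Collect_cong, rule conj_cong[OF HOL.refl])
      fix x assume "x \<in> ?S"
      then obtain u v where x: "x = (u, v)" "u \<in> rook_words k l" "v \<in> rook_words m n" by blast
      show "(\<lambda>(u, v). F (word_diagram k u) (word_diagram m v)) x = word_diagram k' e
          \<longleftrightarrow> (\<lambda>(u, v). p u v) x = e"
        using word_diagram_inj[OF p[OF x(2,3)] that] by (auto simp: x F)
    qed
    then show ?thesis unfolding q_eq by (simp only:)
  qed
  then have "lin_act k' l' q \<phi> w = finsum R (\<lambda>e. finsum R ?h {x \<in> ?S. (\<lambda>(u, v). p u v) x = e} \<otimes> act e \<phi> w)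
      (rook_words k' l')"
    unfolding lin_act_def by (intro finsum_cong') (auto intro!: finsum_closed)
  also have "\<dots> = finsum R (\<lambda>x. ?h x \<otimes> act ((\<lambda>(u, v). p u v) x) \<phi> w) ?S"
    using p by (intro finsum_fibres) (auto simp: finite_rook_words)
  also have "\<dots> = finsum R (\<lambda>(u, v). f (word_diagram k u) \<otimes> g (word_diagram m v)
      \<otimes> (c (word_diagram k u) (word_diagram m v) \<otimes> act (p u v) \<phi> w)) ?S"
    by (intro finsum_cong') (auto simp: m_assoc)
  finally show "lin_act k' l' q \<phi> w = finsum R (\<lambda>(u, v). f (word_diagram k u) \<otimes> g (word_diagram m v)
      \<otimes> (c (word_diagram k u) (word_diagram m v) \<otimes> act (p u v) \<phi> w)) ?S" .
qed

lemma supported_diagram: "u \<in> rook_words k l \<Longrightarrow> supported k l (par_diagram R (word_diagram k u))"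
  using word_diagram_rook by (auto simp: supported_def par_diagram_def)

lemma lin_act_diagram:
  assumes u: "u \<in> rook_words k l" and "\<And>v. \<phi> v \<in> carrier R"
  shows "lin_act k l (par_diagram R (word_diagram k u)) \<phi> w = act u \<phi> w"
proof -
  have "lin_act k l (par_diagram R (word_diagram k u)) \<phi> w
      = finsum R (\<lambda>v. if u = v then act v \<phi> w else \<zero>) (rook_words k l)"
    unfolding lin_act_def
  proof (intro finsum_cong')
    fix v assume "v \<in> rook_words k l"
    then have "word_diagram k v = word_diagram k u \<longleftrightarrow> u = v" using word_diagram_inj[OF u] by metis
    then show "par_diagram R (word_diagram k u) (word_diagram k v) \<otimes> act v \<phi> w
        = (if u = v then act v \<phi> w else \<zero>)"
      using assms(2) by (simp add: par_diagram_def)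
  qed (use assms(2) in auto)
  also have "\<dots> = act u \<phi> w"
    using assms by (intro finsum_singleton) (auto simp: finite_rook_words)
  finally show ?thesis .
qed


lemma act_linear:
  assumes "finite A" "a \<in> A \<rightarrow> carrier R" "\<And>u x. u \<in> A \<Longrightarrow> G u x \<in> carrier R"
  shows "act v (\<lambda>x. finsum R (\<lambda>u. a u \<otimes> G u x) A) w = finsum R (\<lambda>u. a u \<otimes> act v (G u) w) A"
proof -
  have "act v (\<lambda>x. finsum R (\<lambda>u. a u \<otimes> G u x) A) w
      = finsum R (\<lambda>u. t [^] card (loose_ends (length w) v w) \<otimes> (a u \<otimes> G u (substitute w v))) A"
    unfolding act_def using assms by (intro finsum_rdistr) (auto simp: Pi_def)
  also have "\<dots> = finsum R (\<lambda>u. a u \<otimes> act v (G u) w) A"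
    using assms by (intro finsum_cong') (auto simp: act_def Pi_def m_lcomm)
  finally show ?thesis .
qed

lemma act_cong:
  "(\<And>x. length x = length v \<Longrightarrow> \<phi> x = \<psi> x) \<Longrightarrow> act v \<phi> w = act v \<psi> w"
  by (simp add: act_def)

text \<open>The other side of that comparison: one action nested in another expands into the same
  double sum. \<open>H u\<close> is the action of a single diagram u in the inner argument, which
  for a tensor product also depends on the remaining letters.\<close>

lemma lin_act_lin_act:
  assumes f: "supported k l f" and g: "supported m n g"
    and H: "\<And>u y. u \<in> rook_words k l \<Longrightarrow> H u y \<in> carrier R"
    and \<psi>: "\<And>y. length y = n \<Longrightarrow> \<psi> y = finsum R (\<lambda>u. f (word_diagram k u) \<otimes> H u y) (rook_words k l)"
  shows "lin_act m n g \<psi> w = finsum R (\<lambda>(u, v). f (word_diagram k u) \<otimes> g (word_diagram m v)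
    \<otimes> act v (H u) w) (rook_words k l \<times> rook_words m n)"
proof -
  let ?A = "rook_words k l"
  have cl [simp]: "f D \<in> carrier R" "g D \<in> carrier R" for D using f g by (auto simp: supported_def)
  have act: "act v (H u) w \<in> carrier R" if "u \<in> ?A" for u v using H[OF that] by simp
  have "act v \<psi> w = finsum R (\<lambda>u. f (word_diagram k u) \<otimes> act v (H u) w) ?A"
    if "v \<in> rook_words m n" for v
  proof -
    have "act v \<psi> w = act v (\<lambda>y. finsum R (\<lambda>u. f (word_diagram k u) \<otimes> H u y) ?A) w"
      using rook_wordsD(1)[OF that] \<psi> by (intro act_cong) simp
    also have "\<dots> = finsum R (\<lambda>u. f (word_diagram k u) \<otimes> act v (H u) w) ?A"
      using H by (intro act_linear) (auto simp: finite_rook_words)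
    finally show ?thesis .
  qed
  then have "lin_act m n g \<psi> w = finsum R (\<lambda>v. g (word_diagram m v) \<otimes>
      finsum R (\<lambda>u. f (word_diagram k u) \<otimes> act v (H u) w) ?A) (rook_words m n)"
    unfolding lin_act_def using act by (intro finsum_cong') (auto intro!: finsum_closed)
  also have "\<dots> = finsum R (\<lambda>(u, v). f (word_diagram k u) \<otimes> g (word_diagram m v) \<otimes> act v (H u) w)
      (?A \<times> rook_words m n)"
    using act by (intro finsum_bilinear) (auto simp: finite_rook_words)
  finally show ?thesis .
qed

text \<open>The bridge between functor and representation. The support is part of the induction,
  because only coefficient functions on rook diagrams let the sums over partitions be rewritten over
  words.\<close>

lemma par_sem:
  assumes "wf_term R f"
  shows "supported (source f) (target f) (par f) \<and>
    (\<forall>\<phi> w. (\<forall>v. \<phi> v \<in> carrier R) \<longrightarrow> length w = source f \<longrightarrow>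
      sm f \<phi> w = lin_act (source f) (target f) (par f) \<phi> w)"
  using assms
proof (induction f)
  case (Ident k)
  have "act (id_word k) \<phi> w = \<phi> w" if "length w = k" "\<And>v. \<phi> v \<in> carrier R" for \<phi> w
  proof -
    have "loose_ends k (id_word k) w = {}" by (auto simp: loose_ends_def id_word_def)
    moreover have "substitute w (id_word k) = w"
      using that(1) by (auto intro: nth_equalityI)
    ultimately show ?thesis using that by (simp add: act_def)
  qed
  then show ?case
    using supported_diagram[OF generator_rook_words(1)[of k]]
    by (simp add: identity_diagram_eq lin_act_diagram generator_rook_words)
next
  case Swap
  have "act [Some 1, Some 0] \<phi> w = \<phi> (rev w)" if w: "length w = 2" "\<And>v. \<phi> v \<in> carrier R" for \<phi> w
  proof -
    obtain a b where "w = [a, b]" using w(1) by (auto simp: length_Suc_conv numeral_2_eq_2)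
    moreover have "loose_ends 2 [Some 1, Some 0] w = {}" by (auto simp: loose_ends_def)
    ultimately show ?thesis using w by (simp add: act_def substitute_def numeral_2_eq_2)
  qed
  then show ?case
    using supported_diagram[OF generator_rook_words(2)] lin_act_diagram[OF generator_rook_words(2)]
    unfolding par_term.simps generator_diagrams by simp
next
  case Eta
  have "act [None] \<phi> w = \<phi> [None]" if "length w = 0" "\<And>v. \<phi> v \<in> carrier R" for \<phi> w
    using that by (simp add: act_def loose_ends_def substitute_def)
  then show ?case
    using supported_diagram[OF generator_rook_words(3)] lin_act_diagram[OF generator_rook_words(3)]
    unfolding par_term.simps generator_diagrams by simp
next
  case Eps
  have "act [] \<phi> w = sm Eps \<phi> w" if w: "length w = 1" "\<And>v. \<phi> v \<in> carrier R" for \<phi> w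
  proof -
    obtain a where "w = [a]" using w(1) by (auto simp: length_Suc_conv)
    moreover have "loose_ends 1 [] [a] = (if a = None then {0} else {})" by (auto simp: loose_ends_def)
    ultimately show ?thesis using w by (simp add: act_def substitute_def)
  qed
  then show ?case
    using supported_diagram[OF generator_rook_words(4)] lin_act_diagram[OF generator_rook_words(4)]
    unfolding par_term.simps generator_diagrams by simp
next
  case (Comp f g)
  define k l m where d: "k = source f" "l = target f" "m = source g"
  have ty: "wf_term R f" "wf_term R g" "target g = k" using Comp.prems by (auto simp: d)
  have f: "supported k l (par f)" and g: "supported m k (par g)" using Comp ty by (auto simp: d)
  have sm_f: "sm f \<phi> w = lin_act k l (par f) \<phi> w" if "\<And>v. \<phi> v \<in> carrier R" "length w = k" for \<phi> w
    using Comp ty that by (auto simp: d)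
  have sm_g: "sm g \<phi> w = lin_act m k (par g) \<phi> w" if "\<And>v. \<phi> v \<in> carrier R" "length w = m" for \<phi> w
    using Comp ty that by (auto simp: d)
  note pairs = lin_act_pairs[where p = "\<lambda>u v. substitute v u" and F = diagram_star
      and c = "\<lambda>D D'. t [^] middle_count D D'" and k' = m and l' = l,
      OF f g substitute_rook_words diagram_star_word_diagram _ HOL.refl]
  have par: "par (Comp f g) = (\<lambda>E. finsum R (\<lambda>(D, D'). par f D \<otimes> par g D' \<otimes> t [^] middle_count D D')
      {(D, D'). D \<in> partition_diagrams k l \<and> D' \<in> partition_diagrams m k \<and> diagram_star D D' = E})"
    by (simp add: par_comp_def d)
  have "supported m l (par (Comp f g))"
    unfolding par by (rule pairs(1)[where \<phi> = "\<lambda>_. \<zero>"]) auto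
  moreover have "sm (Comp f g) \<phi> w = lin_act m l (par (Comp f g)) \<phi> w"
    if \<phi>: "\<And>v. \<phi> v \<in> carrier R" and w: "length w = m" for \<phi> w
  proof -
    have "sm (Comp f g) \<phi> w = lin_act m k (par g) (sm f \<phi>) w"
      using sm_g[of "sm f \<phi>" w] ty \<phi> w by simp
    also have "\<dots> = finsum R (\<lambda>(u, v). par f (word_diagram k u) \<otimes> par g (word_diagram m v)
        \<otimes> act v (act u \<phi>) w) (rook_words k l \<times> rook_words m k)"
      using \<phi> sm_f by (intro lin_act_lin_act[OF f g]) (auto simp: lin_act_def)
    also have "\<dots> = lin_act m l (par (Comp f g)) \<phi> w"
      unfolding par using \<phi> f g w
      by (subst pairs(2))
        (auto intro!: finsum_cong' simp: act_comp middle_count_word_diagram supported_def)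
    finally show ?thesis .
  qed
  ultimately show ?case by (auto simp: d simp del: par_term.simps sem.simps)
next
  case (Tensor f g)
  define k l k' l' where d: "k = source f" "l = target f" "k' = source g" "l' = target g"
  have ty: "wf_term R f" "wf_term R g" using Tensor.prems by auto
  have f: "supported k l (par f)" and g: "supported k' l' (par g)" using Tensor ty by (auto simp: d)
  have sm_f: "sm f \<phi> w = lin_act k l (par f) \<phi> w" if "\<And>v. \<phi> v \<in> carrier R" "length w = k" for \<phi> w
    using Tensor ty that by (auto simp: d)
  have sm_g: "sm g \<phi> w = lin_act k' l' (par g) \<phi> w" if "\<And>v. \<phi> v \<in> carrier R" "length w = k'" for \<phi> w
    using Tensor ty that by (auto simp: d)
  note pairs = lin_act_pairs[where p = "juxtapose k" and F = "diagram_tensor k l"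
      and c = "\<lambda>D D'. \<one>" and k' = "k + k'" and l' = "l + l'",
      OF f g juxtapose_rook_words diagram_tensor_word_diagram _ HOL.refl]
  have cl [simp]: "par f D \<in> carrier R" "par g D \<in> carrier R" for D using f g by (auto simp: supported_def)
  \<comment> \<open>The factor \<open>\<one>\<close> puts the tensor product into the shape shared
    with composition.\<close>
  have par: "par (Tensor f g) = (\<lambda>E. finsum R (\<lambda>(D, D'). par f D \<otimes> par g D' \<otimes> \<one>)
      {(D, D'). D \<in> partition_diagrams k l \<and> D' \<in> partition_diagrams k' l' \<and>
        diagram_tensor k l D D' = E})"
    by (simp add: par_tensor_def d)
  have "supported (k + k') (l + l') (par (Tensor f g))"
    unfolding par by (rule pairs(1)[where \<phi> = "\<lambda>_. \<zero>"]) auto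
  moreover have "sm (Tensor f g) \<phi> w = lin_act (k + k') (l + l') (par (Tensor f g)) \<phi> w"
    if \<phi>: "\<And>v. \<phi> v \<in> carrier R" and w: "length w = k + k'" for \<phi> w
  proof -
    define w1 w2 where w12: "w1 = take k w" "w2 = drop k w"
    have len: "length w1 = k" "length w2 = k'" "w = w1 @ w2" using w by (auto simp: w12)
    have "sm (Tensor f g) \<phi> w = sm f (\<lambda>x. sm g (\<lambda>y. \<phi> (x @ y)) w2) w1"
      by (simp add: w12 d)
    \<comment> \<open>With the action of \<open>g\<close> outside, the tensor product nests in the
      same order as a composite.\<close>
    also have "\<dots> = sm g (\<lambda>y. sm f (\<lambda>x. \<phi> (x @ y)) w1) w2"
      using \<phi> ty len by (intro sem_commute) (auto simp: d)
    also have "\<dots> = lin_act k' l' (par g) (\<lambda>y. sm f (\<lambda>x. \<phi> (x @ y)) w1) w2"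
      using sm_g[of "\<lambda>y. sm f (\<lambda>x. \<phi> (x @ y)) w1" w2] ty \<phi> len by simp
    also have "\<dots> = finsum R (\<lambda>(u, v). par f (word_diagram k u) \<otimes> par g (word_diagram k' v)
        \<otimes> act v (\<lambda>y. act u (\<lambda>x. \<phi> (x @ y)) w1) w2) (rook_words k l \<times> rook_words k' l')"
      using \<phi> sm_f len by (intro lin_act_lin_act[OF f g]) (auto simp: lin_act_def)
    also have "\<dots> = lin_act (k + k') (l + l') (par (Tensor f g)) \<phi> w"
      unfolding par len(3) using \<phi> len(1,2)
      by (subst pairs(2))
        (auto intro!: finsum_cong' simp: act_tensor, simp add: act_def m_lcomm)
    finally show ?thesis .
  qed
  ultimately show ?case by (auto simp: d simp del: par_term.simps sem.simps)
next
  case (Zero k l)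
  have "lin_act k l (\<lambda>_. \<zero>) \<phi> w = \<zero>" if "\<And>v. \<phi> v \<in> carrier R" for \<phi> w
  proof -
    have "lin_act k l (\<lambda>_. \<zero>) \<phi> w = finsum R (\<lambda>_. \<zero>) (rook_words k l)"
      unfolding lin_act_def using that by (intro finsum_cong') auto
    then show ?thesis by simp
  qed
  then show ?case by (auto simp: supported_def)
next
  case (Add f g)
  then have s: "supported (source g) (target g) (par f)" "supported (source g) (target g) (par g)"
    by auto
  have cl [simp]: "par f D \<in> carrier R" "par g D \<in> carrier R" for D using s by (auto simp: supported_def)
  have "lin_act (source g) (target g) (\<lambda>D. par f D \<oplus> par g D) \<phi> w
      = lin_act (source g) (target g) (par f) \<phi> w \<oplus> lin_act (source g) (target g) (par g) \<phi> w"
    if "\<And>v. \<phi> v \<in> carrier R" for \<phi> w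
    unfolding lin_act_def using that
    by (subst finsum_addf[symmetric]) (auto intro!: finsum_cong' simp: l_distr)
  with Add s show ?case by (auto simp: supported_def)
next
  case (Scale a f)
  then have s: "supported (source f) (target f) (par f)" and a: "a \<in> carrier R" by auto
  have cl [simp]: "par f D \<in> carrier R" for D using s by (auto simp: supported_def)
  have "lin_act (source f) (target f) (\<lambda>D. a \<otimes> par f D) \<phi> w
      = a \<otimes> lin_act (source f) (target f) (par f) \<phi> w"
    if "\<And>v. \<phi> v \<in> carrier R" for \<phi> w
    unfolding lin_act_def using that a
    by (subst finsum_rdistr) (auto intro!: finsum_cong' simp: m_assoc finite_rook_words)
  with Scale s show ?case by (auto simp: supported_def)
qed

lemma supported_par: "wf_term R f \<Longrightarrow> supported (source f) (target f) (par f)"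
  using par_sem by blast

section \<open>Reading off coefficients\<close>

definition delta :: "word \<Rightarrow> word \<Rightarrow> 'a" where
  "delta u v = (if u = v then \<one> else \<zero>)"

lemma delta_closed [simp]: "delta u v \<in> carrier R"
  by (simp add: delta_def)

text \<open>The identity word has distinct letters and no \<open>None\<close>, so a rook diagram sends it to its own word.\<close>

lemma par_eq_sem:
  assumes "wf_term R f" "u \<in> rook_words (source f) (target f)"
  shows "par f (word_diagram (source f) u) = sm f (delta u) (id_word (source f))"
proof -
  let ?k = "source f"
  have cl [simp]: "par f D \<in> carrier R" for D
    using supported_par[OF assms(1)] by (simp add: supported_def)
  have act: "act v (delta u) (id_word ?k) = delta u v" if "v \<in> rook_words ?k (target f)" for v
  proof -
    have "loose_ends ?k v (id_word ?k) = {}" by (auto simp: loose_ends_def)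
    moreover have "substitute (id_word ?k) v = v"
    proof (rule nth_equalityI)
      fix a assume "a < length (substitute (id_word ?k) v)"
      then show "substitute (id_word ?k) v ! a = v ! a"
        using rook_wordsD[OF that] by (cases "v ! a") auto
    qed simp
    ultimately show ?thesis by (simp add: act_def)
  qed
  have "sm f (delta u) (id_word ?k) = lin_act ?k (target f) (par f) (delta u) (id_word ?k)"
    using par_sem[OF assms(1)] by simp
  also have "\<dots> = finsum R (\<lambda>v. if u = v then par f (word_diagram ?k v) else \<zero>) (rook_words ?k (target f))"
    unfolding lin_act_def by (intro finsum_cong') (auto simp: act delta_def)
  also have "\<dots> = par f (word_diagram ?k u)"
    using assms(2) by (intro finsum_singleton) (auto simp: finite_rook_words)
  finally show ?thesis ..
qed

text \<open>The coefficients at rook diagrams are values of \<open>sem\<close>, which respects the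
  relations, and all others vanish. So the functor is well defined without a check of axioms in the
  partition category.\<close>

theorem par_sound:
  assumes "rook_eq R t f g"
  shows "par f = par g"
proof
  fix D
  note ty = rook_eq_typing[OF assms]
  show "par f D = par g D"
  proof (cases "D \<in> rook_diagrams (source f) (target f)")
    case True
    then obtain u where u: "u \<in> rook_words (source f) (target f)" "D = word_diagram (source f) u"
      using word_diagram_surj by blast
    have "sm f (delta u) (id_word (source f)) = sm g (delta u) (id_word (source f))"
      using assms by (intro sem_sound) auto
    then show ?thesis using par_eq_sem[of f u] par_eq_sem[of g u] u ty by simp
  next
    case False
    then show ?thesis using supported_par[of f] supported_par[of g] ty by (simp add: supported_def)
  qed
qed

end

section \<open>The basis\<close>

text \<open>Turns the relative numbering of a code into letters: w lists the letters not yet used.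
  Codes are thus Lehmer codes of partial injections.\<close>

fun code_word :: "nat option list \<Rightarrow> word \<Rightarrow> word" where
  "code_word [] w = []"
| "code_word (None # c) w = None # code_word c w"
| "code_word (Some i # c) w = w ! i # code_word c (take i w @ drop (Suc i) w)"

lemma set_take_drop:
  assumes "distinct w" "i < length w"
  shows "set (take i w @ drop (Suc i) w) = set w - {w ! i}" "distinct (take i w @ drop (Suc i) w)"
proof -
  have w: "w = take i w @ w ! i # drop (Suc i) w" using assms(2) by (rule id_take_nth_drop)
  define a b x where abx: "a = take i w" "b = drop (Suc i) w" "x = w ! i"
  then have "w = a @ x # b" using w by simp
  with assms(1) have "distinct (a @ b) \<and> set (a @ b) = set w - {x}" by auto
  then show "set (take i w @ drop (Suc i) w) = set w - {w ! i}" "distinct (take i w @ drop (Suc i) w)"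
    by (simp_all add: abx)
qed

lemma length_code_word [simp]: "length (code_word c w) = length c"
  by (induction c w rule: code_word.induct) auto

lemma code_word_props:
  assumes "valid_code m c" "length w = m" "distinct w" "None \<notin> set w"
  shows "set (code_word c w) \<subseteq> insert None (set w) \<and>
    distinct (filter (\<lambda>x. x \<noteq> None) (code_word c w))"
  using assms
proof (induction m c arbitrary: w rule: valid_code.induct)
  case (3 m i c)
  note td = set_take_drop[of w i]
  have i: "i < length w" using 3(2,3) by simp
  have "set (code_word c (take i w @ drop (Suc i) w)) \<subseteq> insert None (set w - {w ! i}) \<and>
    distinct (filter (\<lambda>x. x \<noteq> None) (code_word c (take i w @ drop (Suc i) w)))"
    unfolding td(1)[OF 3(4) i, symmetric]
  proof (rule 3(1))
    show "None \<notin> set (take i w @ drop (Suc i) w)"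
      using 3(5) by (auto dest: in_set_takeD in_set_dropD)
  qed (use 3(2-4) td(2) in auto)
  moreover have "w ! i \<in> set w" using 3 by simp
  ultimately show ?case using 3(5) by auto
qed auto

text \<open>The first letter of the word determines the first entry of the code, since the available
  letters are distinct and differ from \<open>None\<close>; the rest follows with that letter
  removed.\<close>

lemma code_word_inj:
  assumes "valid_code m c" "valid_code m c'" "length w = m" "distinct w" "None \<notin> set w"
    "code_word c w = code_word c' w"
  shows "c = c'"
  using assms
proof (induction m c arbitrary: c' w rule: valid_code.induct)
  case (1 m)
  then show ?case by (metis length_code_word length_0_conv code_word.simps(1))
next
  case (2 m c)
  then obtain x d where c': "c' = x # d" by (metis length_code_word length_Suc_conv length_Cons)
  have "x = None"
  proof (cases x)
    case (Some i)
    then have "w ! i = None" "i < length w" using 2 c' by auto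
    then show ?thesis using 2(6) nth_mem by metis
  qed
  with 2 c' show ?case by auto
next
  case (3 m i c)
  then obtain x d where c': "c' = x # d" by (metis length_code_word length_Suc_conv length_Cons)
  have i: "i < length w" using 3 by simp
  have "x \<noteq> None"
  proof
    assume "x = None"
    then have "w ! i = None" using 3 c' by simp
    then show False using 3(6) i nth_mem by metis
  qed
  then obtain j where x: "x = Some j" by blast
  then have "w ! i = w ! j" "j < length w" using 3 c' by auto
  then have "j = i" using 3(5) i nth_eq_iff_index_eq by metis
  moreover have "c = d"
  proof (rule 3(1)[of d "take i w @ drop (Suc i) w"])
    show "None \<notin> set (take i w @ drop (Suc i) w)" using 3(6) by (auto dest: in_set_takeD in_set_dropD)
  qed (use 3 c' x \<open>j = i\<close> set_take_drop[of w i] in auto)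
  ultimately show ?case using c' x by simp
qed

lemma code_word_surj:
  assumes "set u \<subseteq> insert None (set w)" "distinct (filter (\<lambda>x. x \<noteq> None) u)"
    "distinct w" "None \<notin> set w"
  shows "\<exists>c. valid_code (length w) c \<and> code_word c w = u"
  using assms
proof (induction u arbitrary: w)
  case Nil
  then show ?case by (intro exI[of _ "[]"]) simp
next
  case (Cons x u)
  show ?case
  proof (cases "x = None")
    case True
    then obtain c where "valid_code (length w) c" "code_word c w = u" using Cons by auto
    then show ?thesis using True by (intro exI[of _ "None # c"]) simp
  next
    case False
    then obtain i where i: "i < length w" "w ! i = x"
      using Cons.prems(1) by (auto simp: in_set_conv_nth)
    let ?w = "take i w @ drop (Suc i) w"
    note td = set_take_drop[OF Cons.prems(3) i(1)]
    have "set u \<subseteq> insert None (set ?w)" using Cons.prems(1,2) False unfolding td(1) i(2) by auto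
    then obtain c where "valid_code (length ?w) c" "code_word c ?w = u"
      using Cons.IH[of ?w] Cons.prems td False by auto
    then show ?thesis using i by (intro exI[of _ "Some i # c"]) simp
  qed
qed

lemma distinct_Some_iff:
  "distinct (filter (\<lambda>x. x \<noteq> None) u) \<longleftrightarrow>
    (\<forall>a<length u. \<forall>b<length u. u ! a = u ! b \<and> u ! a \<noteq> None \<longrightarrow> a = b)"
proof (induction u)
  case (Cons x u)
  have "x \<in> set u \<longleftrightarrow> (\<exists>a<length u. u ! a = x)" by (auto simp: in_set_conv_nth)
  then have "(\<forall>a<length (x # u). \<forall>b<length (x # u). (x # u) ! a = (x # u) ! b \<and> (x # u) ! a \<noteq> None \<longrightarrow> a = b)
      \<longleftrightarrow> (x \<noteq> None \<longrightarrow> x \<notin> set u) \<and>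
        (\<forall>a<length u. \<forall>b<length u. u ! a = u ! b \<and> u ! a \<noteq> None \<longrightarrow> a = b)"
    by (simp add: All_less_Suc2, intro iffI conjI) (metis option.distinct(1) option.exhaust)+
  moreover have "distinct (filter (\<lambda>x. x \<noteq> None) (x # u)) \<longleftrightarrow>
      (x \<noteq> None \<longrightarrow> x \<notin> set u) \<and> distinct (filter (\<lambda>x. x \<noteq> None) u)"
    by auto
  ultimately show ?case using Cons by (simp only:)
qed simp

lemma rook_words_iff:
  "u \<in> rook_words k l \<longleftrightarrow> length u = l \<and> set u \<subseteq> insert None (set (id_word k)) \<and>
    distinct (filter (\<lambda>x. x \<noteq> None) u)"
proof -
  have "x \<in> insert None (set (id_word k)) \<longleftrightarrow> (\<forall>i. x = Some i \<longrightarrow> i < k)" for x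
    by (cases x) (auto simp: id_word_def)
  then have "set u \<subseteq> insert None (set (id_word k)) \<longleftrightarrow> (\<forall>i. Some i \<in> set u \<longrightarrow> i < k)"
    unfolding subset_iff by blast
  then show ?thesis unfolding rook_words_def distinct_Some_iff mem_Collect_eq by metis
qed

lemma id_word_props [simp]: "distinct (id_word k)" "None \<notin> set (id_word k)"
  by (auto simp: id_word_def distinct_map)

lemma code_word_rook: "valid_code k c \<Longrightarrow> code_word c (id_word k) \<in> rook_words k (length c)"
  using code_word_props[of k c "id_word k"] by (simp add: rook_words_iff)

definition diagram_code :: "nat \<Rightarrow> nat \<Rightarrow> vertex set set \<Rightarrow> nat option list" where
  "diagram_code k l D =
     (THE c. valid_code k c \<and> length c = l \<and> word_diagram k (code_word c (id_word k)) = D)"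

text \<open>Two bijections are chained: codes with rook words, by decoding against the identity
  word, and rook words with rook diagrams.\<close>

lemma ex1_diagram_code:
  assumes "D \<in> rook_diagrams k l"
  shows "\<exists>!c. valid_code k c \<and> length c = l \<and> word_diagram k (code_word c (id_word k)) = D"
proof -
  obtain u where u: "u \<in> rook_words k l" "D = word_diagram k u" using word_diagram_surj[OF assms] by blast
  then obtain c where "valid_code k c" "code_word c (id_word k) = u"
    using code_word_surj[of u "id_word k"] by (auto simp: rook_words_iff)
  moreover have "length c = l" using calculation u length_code_word rook_wordsD(1) by metis
  moreover have "c1 = c2" if "valid_code k c1" "length c1 = l" "valid_code k c2" "length c2 = l"
    "word_diagram k (code_word c1 (id_word k)) = word_diagram k (code_word c2 (id_word k))" for c1 c2
    using that word_diagram_inj[of "code_word c1 (id_word k)" k l "code_word c2 (id_word k)"]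
      code_word_rook[of k c1] code_word_rook[of k c2] code_word_inj[of k c1 c2 "id_word k"]
    by simp
  ultimately show ?thesis using u by (intro ex_ex1I) blast+
qed

lemmas diagram_code = theI'[OF ex1_diagram_code, folded diagram_code_def]

context rook_presentation
begin

section \<open>Images of the normal forms\<close>

lemma sem_sigma: "length w = Suc n \<Longrightarrow> sm (sigma_term n) \<phi> w = \<phi> (last w # butlast w)"
proof (induction n arbitrary: \<phi> w)
  case 0
  then show ?case by (auto simp: length_Suc_conv)
next
  case (Suc n)
  then obtain a w' where "w = a # w'" "length w' = Suc n" by (auto simp: length_Suc_conv)
  then show ?case using Suc.IH by (auto simp: sigma_term.simps)
qed

lemma sem_cyc:
  assumes "i < m" "length w = m"
  shows "sm (cyc_term i m) \<phi> w = \<phi> (w ! i # take i w @ drop (Suc i) w)"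
  using assms by (simp add: cyc_term_def sem_sigma take_Suc_conv_app_nth)

lemma sem_eps_pow: "None \<notin> set w \<Longrightarrow> length w = m \<Longrightarrow> sm (eps_pow m) \<phi> w = \<phi> []"
proof (induction m arbitrary: w \<phi>)
  case (Suc m)
  then obtain a w' where "w = a # w'" "length w' = m" by (auto simp: length_Suc_conv)
  then show ?case using Suc by auto
qed simp

text \<open>On ordinary letters every \<open>Eps\<close> contributes the factor 1, so a normal form
  merely rearranges and drops letters and inserts \<open>None\<close>.\<close>

lemma sem_nf:
  assumes "valid_code m c" "length w = m" "None \<notin> set w"
  shows "sm (nf_term m c) \<phi> w = \<phi> (code_word c w)"
  using assms
proof (induction m c arbitrary: w \<phi> rule: valid_code.induct)
  case (1 m)
  then show ?case by (simp add: sem_eps_pow)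
next
  case (2 m c)
  then show ?case by (simp add: nf_term.simps)
next
  case (3 m i c)
  then have "None \<notin> set (take i w @ drop (Suc i) w)" by (auto dest: in_set_takeD in_set_dropD)
  with 3 show ?case by (simp add: nf_term.simps sem_cyc)
qed

text \<open>The functor sends normal forms to basis vectors of the partition category. This makes
  them representatives of rook diagrams and also separates them.\<close>

lemma par_nf:
  assumes "valid_code k c"
  shows "par (nf_term k c) = par_diagram R (word_diagram k (code_word c (id_word k)))"
proof
  fix D
  let ?u = "code_word c (id_word k)"
  have u: "?u \<in> rook_words k (length c)" using assms by (rule code_word_rook)
  show "par (nf_term k c) D = par_diagram R (word_diagram k ?u) D"
  proof (cases "D \<in> rook_diagrams k (length c)")
    case True
    then obtain v where v: "v \<in> rook_words k (length c)" "D = word_diagram k v"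
      using word_diagram_surj by blast
    then have "par (nf_term k c) D = delta v ?u"
      using par_eq_sem[of "nf_term k c" v] assms by (simp add: sem_nf)
    then show ?thesis using word_diagram_inj[OF u v(1)] v by (auto simp: delta_def par_diagram_def)
  next
    case False
    then show ?thesis
      using supported_par[of "nf_term k c"] supported_diagram[OF u] assms by (simp add: supported_def)
  qed
qed

lemma rook_to_par_cls: "wf_term R f \<Longrightarrow> rook_to_par R t (cls f) = par f"
proof -
  assume "wf_term R f"
  then have "par ` cls f = {par f}"
    using par_sound mem_cls by (auto simp: mem_cls_iff)
  then show ?thesis by (simp add: rook_to_par_def)
qed

abbreviation val where "val \<equiv> rook_to_par R t"

lemma val_closed [simp]: "mor X \<Longrightarrow> val X D \<in> carrier R"
  using supported_par by (auto elim!: morE simp: rook_to_par_cls supported_def)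

lemma val_linear:
  "mor X \<Longrightarrow> mor Y \<Longrightarrow> src X = src Y \<Longrightarrow> tgt X = tgt Y \<Longrightarrow> val (X \<boxplus> Y) D = val X D \<oplus> val Y D"
  "a \<in> carrier R \<Longrightarrow> mor X \<Longrightarrow> val (a \<bullet> X) D = a \<otimes> val X D"
  "val (nul k l) D = \<zero>"
  by ((elim morE)?, simp add: op_cls rook_to_par_cls)+

section \<open>The Hom-module and its candidate basis\<close>

lemma rook_hom_simps:
  "carrier (rook_hom R t k l) = {X. mor X \<and> src X = k \<and> tgt X = l}"
  "add (rook_hom R t k l) = (\<boxplus>)"
  "smult (rook_hom R t k l) = (\<bullet>)"
  "zero (rook_hom R t k l) = nul k l"
proof -
  show "carrier (rook_hom R t k l) = {X. mor X \<and> src X = k \<and> tgt X = l}"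
    by (auto simp: rook_hom_def mor_def)
qed (rule ext, rule ext | simp add: rook_hom_def add_class_def scale_class_def)+

lemma module_rook_hom: "module R (rook_hom R t k l)"
proof (rule moduleI)
  show "abelian_group (rook_hom R t k l)"
  proof (rule abelian_groupI; unfold rook_hom_simps mem_Collect_eq)
    fix X assume X: "mor X \<and> src X = k \<and> tgt X = l"
    have "X \<boxplus> nul k l = X" using add_class_simps(3)[of X] X by simp
    then show "nul k l \<boxplus> X = X" using add_class_simps(2)[of X "nul k l"] X by simp
    have "X \<boxplus> (\<ominus> \<one>) \<bullet> X = nul k l" using add_class_simps(4)[of X] X by simp
    then have "(\<ominus> \<one>) \<bullet> X \<boxplus> X = nul k l"
      using add_class_simps(2)[of X "(\<ominus> \<one>) \<bullet> X"] X by simp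
    then show "\<exists>Y\<in>{X. mor X \<and> src X = k \<and> tgt X = l}. Y \<boxplus> X = nul k l"
      using X by (intro bexI[of _ "(\<ominus> \<one>) \<bullet> X"]) simp_all
  qed (simp, simp, simp add: add_class_simps(1), rule add_class_simps(2), simp_all)
qed (auto simp: rook_hom_simps add_class_simps(5-8) is_cring)

definition basis_mor :: "nat \<Rightarrow> nat \<Rightarrow> vertex set set \<Rightarrow> 'a rook_term set" where
  "basis_mor k l D = NF k (diagram_code k l D)"

lemma basis_mor:
  assumes "D \<in> rook_diagrams k l"
  shows "mor (basis_mor k l D)" "src (basis_mor k l D) = k" "tgt (basis_mor k l D) = l"
    "val (basis_mor k l D) = par_diagram R D"
  using diagram_code[OF assms] by (simp_all add: basis_mor_def rook_to_par_cls par_nf)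

lemma NF_basis_mor:
  assumes "valid_code k c" "length c = l"
  shows "\<exists>D\<in>rook_diagrams k l. NF k c = basis_mor k l D"
proof -
  let ?D = "word_diagram k (code_word c (id_word k))"
  have D: "?D \<in> rook_diagrams k l"
    using word_diagram_rook[OF code_word_rook[OF assms(1)]] assms(2) by simp
  then have "c = diagram_code k l ?D" using ex1_diagram_code[OF D] diagram_code[OF D] assms by blast
  with D show ?thesis by (metis basis_mor_def)
qed

section \<open>Linear combinations of diagram morphisms\<close>

definition combination ::
    "nat \<Rightarrow> nat \<Rightarrow> (vertex set set \<Rightarrow> 'a) \<Rightarrow> vertex set set set \<Rightarrow> 'a rook_term set" where
  "combination k l c S = finsum (rook_hom R t k l) (\<lambda>D. c D \<bullet> basis_mor k l D) S"

lemma finite_rook_diagrams: "finite (rook_diagrams k l)"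
  using finite_partition_diagrams by (rule rev_finite_subset) (auto simp: rook_diagrams_def)

text \<open>The functor recovers the coefficients of a combination, because it maps the diagram
  morphisms to basis vectors. Linear independence is immediate, and faithfulness follows together
  with spanning.\<close>

lemma combination_val:
  assumes "finite S" "S \<subseteq> rook_diagrams k l" "c \<in> S \<rightarrow> carrier R"
  shows "combination k l c S \<in> carrier (rook_hom R t k l) \<and>
    (\<forall>E. val (combination k l c S) E = (if E \<in> S then c E else \<zero>))"
  using assms
proof (induction S rule: finite_induct)
  case empty
  interpret M: module R "rook_hom R t k l" by (rule module_rook_hom)
  show ?case by (simp add: combination_def) (simp add: rook_hom_simps val_linear)
next
  case (insert D S)
  interpret M: module R "rook_hom R t k l" by (rule module_rook_hom)
  have summand: "c D' \<bullet> basis_mor k l D' \<in> carrier (rook_hom R t k l)" if "D' \<in> insert D S" for D'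
  proof -
    have "c D' \<in> carrier R" "D' \<in> rook_diagrams k l" using that insert.prems by auto
    then show ?thesis by (simp add: rook_hom_simps basis_mor)
  qed
  have IH: "combination k l c S \<in> carrier (rook_hom R t k l)"
    "\<And>E. val (combination k l c S) E = (if E \<in> S then c E else \<zero>)"
    using insert by auto
  have eq: "combination k l c (insert D S) = c D \<bullet> basis_mor k l D \<boxplus> combination k l c S"
    unfolding combination_def using insert.hyps summand
    by (subst M.finsum_insert) (auto simp: rook_hom_simps)
  have "c D \<in> carrier R" "D \<in> rook_diagrams k l" "\<And>E. E \<in> S \<Longrightarrow> c E \<in> carrier R"
    using insert.prems by auto
  with insert.hyps IH show ?case unfolding eq
    by (auto simp: rook_hom_simps val_linear basis_mor par_diagram_def)
qed

text \<open>All sums run over the full finite set of rook diagrams, so that addition and scaling act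
  on the coefficients pointwise.\<close>

lemma combination_all:
  assumes "span k l X"
  shows "\<exists>c. c \<in> rook_diagrams k l \<rightarrow> carrier R \<and> X = combination k l c (rook_diagrams k l)"
  using assms
proof (induction rule: span.induct)
  case (span_NF k c l)
  interpret M: module R "rook_hom R t k l" by (rule module_rook_hom)
  obtain D where D: "D \<in> rook_diagrams k l" "NF k c = basis_mor k l D"
    using NF_basis_mor span_NF by blast
  have "combination k l (\<lambda>E. if D = E then \<one> else \<zero>) (rook_diagrams k l)
      = finsum (rook_hom R t k l) (\<lambda>E. if D = E then basis_mor k l E else \<zero>\<^bsub>rook_hom R t k l\<^esub>) (rook_diagrams k l)"
    unfolding combination_def
    by (intro M.finsum_cong') (auto simp: rook_hom_simps basis_mor add_class_simps scale_zero)
  also have "\<dots> = basis_mor k l D"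
    using D by (intro M.finsum_singleton) (auto simp: finite_rook_diagrams rook_hom_simps basis_mor)
  finally show ?case using D by (intro exI[of _ "\<lambda>E. if D = E then \<one> else \<zero>"]) auto
next
  case (span_nul k l)
  interpret M: module R "rook_hom R t k l" by (rule module_rook_hom)
  have "combination k l (\<lambda>_. \<zero>) (rook_diagrams k l)
      = finsum (rook_hom R t k l) (\<lambda>_. \<zero>\<^bsub>rook_hom R t k l\<^esub>) (rook_diagrams k l)"
    unfolding combination_def
    by (intro M.finsum_cong') (auto simp: rook_hom_simps basis_mor scale_zero)
  also have "\<dots> = nul k l" using M.finsum_zero by (simp add: rook_hom_simps)
  finally show ?case by (intro exI[of _ "\<lambda>_. \<zero>"]) auto
next
  case (span_add k l X Y)
  interpret M: module R "rook_hom R t k l" by (rule module_rook_hom)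
  obtain c d where c: "c \<in> rook_diagrams k l \<rightarrow> carrier R" "X = combination k l c (rook_diagrams k l)"
    and d: "d \<in> rook_diagrams k l \<rightarrow> carrier R" "Y = combination k l d (rook_diagrams k l)"
    using span_add by blast
  have "combination k l (\<lambda>D. c D \<oplus> d D) (rook_diagrams k l) = finsum (rook_hom R t k l)
      (\<lambda>D. (c D \<bullet> basis_mor k l D) \<oplus>\<^bsub>rook_hom R t k l\<^esub> (d D \<bullet> basis_mor k l D)) (rook_diagrams k l)"
    unfolding combination_def using c(1) d(1)
    by (intro M.finsum_cong') (auto simp: rook_hom_simps basis_mor add_class_simps Pi_def)
  also have "\<dots> = X \<boxplus> Y"
    unfolding c(2) d(2) combination_def using c(1) d(1)
    by (subst M.finsum_addf) (auto simp: rook_hom_simps basis_mor Pi_def)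
  finally show ?case using c(1) d(1) by (intro exI[of _ "\<lambda>D. c D \<oplus> d D"]) auto
next
  case (span_scale a k l X)
  interpret M: module R "rook_hom R t k l" by (rule module_rook_hom)
  obtain c where c: "c \<in> rook_diagrams k l \<rightarrow> carrier R" "X = combination k l c (rook_diagrams k l)"
    using span_scale by blast
  have "combination k l (\<lambda>D. a \<otimes> c D) (rook_diagrams k l) = finsum (rook_hom R t k l)
      (\<lambda>D. a \<odot>\<^bsub>rook_hom R t k l\<^esub> (c D \<bullet> basis_mor k l D)) (rook_diagrams k l)"
    unfolding combination_def using c(1) span_scale(1)
    by (intro M.finsum_cong') (auto simp: rook_hom_simps basis_mor add_class_simps Pi_def)
  also have "\<dots> = a \<odot>\<^bsub>rook_hom R t k l\<^esub> X"
    unfolding c(2) combination_def using c(1) span_scale(1)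
    by (subst M.finsum_smult_ldistr) (auto simp: rook_hom_simps basis_mor Pi_def finite_rook_diagrams)
  finally show ?case using c(1) span_scale(1)
    by (intro exI[of _ "\<lambda>D. a \<otimes> c D"]) (auto simp: rook_hom_simps)
qed

lemma combination_carrier:
  assumes "X \<in> carrier (rook_hom R t k l)"
  shows "\<exists>c. c \<in> rook_diagrams k l \<rightarrow> carrier R \<and> X = combination k l c (rook_diagrams k l)"
proof (rule combination_all)
  show "span k l X" using assms span_all[of X] by (auto simp: rook_hom_simps)
qed

text \<open>Faithfulness of the functor: both morphisms are combinations of diagram morphisms, and
  their images reveal the coefficients.\<close>

lemma val_inj:
  assumes X: "X \<in> carrier (rook_hom R t k l)" and Y: "Y \<in> carrier (rook_hom R t k l)"
    and eq: "val X = val Y"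
  shows "X = Y"
proof -
  interpret M: module R "rook_hom R t k l" by (rule module_rook_hom)
  let ?I = "rook_diagrams k l"
  obtain c d where c: "c \<in> ?I \<rightarrow> carrier R" "X = combination k l c ?I"
    and d: "d \<in> ?I \<rightarrow> carrier R" "Y = combination k l d ?I"
    using combination_carrier[OF X] combination_carrier[OF Y] by blast
  have "c D = d D" if "D \<in> ?I" for D
    using combination_val[OF finite_rook_diagrams subset_refl c(1)]
      combination_val[OF finite_rook_diagrams subset_refl d(1)] that eq c(2) d(2) by metis
  then show ?thesis
    unfolding c(2) d(2) combination_def using d(1)
    by (intro M.finsum_cong') (auto simp: rook_hom_simps basis_mor Pi_def)
qed

text \<open>Uniqueness is faithfulness of the functor; existence comes from the normal form, which
  is itself a diagrammatic expression.\<close>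

lemma represents_iff:
  assumes D: "D \<in> rook_diagrams k l"
  shows "represents R t k l X D \<longleftrightarrow> X = basis_mor k l D"
proof
  assume "represents R t k l X D"
  then show "X = basis_mor k l D"
    by (intro val_inj[of _ k l]) (auto simp: represents_def rook_hom_simps basis_mor[OF D])
next
  assume X: "X = basis_mor k l D"
  have "nf_term k (diagram_code k l D) \<in> basis_mor k l D"
    unfolding basis_mor_def using diagram_code[OF D] by (intro mem_cls) simp
  then have "\<exists>f\<in>X. diagrammatic f" using X diagrammatic_nf_term by blast
  then show "represents R t k l X D"
    by (simp add: represents_def X rook_hom_simps basis_mor[OF D])
qed

end

theorem theorem5p12:
  fixes R :: "('a, 'm) ring_scheme" and t :: 'a and k l :: nat
  assumes "cring R" and "t \<in> carrier R"
  shows "(\<forall>D\<in>rook_diagrams k l. \<exists>!X. represents R t k l X D) \<and>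
         module_basis R (rook_hom R t k l) (rook_diagrams k l) (diagram_morphism R t k l)"
proof
  interpret rook_presentation R t
    using assms by (simp add: rook_presentation_def rook_presentation_axioms_def)
  let ?I = "rook_diagrams k l" and ?M = "rook_hom R t k l" and ?b = "diagram_morphism R t k l"
  interpret M: module R ?M by (rule module_rook_hom)
  show "\<forall>D\<in>?I. \<exists>!X. represents R t k l X D" by (simp add: represents_iff)
  have b: "?b D = basis_mor k l D" if "D \<in> ?I" for D
    using that by (simp add: diagram_morphism_def represents_iff)
  have sum: "(\<Oplus>\<^bsub>?M\<^esub>D\<in>S. c D \<odot>\<^bsub>?M\<^esub> ?b D) = combination k l c S"
    if "S \<subseteq> ?I" "c \<in> S \<rightarrow> carrier R" for S c
    unfolding combination_def using that
    by (intro M.finsum_cong') (auto simp: rook_hom_simps b basis_mor subset_iff Pi_def)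
  show "module_basis R ?M ?I ?b"
    unfolding module_basis_def
  proof (intro conjI ballI allI impI)
    show "module R ?M" by (rule module_rook_hom)
    show "?b \<in> ?I \<rightarrow> carrier ?M" by (auto simp: b rook_hom_simps basis_mor)
  next
    fix S c D
    assume S: "finite S \<and> S \<subseteq> ?I \<and> c \<in> S \<rightarrow> carrier R \<and>
        (\<Oplus>\<^bsub>?M\<^esub>D\<in>S. c D \<odot>\<^bsub>?M\<^esub> ?b D) = \<zero>\<^bsub>?M\<^esub>" and D: "D \<in> S"
    then have "combination k l c S = nul k l" using sum[of S c] by (simp add: rook_hom_simps)
    \<comment> \<open>The image of the sum has the coefficient \<open>c D\<close> at the diagram
      \<open>D\<close>, and the image of zero has the coefficient zero there.\<close>
    then show "c D = \<zero>\<^bsub>R\<^esub>"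
      using combination_val[of S k l c] S D val_linear(3)[of k l D] by auto
  next
    fix X assume "X \<in> carrier ?M"
    then obtain c where c: "c \<in> ?I \<rightarrow> carrier R" "X = combination k l c ?I"
      using combination_carrier by blast
    show "\<exists>S c. finite S \<and> S \<subseteq> ?I \<and> c \<in> S \<rightarrow> carrier R \<and>
        X = (\<Oplus>\<^bsub>?M\<^esub>D\<in>S. c D \<odot>\<^bsub>?M\<^esub> ?b D)"
      unfolding c(2) sum[OF subset_refl c(1), symmetric]
      by (rule exI[of _ ?I], rule exI[of _ c]) (use c(1) finite_rook_diagrams in simp)
  qed
qed

end
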